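(* Let $(M,\nabla)$ be a smooth manifold with linear connection whose tangent bundle decomposes as the direct sum $TM=H\oplus V$ of two distributions $H$ and $V$. Choose any $q\in M$, and for any tangent vector $(X,Y)\in H_q\oplus V_q=T_qM$ define $\gamma_{(X,Y)}$ to be the curve on $M$ satisfying $$D_t^2\,\dot\gamma_{(X,Y)}=0,\qquad \gamma_{(X,Y)}(0)=q,\qquad \dot\gamma_{(X,Y)}(0)=X,\qquad D_t\dot\gamma_{(X,Y)}(0)=Y.$$ Then there are neighborhoods $\mathcal{O}$ of $0$ in $T_qM$ and $\mathcal{O}_M$ of $q$ in $M$ such that the function $\Psi:\mathcal{O}\to\mathcal{O}_M$, $\Psi(X,Y)=\gamma_{(X,Y)}(1)$, is a diffeomorphism, and $\Psi$ satisfies the parabolic scaling $\Psi(tX,t^2Y)=\gamma_{(X,Y)}(t)$ wherever either side is defined.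
   Context: For a curve $\gamma$ on $M$ and a vector field $Z$ along $\gamma$, $D_tZ$ denotes the covariant derivative of $Z$ along $\gamma$ with respect to $\nabla$, and $D_t^2=D_t\circ D_t$. The curve $\gamma_{(X,Y)}$ is taken to be the maximal solution of the stated initial value problem, a third-order ODE system. In the scaling identity, $\Psi(X,Y)$ means $\gamma_{(X,Y)}(1)$ whenever this is defined. Distributions are smooth subbundles of $TM$. *)

theory Defs
  imports "HOL-Analysis.Analysis"
begin

section \<open>Smooth maps between open subsets of Euclidean spaces\<close>

text \<open>These two predicates are only meant for open sets \<open>S\<close>.  A function is of class
  \<open>C\<^sup>k\<^sup>+\<^sup>1\<close> if it is differentiable and all its directional derivatives are of class \<open>C\<^sup>k\<close>.\<close>

primrec Ck_on ::
    "nat \<Rightarrow> 'a::real_normed_vector set \<Rightarrow> ('a \<Rightarrow> 'b::real_normed_vector) \<Rightarrow> bool" where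
  "Ck_on 0 S f \<longleftrightarrow> continuous_on S f"
| "Ck_on (Suc k) S f \<longleftrightarrow>
     f differentiable_on S \<and> (\<forall>v. Ck_on k S (\<lambda>x. frechet_derivative f (at x) v))"

definition smooth_on ::
    "'a::real_normed_vector set \<Rightarrow> ('a \<Rightarrow> 'b::real_normed_vector) \<Rightarrow> bool" where
  "smooth_on S f \<longleftrightarrow> (\<forall>k. Ck_on k S f)"

section \<open>Smooth manifolds\<close>

text \<open>The manifold is the whole type \<open>'m\<close>, modelled on \<open>'e\<close>.  A chart is a pair of its domain
  and its coordinate map; values of the coordinate map outside the domain are irrelevant.
  The smooth structure is given by an arbitrary, not necessarily maximal, smooth atlas.\<close>

type_synonym ('m, 'e) chart = "'m set \<times> ('m \<Rightarrow> 'e)"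

definition chart_inv :: "('m, 'e) chart \<Rightarrow> 'e \<Rightarrow> 'm" where
  "chart_inv c = inv_into (fst c) (snd c)"

definition is_chart :: "('m::topological_space, 'e::euclidean_space) chart \<Rightarrow> bool" where
  "is_chart c \<longleftrightarrow> open (fst c) \<and> open (snd c ` fst c) \<and>
     homeomorphism (fst c) (snd c ` fst c) (snd c) (chart_inv c)"

definition smooth_manifold ::
    "('m::{t2_space,second_countable_topology}, 'e::euclidean_space) chart set \<Rightarrow> bool" where
  "smooth_manifold A \<longleftrightarrow>
     (\<forall>c\<in>A. is_chart c) \<and> (\<Union>c\<in>A. fst c) = UNIV \<and>
     (\<forall>c\<in>A. \<forall>d\<in>A. smooth_on (snd c ` (fst c \<inter> fst d)) (snd d \<circ> chart_inv c))"

text \<open>Smooth maps from an open subset \<open>W\<close> of the manifold to a vector space, and from an open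
  subset \<open>S\<close> of a normed space to the manifold.  The latter covers curves (\<open>S\<close> an open
  interval) as well as maps defined on open subsets of a tangent space.\<close>

definition smooth_from ::
    "('m, 'e::euclidean_space) chart set \<Rightarrow> 'm set \<Rightarrow> ('m \<Rightarrow> 'b::real_normed_vector) \<Rightarrow> bool" where
  "smooth_from A W f \<longleftrightarrow> (\<forall>c\<in>A. smooth_on (snd c ` (fst c \<inter> W)) (f \<circ> chart_inv c))"

definition smooth_into ::
    "('m::topological_space, 'e::euclidean_space) chart set \<Rightarrow> 'a::real_normed_vector set
      \<Rightarrow> ('a \<Rightarrow> 'm) \<Rightarrow> bool" where
  "smooth_into A S f \<longleftrightarrow>
     continuous_on S f \<and> (\<forall>c\<in>A. smooth_on {x \<in> S. f x \<in> fst c} (snd c \<circ> f))"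

definition diffeomorphism_into ::
    "('m::topological_space, 'e::euclidean_space) chart set \<Rightarrow> 'a::real_normed_vector set
      \<Rightarrow> 'm set \<Rightarrow> ('a \<Rightarrow> 'm) \<Rightarrow> bool" where
  "diffeomorphism_into A S W f \<longleftrightarrow>
     bij_betw f S W \<and> smooth_into A S f \<and> smooth_from A W (inv_into S f)"

section \<open>Tangent vectors and vector fields\<close>

text \<open>A tangent vector at \<open>p\<close> is a class of pairs (chart around \<open>p\<close>, coordinate vector) under
  the usual transformation law.  Every class has exactly one representative in the chart
  \<open>chart_at A p\<close> selected at \<open>p\<close>, so the tangent space at \<open>p\<close> is taken to be the vector space
  \<open>'e\<close>, an element being the coordinate vector with respect to \<open>chart_at A p\<close>.  In particular
  the vector space structure, topology and smooth structure of a tangent space are those of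
  \<open>'e\<close>.  Since the selected chart may jump from point to point, a vector field
  \<open>X :: 'm \<Rightarrow> 'e\<close> is smooth when its coordinates in the charts of the atlas are smooth, not when
  \<open>X\<close> is smooth as an \<open>'e\<close>-valued map.\<close>

definition chart_at :: "('m, 'e) chart set \<Rightarrow> 'm \<Rightarrow> ('m, 'e) chart" where
  "chart_at A p = (SOME c. c \<in> A \<and> p \<in> fst c)"

text \<open>Derivative at \<open>p\<close>, applied to the tangent vector \<open>v\<close>, of a vector-valued map \<open>f\<close> defined
  near \<open>p\<close>.\<close>

definition tangent_deriv ::
    "('m, 'e::euclidean_space) chart set \<Rightarrow> ('m \<Rightarrow> 'b::real_normed_vector) \<Rightarrow> 'm \<Rightarrow> 'e \<Rightarrow> 'b" where
  "tangent_deriv A f p v =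
     frechet_derivative (f \<circ> chart_inv (chart_at A p)) (at (snd (chart_at A p) p)) v"

text \<open>The coordinates in the chart \<open>c\<close> of the tangent vector \<open>v\<close> at \<open>p\<close> are
  \<open>tangent_deriv A (snd c) p v\<close>.\<close>

definition smooth_vector_field ::
    "('m, 'e::euclidean_space) chart set \<Rightarrow> 'm set \<Rightarrow> ('m \<Rightarrow> 'e) \<Rightarrow> bool" where
  "smooth_vector_field A W X \<longleftrightarrow>
     (\<forall>c\<in>A. smooth_from A (fst c \<inter> W) (\<lambda>p. tangent_deriv A (snd c) p (X p)))"

definition velocity ::
    "('m, 'e::euclidean_space) chart set \<Rightarrow> (real \<Rightarrow> 'm) \<Rightarrow> real \<Rightarrow> 'e" where
  "velocity A \<gamma> t = vector_derivative (snd (chart_at A (\<gamma> t)) \<circ> \<gamma>) (at t)"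

text \<open>Smooth subbundles of the tangent bundle: locally spanned by a smooth frame, so that the
  rank is locally constant.\<close>

definition distribution ::
    "('m::topological_space, 'e::euclidean_space) chart set \<Rightarrow> ('m \<Rightarrow> 'e set) \<Rightarrow> bool" where
  "distribution A H \<longleftrightarrow>
     (\<forall>p. \<exists>W (k::nat) E. open W \<and> p \<in> W \<and>
        (\<forall>i<k. smooth_vector_field A W (E i)) \<and>
        (\<forall>p'\<in>W. inj_on (\<lambda>i. E i p') {..<k} \<and> independent ((\<lambda>i. E i p') ` {..<k}) \<and>
                 H p' = span ((\<lambda>i. E i p') ` {..<k})))"

definition direct_sum_decomposition :: "('m \<Rightarrow> 'e::real_vector set) \<Rightarrow> ('m \<Rightarrow> 'e set) \<Rightarrow> bool" where
  "direct_sum_decomposition H V \<longleftrightarrow>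
     (\<forall>p. H p \<inter> V p = {0} \<and> {X + Y | X Y. X \<in> H p \<and> Y \<in> V p} = UNIV)"

section \<open>Linear connections and covariant derivatives along curves\<close>

text \<open>The operator \<open>nabla X Y\<close> is only constrained on globally defined smooth vector fields.\<close>

definition linear_connection ::
    "('m, 'e::euclidean_space) chart set \<Rightarrow> (('m \<Rightarrow> 'e) \<Rightarrow> ('m \<Rightarrow> 'e) \<Rightarrow> 'm \<Rightarrow> 'e) \<Rightarrow> bool" where
  "linear_connection A nabla \<longleftrightarrow>
     (\<forall>X Y. smooth_vector_field A UNIV X \<longrightarrow> smooth_vector_field A UNIV Y \<longrightarrow>
        smooth_vector_field A UNIV (nabla X Y)) \<and>
     (\<forall>X X' Y. smooth_vector_field A UNIV X \<longrightarrow> smooth_vector_field A UNIV X' \<longrightarrow>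
        smooth_vector_field A UNIV Y \<longrightarrow>
        nabla (\<lambda>p. X p + X' p) Y = (\<lambda>p. nabla X Y p + nabla X' Y p)) \<and>
     (\<forall>f X Y. smooth_from A UNIV f \<longrightarrow> smooth_vector_field A UNIV X \<longrightarrow>
        smooth_vector_field A UNIV Y \<longrightarrow>
        nabla (\<lambda>p. f p *\<^sub>R X p) Y = (\<lambda>p. f p *\<^sub>R nabla X Y p)) \<and>
     (\<forall>X Y Y'. smooth_vector_field A UNIV X \<longrightarrow> smooth_vector_field A UNIV Y \<longrightarrow>
        smooth_vector_field A UNIV Y' \<longrightarrow>
        nabla X (\<lambda>p. Y p + Y' p) = (\<lambda>p. nabla X Y p + nabla X Y' p)) \<and>
     (\<forall>a X Y. smooth_vector_field A UNIV X \<longrightarrow> smooth_vector_field A UNIV Y \<longrightarrow>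
        nabla X (\<lambda>p. a *\<^sub>R Y p) = (\<lambda>p. a *\<^sub>R nabla X Y p)) \<and>
     (\<forall>f X Y. smooth_from A UNIV f \<longrightarrow> smooth_vector_field A UNIV X \<longrightarrow>
        smooth_vector_field A UNIV Y \<longrightarrow>
        nabla X (\<lambda>p. f p *\<^sub>R Y p) =
          (\<lambda>p. f p *\<^sub>R nabla X Y p + tangent_deriv A f p (X p) *\<^sub>R Y p))"

text \<open>A vector field along \<open>\<gamma>\<close> is a map \<open>Z :: real \<Rightarrow> 'e\<close>, with \<open>Z t\<close> read as a tangent vector
  at \<open>\<gamma> t\<close>.  If \<open>Z\<close> is, for parameters near \<open>t\<close>, a combination of restrictions \<open>E\<^sub>i \<circ> \<gamma>\<close> of
  smooth vector fields with coefficients \<open>z\<^sub>i\<close>, then linearity, the product rule and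
  compatibility with \<open>nabla\<close> on restrictions force
  \<open>D\<^sub>t Z = (\<Sum>i. z\<^sub>i' E\<^sub>i + z\<^sub>i nabla\<^bsub>\<gamma>'\<^esub> E\<^sub>i)\<close>; the result does not depend on the representation.
  The value of \<open>nabla\<^bsub>v\<^esub> E\<close> for a tangent vector \<open>v\<close> is obtained from any smooth
  vector field \<open>X\<close> extending \<open>v\<close>.\<close>

definition has_covariant_derivative ::
    "('m, 'e::euclidean_space) chart set \<Rightarrow> (('m \<Rightarrow> 'e) \<Rightarrow> ('m \<Rightarrow> 'e) \<Rightarrow> 'm \<Rightarrow> 'e)
      \<Rightarrow> (real \<Rightarrow> 'm) \<Rightarrow> (real \<Rightarrow> 'e) \<Rightarrow> real \<Rightarrow> 'e \<Rightarrow> bool" where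
  "has_covariant_derivative A nabla \<gamma> Z t w \<longleftrightarrow>
     (\<exists>X (n::nat) E z.
        smooth_vector_field A UNIV X \<and> X (\<gamma> t) = velocity A \<gamma> t \<and>
        (\<forall>i<n. smooth_vector_field A UNIV (E i) \<and> (z i :: real \<Rightarrow> real) differentiable (at t)) \<and>
        (\<forall>\<^sub>F s in nhds t. Z s = (\<Sum>i<n. z i s *\<^sub>R E i (\<gamma> s))) \<and>
        w = (\<Sum>i<n. deriv (z i) t *\<^sub>R E i (\<gamma> t) + z i t *\<^sub>R nabla X (E i) (\<gamma> t)))"

definition covariant_derivative ::
    "('m, 'e::euclidean_space) chart set \<Rightarrow> (('m \<Rightarrow> 'e) \<Rightarrow> ('m \<Rightarrow> 'e) \<Rightarrow> 'm \<Rightarrow> 'e)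
      \<Rightarrow> (real \<Rightarrow> 'm) \<Rightarrow> (real \<Rightarrow> 'e) \<Rightarrow> real \<Rightarrow> 'e" where
  "covariant_derivative A nabla \<gamma> Z t = (THE w. has_covariant_derivative A nabla \<gamma> Z t w)"

section \<open>The curves and the map \<open>\<Psi>\<close>\<close>

definition solves_ivp ::
    "('m::topological_space, 'e::euclidean_space) chart set
      \<Rightarrow> (('m \<Rightarrow> 'e) \<Rightarrow> ('m \<Rightarrow> 'e) \<Rightarrow> 'm \<Rightarrow> 'e) \<Rightarrow> 'm \<Rightarrow> 'e \<Rightarrow> 'e
      \<Rightarrow> real set \<Rightarrow> (real \<Rightarrow> 'm) \<Rightarrow> bool" where
  "solves_ivp A nabla q X Y I \<gamma> \<longleftrightarrow>
     open I \<and> is_interval I \<and> 0 \<in> I \<and> smooth_into A I \<gamma> \<and>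
     (\<forall>t\<in>I. covariant_derivative A nabla \<gamma>
               (covariant_derivative A nabla \<gamma> (velocity A \<gamma>)) t = 0) \<and>
     \<gamma> 0 = q \<and> velocity A \<gamma> 0 = X \<and> covariant_derivative A nabla \<gamma> (velocity A \<gamma>) 0 = Y"

text \<open>The maximal solution: its domain is the union of the domains of all solutions, and its
  value at \<open>t\<close> is the common value there of all solutions defined at \<open>t\<close>.\<close>

definition max_domain ::
    "('m::topological_space, 'e::euclidean_space) chart set
      \<Rightarrow> (('m \<Rightarrow> 'e) \<Rightarrow> ('m \<Rightarrow> 'e) \<Rightarrow> 'm \<Rightarrow> 'e) \<Rightarrow> 'm \<Rightarrow> 'e \<Rightarrow> 'e \<Rightarrow> real set" where
  "max_domain A nabla q X Y = \<Union>{I. \<exists>\<gamma>. solves_ivp A nabla q X Y I \<gamma>}"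

definition max_curve ::
    "('m::topological_space, 'e::euclidean_space) chart set
      \<Rightarrow> (('m \<Rightarrow> 'e) \<Rightarrow> ('m \<Rightarrow> 'e) \<Rightarrow> 'm \<Rightarrow> 'e) \<Rightarrow> 'm \<Rightarrow> 'e \<Rightarrow> 'e \<Rightarrow> real \<Rightarrow> 'm" where
  "max_curve A nabla q X Y t =
     (THE p. \<exists>I \<gamma>. solves_ivp A nabla q X Y I \<gamma> \<and> t \<in> I \<and> p = \<gamma> t)"

text \<open>The component in \<open>S\<close> of \<open>u\<close> with respect to a direct sum of subspaces \<open>S \<oplus> T\<close>.  With it
  \<open>Psi\<close> is a function of the tangent vector \<open>u = X + Y\<close> at \<open>q\<close>, where \<open>X\<close> and \<open>Y\<close> are the
  components of \<open>u\<close> in \<open>H q\<close> and \<open>V q\<close>.\<close>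

definition component :: "'e::real_vector set \<Rightarrow> 'e set \<Rightarrow> 'e \<Rightarrow> 'e" where
  "component S T u = (THE x. x \<in> S \<and> u - x \<in> T)"

definition Psi_domain ::
    "('m::topological_space, 'e::euclidean_space) chart set
      \<Rightarrow> (('m \<Rightarrow> 'e) \<Rightarrow> ('m \<Rightarrow> 'e) \<Rightarrow> 'm \<Rightarrow> 'e) \<Rightarrow> ('m \<Rightarrow> 'e set) \<Rightarrow> ('m \<Rightarrow> 'e set) \<Rightarrow> 'm \<Rightarrow> 'e set" where
  "Psi_domain A nabla H V q =
     {u. 1 \<in> max_domain A nabla q (component (H q) (V q) u) (component (V q) (H q) u)}"

definition Psi ::
    "('m::topological_space, 'e::euclidean_space) chart set
      \<Rightarrow> (('m \<Rightarrow> 'e) \<Rightarrow> ('m \<Rightarrow> 'e) \<Rightarrow> 'm \<Rightarrow> 'e) \<Rightarrow> ('m \<Rightarrow> 'e set) \<Rightarrow> ('m \<Rightarrow> 'e set) \<Rightarrow> 'm \<Rightarrow> 'e \<Rightarrow> 'm" where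
  "Psi A nabla H V q u =
     max_curve A nabla q (component (H q) (V q) u) (component (V q) (H q) u) 1"

end

theory Submission
  imports Defs
begin

text \<open>In a chart \<open>c\<close> around \<open>q\<close> the connection is given by Christoffel symbols \<open>\<Gamma>\<close>.  With \<open>x\<close> the coordinates
of \<open>\<gamma>\<close>, \<open>v\<close> those of its velocity and \<open>a\<close> those of \<open>D\<^sub>t \<gamma>'\<close>, the equation \<open>D\<^sub>t\<^sup>2 \<gamma>' = 0\<close> becomes the
first-order autonomous system
  \<open>x' = v\<close>,  \<open>v' = a - \<Gamma>(x)(v, v)\<close>,  \<open>a' = - \<Gamma>(x)(v, a)\<close>,
whose right-hand side is smooth and vanishes at \<open>(c(q), 0, 0)\<close>.

Scaling.  If \<open>\<gamma>\<close> solves the problem with data \<open>(X, Y)\<close>, then \<open>s \<mapsto> \<gamma>(k s)\<close> solves it with data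
\<open>(k X, k\<^sup>2 Y)\<close>, because each covariant derivative contributes one factor \<open>k\<close>.  For \<open>k \<noteq> 0\<close> this is a
bijection between the solutions of the two problems, and the scaling identity follows at once
(\<open>max_curve_scale\<close>).  It also reduces everything to short times: \<open>\<Psi>(X, Y)\<close> is the value at a fixed
small time \<open>\<epsilon>\<close> of the solution with data \<open>(X / \<epsilon>, Y / \<epsilon>\<^sup>2)\<close>.

Local diffeomorphism.  After a cutoff the system is given by a smooth vector field with compact
support, and \<open>flow_exists\<close> provides its flow for short times as a smooth function of the initial
value.  The linearization of the system at the rest point \<open>(c(q), 0, 0)\<close> is \<open>(\<xi>, \<eta>, \<zeta>)' = (\<eta>, \<zeta>, 0)\<close>,
so the position at time \<open>\<epsilon>\<close> has the derivative \<open>(X, Y) \<mapsto> \<epsilon> X + (\<epsilon>\<^sup>2 / 2) Y\<close>.  In coordinates \<open>\<Psi>\<close>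
therefore has the derivative \<open>X + Y \<mapsto> X + Y / 2\<close> at \<open>0\<close>, which is invertible on
\<open>T\<^sub>q M = H\<^sub>q \<oplus> V\<^sub>q\<close>, and the inverse function theorem (\<open>smooth_inverse_function\<close>) applies.

Three ingredients carry the argument.

  \<^item> Smooth dependence of the flow.  Solutions are fixed points of a contraction on the Banach space
    of bounded continuous curves.  The derivative of the fixed point in the initial value is obtained
    by inverting \<open>id - K\<close>, where the operator \<open>K\<close> is as often differentiable in the initial value
    as the fixed point itself; this bootstraps to all orders.

  \<^item> Locality of the connection.  The operator \<open>nabla\<close> acts on global fields only, so bump functions
    are needed to see that it is given by Christoffel symbols in a chart (\<open>christoffel_exists\<close>) and
    that the covariant derivative along a curve is well defined (\<open>covariant_derivative_coord\<close>).

  \<^item> Uniqueness of solutions beyond a single chart (\<open>solution_unique\<close>), so that the curves constructed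
    in the chart are the maximal ones.  The times near which two solutions agree form a set that is
    open, and closed because the manifold is Hausdorff.\<close>

section \<open>Calculus of maps of class \<open>C\<^sup>k\<close> and the smooth inverse function theorem\<close>

lemma Ck_on_has_derivative:
  assumes "Ck_on (Suc k) S f" "open S" "x \<in> S"
  shows "(f has_derivative frechet_derivative f (at x)) (at x)"
  using assms by (metis Ck_on.simps(2) differentiable_on_eq_differentiable_at frechet_derivative_works)

lemma Ck_on_cong:
  assumes "open S" "\<And>x. x \<in> S \<Longrightarrow> f x = g x" "Ck_on k S f"
  shows "Ck_on k S g"
  using assms
proof (induction k arbitrary: f g)
  case 0
  then show ?case by (metis Ck_on.simps(1) continuous_on_cong)
next
  case (Suc k)
  have der: "(g has_derivative frechet_derivative f (at x)) (at x)" if "x \<in> S" for x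
    using has_derivative_transform_within_open[OF Ck_on_has_derivative[OF Suc.prems(3,1) that] Suc.prems(1) that]
      Suc.prems(2) by auto
  have eq: "frechet_derivative f (at x) = frechet_derivative g (at x)" if "x \<in> S" for x
    using frechet_derivative_at[OF der[OF that]] .
  have "g differentiable_on S"
    using der by (meson differentiableI differentiable_at_withinI differentiable_on_def)
  moreover have "Ck_on k S (\<lambda>x. frechet_derivative g (at x) v)" for v
    by (rule Suc.IH[OF Suc.prems(1), of "\<lambda>x. frechet_derivative f (at x) v"]) (use eq Suc.prems(3) in auto)
  ultimately show ?case by simp
qed

text \<open>Any formula \<open>f'\<close> for the derivative may replace \<open>frechet_derivative\<close>; by induction on the order,
differentiability of all orders is then read off from derivative formulas.\<close>

lemma Ck_on_SucI:
  assumes "open S" "\<And>x. x \<in> S \<Longrightarrow> (f has_derivative f' x) (at x)"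
    and "\<And>v. Ck_on k S (\<lambda>x. f' x v)"
  shows "Ck_on (Suc k) S f"
proof -
  have eq: "f' x = frechet_derivative f (at x)" if "x \<in> S" for x
    using frechet_derivative_at[OF assms(2)[OF that]] .
  have "f differentiable_on S"
    using assms(2) by (meson differentiableI differentiable_at_withinI differentiable_on_def)
  moreover have "Ck_on k S (\<lambda>x. frechet_derivative f (at x) v)" for v
    by (rule Ck_on_cong[OF assms(1) _ assms(3)[of v]]) (use eq in auto)
  ultimately show ?thesis by simp
qed

lemma Ck_on_imp_continuous_on: "Ck_on k S f \<Longrightarrow> continuous_on S f"
  by (cases k) (auto simp: differentiable_imp_continuous_on)

lemma Ck_on_subset:
  assumes "Ck_on k S f" "open S" "T \<subseteq> S" "open T"
  shows "Ck_on k T f"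
  using assms by (induction k arbitrary: f) (auto intro: continuous_on_subset differentiable_on_subset)

lemma Ck_on_SucD:
  assumes "Ck_on (Suc k) S f"
  shows "Ck_on k S f"
  using assms
proof (induction k arbitrary: f)
  case 0
  then show ?case using Ck_on_imp_continuous_on Ck_on.simps(1) by blast
next
  case (Suc k)
  have "f differentiable_on S" "\<And>v. Ck_on (Suc k) S (\<lambda>x. frechet_derivative f (at x) v)"
    using Suc.prems Ck_on.simps(2)[of "Suc k" S f] by blast+
  then show ?case using Suc.IH Ck_on.simps(2)[of k S f] by blast
qed

lemma Ck_on_local:
  assumes "open S" "\<And>x. x \<in> S \<Longrightarrow> \<exists>T. open T \<and> x \<in> T \<and> Ck_on k T f"
  shows "Ck_on k S f"
  using assms
proof (induction k arbitrary: f)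
  case 0
  then show ?case
    by (metis Ck_on.simps(1) continuous_at_imp_continuous_on continuous_on_eq_continuous_at)
next
  case (Suc k)
  have "f differentiable (at x)" if "x \<in> S" for x
    using Suc.prems(2)[OF that]
    by (metis Ck_on_has_derivative differentiableI)
  moreover have "Ck_on k S (\<lambda>x. frechet_derivative f (at x) v)" for v
  proof (rule Suc.IH[OF Suc.prems(1)])
    fix x assume "x \<in> S"
    then obtain T where T: "open T" "x \<in> T" "Ck_on (Suc k) T f" using Suc.prems(2) by blast
    then show "\<exists>T. open T \<and> x \<in> T \<and> Ck_on k T (\<lambda>x. frechet_derivative f (at x) v)"
      by (auto intro: exI[of _ T])
  qed
  ultimately show ?case
    by (simp add: differentiable_at_imp_differentiable_on)
qed

lemma Ck_on_const: "Ck_on k S (\<lambda>x. c)"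
  by (induction k arbitrary: c) auto

lemma Ck_on_bounded_linear_compose:
  assumes "bounded_linear L" "open S" "Ck_on k S f"
  shows "Ck_on k S (\<lambda>x. L (f x))"
  using assms(3)
proof (induction k arbitrary: f)
  case 0
  then show ?case
    using assms(1) by (auto intro: bounded_linear.continuous_on)
next
  case (Suc k)
  show ?case
  proof (rule Ck_on_SucI[OF \<open>open S\<close>])
    show "((\<lambda>x. L (f x)) has_derivative (\<lambda>v. L (frechet_derivative f (at x) v))) (at x)" if "x \<in> S" for x
      using bounded_linear.has_derivative[OF assms(1) Ck_on_has_derivative[OF Suc.prems assms(2) that]] .
    show "Ck_on k S (\<lambda>x. L (frechet_derivative f (at x) v))" for v
      using Suc by simp
  qed
qed

lemma Ck_on_bounded_linear:
  assumes "bounded_linear f" "open S"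
  shows "Ck_on k S f"
proof (cases k)
  case 0
  then show ?thesis using assms linear_continuous_on by auto
next
  case (Suc l)
  show ?thesis unfolding Suc
    by (rule Ck_on_SucI[OF \<open>open S\<close> bounded_linear_imp_has_derivative[OF assms(1)] Ck_on_const])
qed

lemma Ck_on_add:
  assumes "open S" "Ck_on k S f" "Ck_on k S g"
  shows "Ck_on k S (\<lambda>x. f x + g x)"
  using assms(2,3)
proof (induction k arbitrary: f g)
  case 0
  then show ?case by (auto intro: continuous_on_add)
next
  case (Suc k)
  show ?case
  proof (rule Ck_on_SucI[OF \<open>open S\<close>])
    show "((\<lambda>x. f x + g x) has_derivative
        (\<lambda>v. frechet_derivative f (at x) v + frechet_derivative g (at x) v)) (at x)" if "x \<in> S" for x
      by (intro has_derivative_add Ck_on_has_derivative[OF Suc.prems(1) \<open>open S\<close> that]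
        Ck_on_has_derivative[OF Suc.prems(2) \<open>open S\<close> that])
    show "Ck_on k S (\<lambda>x. frechet_derivative f (at x) v + frechet_derivative g (at x) v)" for v
      using Suc by simp
  qed
qed

lemma Ck_on_sum:
  assumes "open S" "\<And>i. i \<in> I \<Longrightarrow> Ck_on k S (f i)"
  shows "Ck_on k S (\<lambda>x. \<Sum>i\<in>I. f i x)"
  using assms(2)
  by (induction I rule: infinite_finite_induct) (auto intro: Ck_on_const Ck_on_add assms(1))

lemma Ck_on_bounded_bilinear:
  assumes "bounded_bilinear pr" "open S" "Ck_on k S f" "Ck_on k S g"
  shows "Ck_on k S (\<lambda>x. pr (f x) (g x))"
  using assms(3,4)
proof (induction k arbitrary: f g)
  case 0
  then show ?case using bounded_bilinear.continuous_on[OF assms(1)] by auto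
next
  case (Suc k)
  show ?case
  proof (rule Ck_on_SucI[OF \<open>open S\<close>])
    show "((\<lambda>x. pr (f x) (g x)) has_derivative
        (\<lambda>v. pr (f x) (frechet_derivative g (at x) v) + pr (frechet_derivative f (at x) v) (g x))) (at x)"
      if "x \<in> S" for x
      by (intro bounded_bilinear.FDERIV[OF assms(1)] Ck_on_has_derivative[OF Suc.prems(1) \<open>open S\<close> that]
        Ck_on_has_derivative[OF Suc.prems(2) \<open>open S\<close> that])
    show "Ck_on k S (\<lambda>x. pr (f x) (frechet_derivative g (at x) v) + pr (frechet_derivative f (at x) v) (g x))" for v
      using Suc.prems Ck_on_SucD[OF Suc.prems(1)] Ck_on_SucD[OF Suc.prems(2)]
      by (intro Ck_on_add Suc.IH \<open>open S\<close>) auto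
  qed
qed

lemmas Ck_on_scaleR = Ck_on_bounded_bilinear[OF bounded_bilinear_scaleR]

lemma bounded_linear_basis_expansion:
  fixes f :: "'a::euclidean_space \<Rightarrow> 'b::real_normed_vector"
  assumes "bounded_linear f"
  shows "f v = (\<Sum>b\<in>Basis. (v \<bullet> b) *\<^sub>R f b)"
proof -
  interpret bounded_linear f by fact
  have "f v = f (\<Sum>b\<in>Basis. (v \<bullet> b) *\<^sub>R b)" by (simp only: euclidean_representation)
  also have "\<dots> = (\<Sum>b\<in>Basis. (v \<bullet> b) *\<^sub>R f b)" by (simp add: sum scaleR)
  finally show ?thesis .
qed

text \<open>The chain rule produces \<open>Df(g x)(Dg(x) v)\<close>, where the direction depends on \<open>x\<close>.  Expanding it in a
basis leaves only derivatives of \<open>f\<close> in fixed directions, to which the induction hypothesis applies;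
this is where a finite-dimensional middle space is used.\<close>

lemma Ck_on_compose:
  fixes g :: "'a::real_normed_vector \<Rightarrow> 'b::euclidean_space" and f :: "'b \<Rightarrow> 'c::real_normed_vector"
  assumes "open S" "open T" "Ck_on k T f" "Ck_on k S g" "g ` S \<subseteq> T"
  shows "Ck_on k S (\<lambda>x. f (g x))"
  using assms(3,4)
proof (induction k arbitrary: f)
  case 0
  then show ?case
    using assms(5) by (auto intro: continuous_on_compose2)
next
  case (Suc k)
  show ?case
  proof (rule Ck_on_SucI[OF \<open>open S\<close>])
    fix x assume x: "x \<in> S"
    have f: "(f has_derivative frechet_derivative f (at (g x))) (at (g x))"
      using Ck_on_has_derivative[OF Suc.prems(1) assms(2)] assms(5) x by blast
    have "((\<lambda>x. f (g x)) has_derivative (\<lambda>v. frechet_derivative f (at (g x)) (frechet_derivative g (at x) v))) (at x)"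
      using has_derivative_compose[OF Ck_on_has_derivative[OF Suc.prems(2) assms(1) x] f] .
    also have "(\<lambda>v. frechet_derivative f (at (g x)) (frechet_derivative g (at x) v)) =
       (\<lambda>v. \<Sum>b\<in>Basis. (frechet_derivative g (at x) v \<bullet> b) *\<^sub>R frechet_derivative f (at (g x)) b)"
      using bounded_linear_basis_expansion[OF has_derivative_bounded_linear[OF f]] by blast
    finally show "((\<lambda>x. f (g x)) has_derivative
       (\<lambda>v. \<Sum>b\<in>Basis. (frechet_derivative g (at x) v \<bullet> b) *\<^sub>R frechet_derivative f (at (g x)) b)) (at x)" .
  next
    fix v
    show "Ck_on k S (\<lambda>x. \<Sum>b\<in>Basis. (frechet_derivative g (at x) v \<bullet> b) *\<^sub>R frechet_derivative f (at (g x)) b)"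
    proof (intro Ck_on_sum Ck_on_scaleR assms(1))
      fix b :: 'b assume "b \<in> Basis"
      show "Ck_on k S (\<lambda>x. frechet_derivative g (at x) v \<bullet> b)"
        using Suc.prems(2) by (intro Ck_on_bounded_linear_compose[OF bounded_linear_inner_left] assms(1)) auto
      show "Ck_on k S (\<lambda>x. frechet_derivative f (at (g x)) b)"
        using Suc.prems(1) Ck_on_SucD[OF Suc.prems(2)] by (intro Suc.IH) auto
    qed
  qed
qed

lemma Ck_on_Pair:
  assumes "open S" "Ck_on k S f" "Ck_on k S g"
  shows "Ck_on k S (\<lambda>x. (f x, g x))"
proof -
  have "Ck_on k S (\<lambda>x. (f x, 0) + (0, g x))"
    by (intro Ck_on_add assms(1) Ck_on_bounded_linear_compose[OF _ assms(1,2), of "\<lambda>y. (y, 0)"]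
      Ck_on_bounded_linear_compose[OF _ assms(1,3), of "\<lambda>y. (0, y)"]
      bounded_linear_Pair bounded_linear_ident bounded_linear_zero)
  then show ?thesis by simp
qed

lemma smooth_onI: "(\<And>k. Ck_on k S f) \<Longrightarrow> smooth_on S f"
  by (simp add: smooth_on_def)
lemma smooth_onD: "smooth_on S f \<Longrightarrow> Ck_on k S f"
  by (simp add: smooth_on_def)

lemma smooth_on_cong:
  "open S \<Longrightarrow> smooth_on S f \<Longrightarrow> (\<And>x. x \<in> S \<Longrightarrow> f x = g x) \<Longrightarrow> smooth_on S g"
  unfolding smooth_on_def using Ck_on_cong by blast
lemma smooth_on_subset:
  "smooth_on S f \<Longrightarrow> open S \<Longrightarrow> open T \<Longrightarrow> T \<subseteq> S \<Longrightarrow> smooth_on T f"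
  unfolding smooth_on_def using Ck_on_subset by blast
lemma smooth_on_local:
  assumes "open S" "\<And>x. x \<in> S \<Longrightarrow> \<exists>T. open T \<and> x \<in> T \<and> smooth_on T f"
  shows "smooth_on S f"
  unfolding smooth_on_def
proof
  fix k show "Ck_on k S f"
    by (rule Ck_on_local[OF assms(1)]) (use assms(2) smooth_onD in blast)
qed
lemma smooth_on_const: "smooth_on S (\<lambda>x. c)"
  by (simp add: smooth_on_def Ck_on_const)
lemma smooth_on_bounded_linear: "bounded_linear f \<Longrightarrow> open S \<Longrightarrow> smooth_on S f"
  by (simp add: smooth_on_def Ck_on_bounded_linear)
lemma smooth_on_id: "open S \<Longrightarrow> smooth_on S (\<lambda>x. x)"
  by (simp add: smooth_on_bounded_linear)
lemma smooth_on_bounded_linear_compose: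
  "bounded_linear L \<Longrightarrow> open S \<Longrightarrow> smooth_on S f \<Longrightarrow> smooth_on S (\<lambda>x. L (f x))"
  by (simp add: smooth_on_def Ck_on_bounded_linear_compose)
lemma smooth_on_add: "open S \<Longrightarrow> smooth_on S f \<Longrightarrow> smooth_on S g \<Longrightarrow> smooth_on S (\<lambda>x. f x + g x)"
  by (simp add: smooth_on_def Ck_on_add)
lemma smooth_on_uminus: "open S \<Longrightarrow> smooth_on S f \<Longrightarrow> smooth_on S (\<lambda>x. - f x)"
  by (rule smooth_on_bounded_linear_compose[OF bounded_linear_minus[OF bounded_linear_ident]])
lemma smooth_on_diff: "open S \<Longrightarrow> smooth_on S f \<Longrightarrow> smooth_on S g \<Longrightarrow> smooth_on S (\<lambda>x. f x - g x)"
  using smooth_on_add[of S f "\<lambda>x. - g x"] smooth_on_uminus[of S g] by simp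
lemma smooth_on_sum:
  "open S \<Longrightarrow> (\<And>i. i \<in> I \<Longrightarrow> smooth_on S (f i)) \<Longrightarrow> smooth_on S (\<lambda>x. \<Sum>i\<in>I. f i x)"
  by (simp add: smooth_on_def Ck_on_sum)
lemma smooth_on_scaleR:
  "open S \<Longrightarrow> smooth_on S f \<Longrightarrow> smooth_on S g \<Longrightarrow> smooth_on S (\<lambda>x. f x *\<^sub>R g x)"
  by (simp add: smooth_on_def Ck_on_scaleR)
lemma smooth_on_inner:
  "open S \<Longrightarrow> smooth_on S f \<Longrightarrow> smooth_on S g \<Longrightarrow> smooth_on S (\<lambda>x. f x \<bullet> g x)"
  by (simp add: smooth_on_def Ck_on_bounded_bilinear[OF bounded_bilinear_inner])
lemma smooth_on_Pair:
  "open S \<Longrightarrow> smooth_on S f \<Longrightarrow> smooth_on S g \<Longrightarrow> smooth_on S (\<lambda>x. (f x, g x))"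
  by (simp add: smooth_on_def Ck_on_Pair)
lemma smooth_on_compose:
  fixes g :: "'a::real_normed_vector \<Rightarrow> 'b::euclidean_space"
  shows "open S \<Longrightarrow> open T \<Longrightarrow> smooth_on T f \<Longrightarrow> smooth_on S g \<Longrightarrow> g ` S \<subseteq> T \<Longrightarrow> smooth_on S (\<lambda>x. f (g x))"
  by (simp add: smooth_on_def Ck_on_compose)
lemma smooth_on_has_derivative:
  "smooth_on S f \<Longrightarrow> open S \<Longrightarrow> x \<in> S \<Longrightarrow> (f has_derivative frechet_derivative f (at x)) (at x)"
  using Ck_on_has_derivative smooth_onD by blast
lemma smooth_on_frechet: "smooth_on S f \<Longrightarrow> smooth_on S (\<lambda>x. frechet_derivative f (at x) v)"
  unfolding smooth_on_def using Ck_on.simps(2) by blast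
lemma smooth_on_imp_continuous_on: "smooth_on S f \<Longrightarrow> continuous_on S f"
  using Ck_on_imp_continuous_on smooth_onD by blast

lemma smooth_on_frechet_apply:
  fixes f :: "'a::euclidean_space \<Rightarrow> 'b::real_normed_vector"
  assumes "open S" "smooth_on S f" "smooth_on S g"
  shows "smooth_on S (\<lambda>x. frechet_derivative f (at x) (g x))"
proof -
  have "frechet_derivative f (at x) (g x) = (\<Sum>b\<in>Basis. (g x \<bullet> b) *\<^sub>R frechet_derivative f (at x) b)"
    if "x \<in> S" for x
    by (rule bounded_linear_basis_expansion[OF has_derivative_bounded_linear[OF smooth_on_has_derivative[OF assms(2,1) that]]])
  moreover have "smooth_on S (\<lambda>x. \<Sum>b\<in>Basis. (g x \<bullet> b) *\<^sub>R frechet_derivative f (at x) b)"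
    by (intro smooth_on_sum smooth_on_scaleR assms smooth_on_inner smooth_on_const smooth_on_frechet)
  ultimately show ?thesis using smooth_on_cong[OF assms(1)] by (metis (no_types, lifting))
qed

text \<open>A product rule in which one factor is merely continuous: where the other factor vanishes, the first
one enters the derivative only through its value.\<close>

lemma has_derivative_bilinear_vanishing:
  assumes "bounded_bilinear pr" "isCont f z" "(g has_derivative g') (at z)" "g z = 0"
  shows "((\<lambda>x. pr (f x) (g x)) has_derivative (\<lambda>h. pr (f z) (g' h))) (at z)"
proof -
  interpret bounded_bilinear pr by fact
  have 1: "((\<lambda>x. pr (f z) (g x)) has_derivative (\<lambda>h. pr (f z) (g' h))) (at z)"
    using bounded_linear.has_derivative[OF bounded_linear_right assms(3)] .
  have 2: "((\<lambda>x. pr (f x - f z) (g x)) has_derivative (\<lambda>h. 0)) (at z)"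
  proof -
    obtain K where K: "\<And>a b. norm (pr a b) \<le> norm a * norm b * K" "K > 0"
      using pos_bounded by blast
    obtain B where B: "\<And>h. norm (g' h) \<le> norm h * B" "B > 0"
      using bounded_linear.pos_bounded[OF has_derivative_bounded_linear[OF assms(3)]] by blast
    show ?thesis
      unfolding has_derivative_at_alt
    proof (intro conjI allI impI)
      fix e :: real assume "e > 0"
      have "e / (K * (B + 1)) > 0" using \<open>e > 0\<close> K B by auto
      then obtain d1 where d1: "d1 > 0" "\<And>x. dist x z < d1 \<Longrightarrow> dist (f x) (f z) < e / (K * (B + 1))"
        using assms(2) unfolding continuous_at_eps_delta by blast
      obtain d2 where d2: "d2 > 0" "\<And>x. norm (x - z) < d2 \<Longrightarrow> norm (g x - g z - g' (x - z)) \<le> 1 * norm (x - z)"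
        using assms(3) unfolding has_derivative_at_alt using zero_less_one by blast
      show "\<exists>d>0. \<forall>y. norm (y - z) < d \<longrightarrow> norm (pr (f y - f z) (g y) - pr (f z - f z) (g z) - 0) \<le> e * norm (y - z)"
      proof (intro exI[of _ "min d1 d2"] conjI allI impI)
        fix y assume y: "norm (y - z) < min d1 d2"
        have "norm (g y) \<le> norm (g y - g z - g' (y - z)) + norm (g' (y - z))"
          using norm_triangle_ineq[of "g y - g z - g' (y - z)" "g' (y - z)"] assms(4) by simp
        also have "\<dots> \<le> norm (y - z) + norm (y - z) * B" using d2(2)[of y] B(1)[of "y - z"] y by auto
        finally have g: "norm (g y) \<le> norm (y - z) * (B + 1)" by (simp add: algebra_simps)
        have "norm (f y - f z) \<le> e / (K * (B + 1))" using d1(2)[of y] y by (auto simp: dist_norm)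
        then have "norm (f y - f z) * norm (g y) * K \<le> e / (K * (B + 1)) * (norm (y - z) * (B + 1)) * K"
          using g \<open>K > 0\<close> \<open>B > 0\<close> \<open>e > 0\<close> by (intro mult_right_mono mult_mono) auto
        also have "\<dots> = (e * norm (y - z)) * ((K * (B + 1)) / (K * (B + 1)))" by (simp only: times_divide_eq_right times_divide_eq_left mult_ac)
        also have "\<dots> = e * norm (y - z)" using \<open>K > 0\<close> \<open>B > 0\<close> by (simp add: add_pos_pos less_imp_neq[symmetric])
        finally show "norm (pr (f y - f z) (g y) - pr (f z - f z) (g z) - 0) \<le> e * norm (y - z)"
          using K(1)[of "f y - f z" "g y"] by (simp add: zero_left)
      qed (use d1 d2 in auto)
    qed auto
  qed
  show ?thesis
    using has_derivative_add[OF 1 2] by (simp add: diff_left)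
qed

text \<open>Taking norms in the identity for \<open>R y - R z\<close> first gives \<open>\<parallel>R y\<parallel> \<le> 2 \<parallel>R z\<parallel>\<close> as soon as
\<open>\<parallel>L y - L z\<parallel> \<parallel>R z\<parallel> \<le> 1/2\<close>, and then \<open>\<parallel>R y - R z\<parallel> = O(\<parallel>L y - L z\<parallel>)\<close>.\<close>

lemma isCont_blinfun_inverse:
  fixes L :: "'p::real_normed_vector \<Rightarrow> ('x::real_normed_vector \<Rightarrow>\<^sub>L 'y::real_normed_vector)" and R :: "'p \<Rightarrow> ('y \<Rightarrow>\<^sub>L 'x)"
  assumes "open S" "z \<in> S" "isCont L z"
    and diff: "\<And>y. y \<in> S \<Longrightarrow> R y - R z = - (R y o\<^sub>L (L y - L z) o\<^sub>L R z)"
  shows "isCont R z"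
proof -
  have "((\<lambda>y. norm (L y - L z)) \<longlongrightarrow> 0) (at z)"
    using assms(3) by (simp add: isCont_def LIM_zero tendsto_norm_zero)
  then have lim: "((\<lambda>y. 2 * norm (R z) * norm (R z) * norm (L y - L z)) \<longlongrightarrow> 0) (at z)"
    using tendsto_mult_right_zero by blast
  have "((\<lambda>y. norm (L y - L z) * norm (R z)) \<longlongrightarrow> 0) (at z)"
    using \<open>((\<lambda>y. norm (L y - L z)) \<longlongrightarrow> 0) (at z)\<close> tendsto_mult_left_zero by blast
  then have ev: "\<forall>\<^sub>F y in at z. norm (L y - L z) * norm (R z) < 1/2"
    by (rule order_tendstoD) simp
  have evS: "\<forall>\<^sub>F y in at z. y \<in> S"
    using assms(1,2) eventually_at_in_open' by blast
  have "\<forall>\<^sub>F y in at z. norm (R y - R z) \<le> 2 * norm (R z) * norm (R z) * norm (L y - L z)"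
    using ev evS
  proof eventually_elim
    case (elim y)
    have b: "norm (R y - R z) \<le> norm (R y) * (norm (L y - L z) * norm (R z))"
    proof -
      have "norm (R y - R z) = norm (R y o\<^sub>L (L y - L z) o\<^sub>L R z)"
        using diff[OF elim(2)] by simp
      also have "\<dots> \<le> norm (R y o\<^sub>L (L y - L z)) * norm (R z)" by (rule norm_blinfun_compose)
      also have "\<dots> \<le> norm (R y) * norm (L y - L z) * norm (R z)"
        by (intro mult_right_mono norm_blinfun_compose) auto
      finally show ?thesis by (simp add: mult.assoc)
    qed
    also have "\<dots> \<le> norm (R y) * (1/2)" using elim(1) by (intro mult_left_mono) auto
    finally have "norm (R y) \<le> 2 * norm (R z)"
      using norm_triangle_ineq2[of "R y" "R z"] by linarith
    then have "norm (R y) * (norm (L y - L z) * norm (R z)) \<le> 2 * norm (R z) * (norm (L y - L z) * norm (R z))"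
      by (intro mult_right_mono) auto
    with b show ?case by (simp add: mult_ac)
  qed
  then have "((\<lambda>y. norm (R y - R z)) \<longlongrightarrow> 0) (at z)"
    by (intro tendsto_sandwich[OF _ _ tendsto_const lim]) auto
  then show ?thesis
    by (simp add: isCont_def LIM_zero_iff tendsto_norm_zero_iff)
qed

lemma blinfun_inverse_diff:
  assumes "L y o\<^sub>L R y = id_blinfun" "R y o\<^sub>L L y = id_blinfun" "L z o\<^sub>L R z = id_blinfun"
  shows "R y - R z = - (R y o\<^sub>L (L y - L z) o\<^sub>L R z)"
proof (rule blinfun_eqI)
  fix i
  have "R y (L y (R z i)) = R z i" "L z (R z i) = i"
    using assms by (metis blinfun_apply_blinfun_compose blinfun_apply_id_blinfun)+
  then show "(R y - R z) i = (- (R y o\<^sub>L (L y - L z) o\<^sub>L R z)) i"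
    by (simp add: blinfun.bilinear_simps)
qed

text \<open>The inverse \<open>R\<close> of an operator family \<open>L\<close> has the derivative \<open>- R (DL) R\<close>, which is of class \<open>C\<^sup>k\<close>
if \<open>R\<close> and \<open>DL\<close> are.  The lemma is stated for operators between arbitrary normed spaces because it
is used both for Jacobians and for operators on a space of curves.\<close>

lemma Ck_on_blinfun_inverse:
  fixes L :: "'p::real_normed_vector \<Rightarrow> ('x::real_normed_vector \<Rightarrow>\<^sub>L 'y::real_normed_vector)" and R :: "'p \<Rightarrow> ('y \<Rightarrow>\<^sub>L 'x)"
  assumes "open S" "Ck_on k S L"
    and LR: "\<And>z. z \<in> S \<Longrightarrow> L z o\<^sub>L R z = id_blinfun" and RL: "\<And>z. z \<in> S \<Longrightarrow> R z o\<^sub>L L z = id_blinfun"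
  shows "Ck_on k S R"
  using assms(2)
proof (induction k)
  have diff: "R y - R z = - (R y o\<^sub>L (L y - L z) o\<^sub>L R z)" if "y \<in> S" "z \<in> S" for y z
    by (rule blinfun_inverse_diff[OF LR[OF that(1)] RL[OF that(1)] LR[OF that(2)]])
  have cont: "isCont R z" if "isCont L z" "z \<in> S" for z
    by (rule isCont_blinfun_inverse[OF \<open>open S\<close> that(2,1) diff[OF _ that(2)]])
  {
    case 0
    then show ?case
      using cont \<open>open S\<close> by (auto simp: continuous_on_eq_continuous_at)
  next
    case (Suc k)
    let ?D = "\<lambda>z h. - (R z o\<^sub>L frechet_derivative L (at z) h o\<^sub>L R z)"
    show ?case
    proof (rule Ck_on_SucI[OF \<open>open S\<close>])
      fix z assume z: "z \<in> S"
      note dL = Ck_on_has_derivative[OF Suc.prems \<open>open S\<close> z]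
      have Rz: "isCont R z"
        using cont z has_derivative_continuous[OF dL] by blast
      have "((\<lambda>y. R y o\<^sub>L (L y - L z)) has_derivative (\<lambda>h. R z o\<^sub>L frechet_derivative L (at z) h)) (at z)"
        by (rule has_derivative_bilinear_vanishing[OF bounded_bilinear_blinfun_compose Rz])
           (use has_derivative_diff[OF dL has_derivative_const[of "L z"]] in auto)
      then have "((\<lambda>y. R y o\<^sub>L (L y - L z) o\<^sub>L R z) has_derivative
          (\<lambda>h. R z o\<^sub>L frechet_derivative L (at z) h o\<^sub>L R z)) (at z)"
        by (rule bounded_linear.has_derivative[OF bounded_bilinear.bounded_linear_left[OF bounded_bilinear_blinfun_compose]])
      from has_derivative_add[OF has_derivative_const[of "R z"] has_derivative_minus[OF this]]
      have "((\<lambda>y. R z + - (R y o\<^sub>L (L y - L z) o\<^sub>L R z)) has_derivative ?D z) (at z)"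
        by simp
      then show "(R has_derivative ?D z) (at z)"
      proof (rule has_derivative_transform_within_open[OF _ \<open>open S\<close> z])
        fix y assume "y \<in> S"
        from diff[OF this z] show "R z + - (R y o\<^sub>L (L y - L z) o\<^sub>L R z) = R y"
          by (simp add: algebra_simps)
      qed
    next
      have R: "Ck_on k S R" using Suc.IH Ck_on_SucD[OF Suc.prems] .
      fix v
      have "Ck_on k S (\<lambda>z. R z o\<^sub>L frechet_derivative L (at z) v o\<^sub>L R z)"
        using Suc.prems R
        by (intro Ck_on_bounded_bilinear[OF bounded_bilinear_blinfun_compose \<open>open S\<close>]) auto
      then show "Ck_on k S (\<lambda>z. ?D z v)"
        by (rule Ck_on_bounded_linear_compose[OF bounded_linear_minus[OF bounded_linear_ident] \<open>open S\<close>])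
    qed
  }
qed

lemma blinfun_apply_sum: "blinfun_apply (sum f I) x = (\<Sum>i\<in>I. blinfun_apply (f i) x)"
  by (induction I rule: infinite_finite_induct) (auto simp: blinfun.bilinear_simps)

text \<open>The total derivative as a bounded linear operator.  The sum over a basis expresses it through
directional derivatives, from which it inherits smoothness.\<close>

definition deriv_blinfun :: "('a::euclidean_space \<Rightarrow> 'b::real_normed_vector) \<Rightarrow> 'a \<Rightarrow> 'a \<Rightarrow>\<^sub>L 'b" where
  "deriv_blinfun f x = (\<Sum>b\<in>Basis. blinfun_scaleR_left (frechet_derivative f (at x) b) o\<^sub>L blinfun_inner_right b)"

lemma deriv_blinfun_apply:
  assumes "(f has_derivative f') (at x)"
  shows "blinfun_apply (deriv_blinfun f x) = f'"
proof
  fix v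
  have "deriv_blinfun f x v = (\<Sum>b\<in>Basis. (v \<bullet> b) *\<^sub>R frechet_derivative f (at x) b)"
    by (simp add: deriv_blinfun_def blinfun_apply_sum blinfun_inner_right.rep_eq inner_commute)
  also have "\<dots> = frechet_derivative f (at x) v"
    using assms by (metis bounded_linear_basis_expansion frechet_derivative_at has_derivative_bounded_linear)
  finally show "deriv_blinfun f x v = f' v" using frechet_derivative_at[OF assms] by simp
qed

lemma smooth_on_deriv_blinfun:
  assumes "open S" "smooth_on S f"
  shows "smooth_on S (deriv_blinfun f)"
  unfolding deriv_blinfun_def
  by (intro smooth_on_sum assms(1) smooth_on_frechet assms(2)
      smooth_on_bounded_linear_compose[OF bounded_linear_compose[OF bounded_bilinear.bounded_linear_left[OF bounded_bilinear_blinfun_compose]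
        bounded_linear_blinfun_scaleR_left]])

text \<open>The inverse \<open>g\<close> from the inverse function theorem satisfies \<open>Dg(y) = Df(g y)\<^sup>-\<^sup>1\<close>.  If \<open>g\<close> is \<open>C\<^sup>k\<close>, so
is the right-hand side, hence \<open>g\<close> is \<open>C\<^sup>k\<^sup>+\<^sup>1\<close>.\<close>

lemma smooth_inverse_function:
  fixes f :: "'a::euclidean_space \<Rightarrow> 'a"
  assumes U: "open U" "smooth_on U f" "x0 \<in> U"
    and f': "(f has_derivative f') (at x0)" and k: "bounded_linear k" "\<And>v. k (f' v) = v"
  obtains U' V g where "open U'" "U' \<subseteq> U" "x0 \<in> U'" "open V" "homeomorphism U' V f g" "smooth_on V g"
proof -
  have df: "(f has_derivative blinfun_apply (deriv_blinfun f x)) (at x)" if "x \<in> U" for x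
    using smooth_on_has_derivative[OF U(2,1) that] deriv_blinfun_apply by metis
  have sD: "smooth_on U (deriv_blinfun f)" by (rule smooth_on_deriv_blinfun[OF U(1,2)])
  have inv: "Blinfun k o\<^sub>L deriv_blinfun f x0 = id_blinfun"
    by (rule blinfun_eqI) (simp add: deriv_blinfun_apply[OF f'] bounded_linear_Blinfun_apply k)
  obtain U' V g g' where g: "open U'" "U' \<subseteq> U" "x0 \<in> U'" "open V" "f x0 \<in> V" "homeomorphism U' V f g"
    "\<And>y. y \<in> V \<Longrightarrow> (g has_derivative (g' y)) (at y)"
    "\<And>y. y \<in> V \<Longrightarrow> g' y = inv (blinfun_apply (deriv_blinfun f (g y)))"
    "\<And>y. y \<in> V \<Longrightarrow> bij (blinfun_apply (deriv_blinfun f (g y)))"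
    by (rule inverse_function_theorem[OF U(1) df smooth_on_imp_continuous_on[OF sD] U(3) inv]) (assumption, rule that)
  have gU: "g ` V \<subseteq> U" using g(2,6) homeomorphism_image2 by blast
  have ap: "blinfun_apply (Blinfun (g' y)) = g' y" if "y \<in> V" for y
    using bounded_linear_Blinfun_apply has_derivative_bounded_linear g(7)[OF that] by blast
  have "Ck_on k V g" for k
  proof (induction k)
    case 0
    then show ?case using g(6) homeomorphism_cont2 by auto
  next
    case (Suc k)
    have "Ck_on k V (\<lambda>y. deriv_blinfun f (g y))"
      by (rule Ck_on_compose[OF g(4) U(1) smooth_onD[OF sD] Suc gU])
    then have "Ck_on k V (\<lambda>y. Blinfun (g' y))"
    proof (rule Ck_on_blinfun_inverse[OF g(4)])
      fix y assume y: "y \<in> V"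
      note b = g(9)[OF y]
      have e: "blinfun_apply (Blinfun (g' y)) = inv (blinfun_apply (deriv_blinfun f (g y)))"
        unfolding ap[OF y] by (rule g(8)[OF y])
      show "deriv_blinfun f (g y) o\<^sub>L Blinfun (g' y) = id_blinfun"
        by (rule blinfun_eqI) (simp add: e surj_f_inv_f[OF bij_is_surj[OF b]])
      show "Blinfun (g' y) o\<^sub>L deriv_blinfun f (g y) = id_blinfun"
        by (rule blinfun_eqI) (simp add: e inv_f_f[OF bij_is_inj[OF b]])
    qed
    then have "Ck_on k V (\<lambda>y. Blinfun (g' y) v)" for v
      by (rule Ck_on_bounded_linear_compose[OF blinfun.bounded_linear_left g(4)])
    then have "Ck_on k V (\<lambda>y. g' y v)" for v
      by (rule Ck_on_cong[OF g(4), rotated]) (simp add: ap)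
    then show ?case by (intro Ck_on_SucI[OF g(4,7)])
  qed
  then have "smooth_on V g" by (rule smooth_onI)
  then show thesis by (rule that[OF g(1-4,6)])
qed

section \<open>Bump functions and compactly supported maps\<close>

text \<open>The factor \<open>1 / x\<^sup>n\<close> makes the family closed under differentiation, so that smoothness of all its
members is proved by one induction.\<close>

definition flat_exp :: "nat \<Rightarrow> real \<Rightarrow> real" where
  "flat_exp n x = (if x \<le> 0 then 0 else exp (- 1 / x) / x ^ n)"

text \<open>From \<open>exp (1/x) = (exp y)\<^sup>m \<ge> y\<^sup>m\<close> with \<open>m = n + 2\<close> and \<open>y = 1 / (m x)\<close>.  A bound that is quadratic in \<open>x\<close>
yields the derivative \<open>0\<close> at the origin.\<close>

lemma flat_exp_quadratic_bound:
  "\<bar>flat_exp n x\<bar> \<le> real (n + 2) ^ (n + 2) * \<bar>x\<bar>\<^sup>2"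
proof (cases "x \<le> 0")
  case True
  then show ?thesis by (simp add: flat_exp_def)
next
  case False
  then have x: "x > 0" by simp
  let ?m = "n + 2"
  define y where "y = 1 / (x * real ?m)"
  have y: "y > 0" using x by (simp add: y_def add_pos_pos)
  have "y ^ ?m \<le> exp y ^ ?m"
    using y exp_ge_add_one_self[of y] by (intro power_mono) linarith+
  also have "exp y ^ ?m = exp (1 / x)"
    using x by (simp add: y_def exp_of_nat_mult[symmetric] del: of_nat_add power_Suc)
  finally have "y ^ ?m \<le> exp (1 / x)" .
  then have "exp (- 1 / x) \<le> 1 / y ^ ?m"
    using y by (simp add: exp_minus field_simps)
  also have "\<dots> = (x * real ?m) ^ ?m" by (simp add: y_def power_divide)
  also have "\<dots> = (real ?m ^ ?m * x\<^sup>2) * x ^ n" by (simp only: power_mult_distrib power_add mult_ac)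
  finally have "exp (- 1 / x) / x ^ n \<le> real ?m ^ ?m * x\<^sup>2"
    using x by (simp add: divide_le_eq)
  then show ?thesis using x by (simp add: flat_exp_def)
qed

lemma flat_exp_has_derivative:
  "(flat_exp n has_derivative (\<lambda>h. h * (flat_exp (n + 2) x - real n * flat_exp (n + 1) x))) (at x)"
proof -
  consider "x > 0" | "x < 0" | "x = 0" by linarith
  then show ?thesis
  proof cases
    case 1
    have "((\<lambda>x. exp (- 1 / x) / x ^ n) has_real_derivative
        (exp (- 1 / x) * (1 / x\<^sup>2) * x ^ n - exp (- 1 / x) * (real n * x ^ (n - 1))) / (x ^ n * x ^ n)) (at x)"
      using 1 by (auto intro!: derivative_eq_intros simp: power2_eq_square)
    also have "(exp (- 1 / x) * (1 / x\<^sup>2) * x ^ n - exp (- 1 / x) * (real n * x ^ (n - 1))) / (x ^ n * x ^ n)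
        = flat_exp (n + 2) x - real n * flat_exp (n + 1) x"
    proof -
      have "exp (- 1 / x) * (1 / x\<^sup>2) * x ^ n / (x ^ n * x ^ n) = flat_exp (n + 2) x"
        using 1 by (simp add: flat_exp_def power2_eq_square)
      moreover have "exp (- 1 / x) * (real n * x ^ (n - 1)) / (x ^ n * x ^ n) = real n * flat_exp (n + 1) x"
        using 1 by (cases n) (simp_all add: flat_exp_def)
      ultimately show ?thesis by (simp only: diff_divide_distrib)
    qed
    finally have "((\<lambda>x. exp (- 1 / x) / x ^ n) has_derivative
        (\<lambda>h. h * (flat_exp (n + 2) x - real n * flat_exp (n + 1) x))) (at x)"
      unfolding has_field_derivative_def by (rule has_derivative_eq_rhs) (auto simp: mult.commute)
    then show ?thesis
      by (rule has_derivative_transform_within_open[where s = "{0<..}"]) (use 1 in \<open>auto simp: flat_exp_def\<close>)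
  next
    case 2
    have "(flat_exp n has_derivative (\<lambda>h. 0)) (at x)"
      by (rule has_derivative_transform_within_open[OF has_derivative_const[of 0], where s = "{..<0}"])
         (use 2 in \<open>auto simp: flat_exp_def\<close>)
    then show ?thesis using 2 by (simp add: flat_exp_def)
  next
    case 3
    let ?C = "real (n + 2) ^ (n + 2)"
    have "((\<lambda>y. ?C * \<bar>y\<bar>) \<longlongrightarrow> 0) (at 0)"
      by (auto intro!: tendsto_eq_intros)
    then have "((\<lambda>y. norm (flat_exp n y) / norm y) \<longlongrightarrow> 0) (at 0)"
    proof (rule tendsto_sandwich[OF _ _ tendsto_const, rotated 2])
      show "\<forall>\<^sub>F y in at 0. norm (flat_exp n y) / norm y \<le> ?C * \<bar>y\<bar>"
        unfolding eventually_at
        by (intro exI[of _ 1]) (use flat_exp_quadratic_bound[of n] in \<open>auto simp: divide_le_eq power2_eq_square mult.assoc\<close>)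
    qed auto
    then have "(flat_exp n has_derivative (\<lambda>h. 0)) (at 0)"
      by (simp add: has_derivative_iff_norm flat_exp_def[of _ 0])
    then show ?thesis using 3 by (simp add: flat_exp_def)
  qed
qed

lemma Ck_on_flat_exp: "Ck_on k UNIV (flat_exp n)"
proof (induction k arbitrary: n)
  case 0
  then show ?case
    using flat_exp_has_derivative[of n] has_derivative_continuous
    by (fastforce simp: continuous_on_eq_continuous_at)
next
  case (Suc k)
  show ?case
  proof (rule Ck_on_SucI[OF open_UNIV flat_exp_has_derivative])
    fix v
    have "Ck_on k UNIV (\<lambda>x. v *\<^sub>R (flat_exp (n + 2) x + (- real n) *\<^sub>R flat_exp (n + 1) x))"
      by (intro Ck_on_scaleR Ck_on_const Ck_on_add Suc.IH open_UNIV)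
    then show "Ck_on k UNIV (\<lambda>x. v * (flat_exp (n + 2) x - real n * flat_exp (n + 1) x))"
      by simp
  qed
qed

text \<open>With \<open>\<rho>(s) = exp (-1/s)\<close> for \<open>s > 0\<close> and \<open>\<rho>(s) = 0\<close> otherwise, the function \<open>\<rho>(\<rho>(1) - \<rho>(s))\<close> is a
positive constant for \<open>s \<le> 0\<close> and vanishes for \<open>s \<ge> 1\<close>.\<close>

lemma smooth_bump:
  fixes x0 :: "'a::euclidean_space"
  assumes "r > 0"
  obtains h :: "'a \<Rightarrow> real" where "smooth_on UNIV h"
    "\<And>x. x \<in> ball x0 (r / 2) \<Longrightarrow> h x = 1" "\<And>x. x \<notin> ball x0 r \<Longrightarrow> h x = 0"
proof -
  \<comment> \<open>\<open>s\<close> is \<open>0\<close> on the sphere of radius \<open>r / 2\<close> and \<open>1\<close> on the sphere of radius \<open>r\<close>.\<close>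
  define s where "s x = (4 / (3 * r\<^sup>2)) *\<^sub>R ((x - x0) \<bullet> (x - x0) - (r / 2)\<^sup>2)" for x
  define \<rho> where "\<rho> = flat_exp 0"
  define h where "h x = (1 / \<rho> (\<rho> 1)) *\<^sub>R \<rho> (\<rho> 1 - \<rho> (s x))" for x
  have rho: "smooth_on UNIV \<rho>" by (simp add: \<rho>_def smooth_on_def Ck_on_flat_exp)
  have s: "smooth_on UNIV s"
    unfolding s_def
    by (intro smooth_on_scaleR smooth_on_const smooth_on_diff smooth_on_inner smooth_on_id open_UNIV)
  have "smooth_on UNIV h"
    unfolding h_def
    by (intro smooth_on_scaleR smooth_on_const smooth_on_compose[OF _ _ rho] smooth_on_diff s open_UNIV) auto
  moreover have "h x = 1" if "x \<in> ball x0 (r / 2)" for x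
  proof -
    have "norm (x - x0) < r / 2" using that by (simp add: dist_norm norm_minus_commute)
    then have "(norm (x - x0))\<^sup>2 \<le> (r / 2)\<^sup>2" by (intro power_mono) auto
    then have "s x \<le> 0"
      unfolding s_def dot_square_norm real_scaleR_def by (intro mult_nonneg_nonpos) auto
    then have "\<rho> (s x) = 0" by (simp add: \<rho>_def flat_exp_def)
    moreover have "\<rho> (\<rho> 1) > 0" by (simp add: \<rho>_def flat_exp_def)
    ultimately show ?thesis by (simp add: h_def)
  qed
  moreover have "h x = 0" if "x \<notin> ball x0 r" for x
  proof -
    have "norm (x - x0) \<ge> r" using that by (simp add: dist_norm norm_minus_commute)
    then have "(norm (x - x0))\<^sup>2 \<ge> r\<^sup>2" using assms by (intro power_mono) auto
    then have "(4 / (3 * r\<^sup>2)) * ((norm (x - x0))\<^sup>2 - (r / 2)\<^sup>2) \<ge> (4 / (3 * r\<^sup>2)) * (r\<^sup>2 - (r / 2)\<^sup>2)"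
      by (intro mult_left_mono) auto
    also have "(4 / (3 * r\<^sup>2)) * (r\<^sup>2 - (r / 2)\<^sup>2) = 1" using assms by (simp add: field_simps power2_eq_square)
    finally have "s x \<ge> 1" by (simp add: s_def dot_square_norm)
    then have "\<rho> (s x) \<ge> \<rho> 1" by (simp add: \<rho>_def flat_exp_def field_simps)
    then show ?thesis by (simp add: h_def \<rho>_def flat_exp_def[of 0 "_ - _"])
  qed
  ultimately show thesis using that by blast
qed

lemma smooth_cutoff:
  fixes F :: "'a::euclidean_space \<Rightarrow> 'b::real_normed_vector"
  assumes "open U" "z0 \<in> U" "smooth_on U F"
  obtains r G R where "r > 0" "ball z0 r \<subseteq> U" "smooth_on UNIV G" "\<And>z. z \<in> ball z0 r \<Longrightarrow> G z = F z"
    "\<And>z. z \<notin> cball z0 R \<Longrightarrow> G z = 0"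
proof -
  obtain R where R: "R > 0" "cball z0 R \<subseteq> U"
    using assms open_contains_cball by blast
  obtain h :: "'a \<Rightarrow> real" where h: "smooth_on UNIV h"
    "\<And>x. x \<in> ball z0 (R / 2) \<Longrightarrow> h x = 1" "\<And>x. x \<notin> ball z0 R \<Longrightarrow> h x = 0"
    using smooth_bump[OF R(1)] by blast
  have z: "h z = 0" if "z \<notin> cball z0 R" for z using h(3) that ball_subset_cball by blast
  have "smooth_on UNIV (\<lambda>z. h z *\<^sub>R F z)"
  proof (rule smooth_on_local[OF open_UNIV])
    fix x :: 'a
    show "\<exists>T. open T \<and> x \<in> T \<and> smooth_on T (\<lambda>z. h z *\<^sub>R F z)"
    proof (cases "x \<in> U")
      case True
      then show ?thesis
        using assms smooth_on_scaleR[OF assms(1) smooth_on_subset[OF h(1) open_UNIV assms(1)] assms(3)] by blast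
    next
      case False
      then have "x \<in> - cball z0 R" using R by blast
      moreover have "smooth_on (- cball z0 R) (\<lambda>z. h z *\<^sub>R F z)"
        by (rule smooth_on_cong[OF _ smooth_on_const[of _ 0]]) (use z in auto)
      ultimately show ?thesis by (intro exI[of _ "- cball z0 R"]) auto
    qed
  qed
  moreover have "ball z0 (R / 2) \<subseteq> U" using R by (auto simp: subset_iff)
  ultimately show thesis
    using that[of "R / 2" "\<lambda>z. h z *\<^sub>R F z" R] R(1) h(2) z by auto
qed

text \<open>Smooth maps with bounded support.  They and all their derivatives are bounded and globally
Lipschitz, so that differential equations given by them can be treated by contraction on the whole
space.\<close>

definition cs_smooth :: "('a::euclidean_space \<Rightarrow> 'b::real_normed_vector) \<Rightarrow> bool" where
  "cs_smooth G \<longleftrightarrow> smooth_on UNIV G \<and> (\<exists>z0 R. \<forall>z. z \<notin> cball z0 R \<longrightarrow> G z = 0)"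

lemma cs_smooth_has_derivative:
  "cs_smooth G \<Longrightarrow> (G has_derivative frechet_derivative G (at x)) (at x)"
  using smooth_on_has_derivative[of UNIV G x] by (simp add: cs_smooth_def)

lemma cs_smooth_frechet:
  assumes "cs_smooth G"
  shows "cs_smooth (\<lambda>x. frechet_derivative G (at x) v)"
proof -
  obtain z0 R where z: "\<And>z. z \<notin> cball z0 R \<Longrightarrow> G z = 0" using assms by (auto simp: cs_smooth_def)
  have "frechet_derivative G (at x) v = 0" if x: "x \<notin> cball z0 R" for x
  proof -
    have "(G has_derivative (\<lambda>h. 0)) (at x)"
      by (rule has_derivative_transform_within_open[OF has_derivative_const[of 0], where s = "- cball z0 R"])
         (use z x in \<open>auto\<close>)
    then show ?thesis using frechet_derivative_at by metis
  qed
  then show ?thesis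
    using assms smooth_on_frechet unfolding cs_smooth_def by blast
qed

lemma cs_smooth_bounded:
  assumes "cs_smooth G"
  obtains B where "B > 0" "\<And>x. norm (G x) \<le> B"
proof -
  obtain z0 R where z: "\<And>z. z \<notin> cball z0 R \<Longrightarrow> G z = 0" using assms by (auto simp: cs_smooth_def)
  have "continuous_on (cball z0 R) G"
    using assms smooth_on_imp_continuous_on continuous_on_subset unfolding cs_smooth_def by blast
  then have "bounded (G ` cball z0 R)"
    using compact_continuous_image compact_imp_bounded compact_cball by blast
  then obtain B where "B > 0" "\<And>x. x \<in> cball z0 R \<Longrightarrow> norm (G x) \<le> B"
    unfolding bounded_pos by blast
  then have "norm (G x) \<le> B" for x using z by (cases "x \<in> cball z0 R") auto
  with \<open>B > 0\<close> show thesis using that by blast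
qed

lemma cs_smooth_derivative_bound:
  assumes "cs_smooth G"
  obtains L where "L > 0" "\<And>x v. norm (frechet_derivative G (at x) v) \<le> L * norm v"
    "\<And>x y. norm (G x - G y) \<le> L * norm (x - y)"
proof -
  have "\<exists>B>0. \<forall>x. norm (frechet_derivative G (at x) b) \<le> B" for b
    using cs_smooth_bounded[OF cs_smooth_frechet[OF assms, of b]] by blast
  then obtain B where B: "\<And>b. B b > 0" "\<And>b x. norm (frechet_derivative G (at x) b) \<le> B b" by metis
  define L where "L = (\<Sum>b\<in>Basis. B b) + 1"
  have L: "L > 0" unfolding L_def using B(1) by (meson add_nonneg_pos less_imp_le sum_nonneg zero_less_one)
  have 1: "norm (frechet_derivative G (at x) v) \<le> L * norm v" for x v
  proof -
    have "norm (frechet_derivative G (at x) v) \<le> (\<Sum>b\<in>Basis. norm ((v \<bullet> b) *\<^sub>R frechet_derivative G (at x) b))"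
      by (subst bounded_linear_basis_expansion[OF has_derivative_bounded_linear[OF cs_smooth_has_derivative[OF assms]]])
         (rule norm_sum)
    also have "\<dots> \<le> (\<Sum>b\<in>Basis. norm v * B b)"
      using B by (intro sum_mono) (auto intro!: mult_mono Basis_le_norm intro: less_imp_le)
    also have "\<dots> \<le> L * norm v" unfolding sum_distrib_left[symmetric] by (simp add: L_def algebra_simps)
    finally show ?thesis .
  qed
  have 2: "norm (G x - G y) \<le> L * norm (x - y)" for x y
    by (rule differentiable_bound[of UNIV G "\<lambda>x. frechet_derivative G (at x)"])
       (auto intro!: cs_smooth_has_derivative[OF assms] onorm_bound 1 less_imp_le[OF L])
  show thesis using that L 1 2 by blast
qed

lemma cs_smooth_second_order_bound:
  assumes "cs_smooth G"
  obtains M where "M > 0"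
    "\<And>x h. norm (G (x + h) - G x - frechet_derivative G (at x) h) \<le> M * (norm h)\<^sup>2"
proof -
  have "\<exists>B>0. \<forall>x y. norm (frechet_derivative G (at x) b - frechet_derivative G (at y) b) \<le> B * norm (x - y)" for b
    using cs_smooth_derivative_bound[OF cs_smooth_frechet[OF assms, of b]] by metis
  then obtain B where B: "\<And>b. B b > 0"
    "\<And>b x y. norm (frechet_derivative G (at x) b - frechet_derivative G (at y) b) \<le> B b * norm (x - y)" by metis
  define M where "M = (\<Sum>b\<in>Basis. B b) + 1"
  have M: "M > 0" unfolding M_def using B(1) by (meson add_nonneg_pos less_imp_le sum_nonneg zero_less_one)
  note bl = has_derivative_bounded_linear[OF cs_smooth_has_derivative[OF assms]]
  have 1: "norm (frechet_derivative G (at x) v - frechet_derivative G (at y) v) \<le> (M * norm (x - y)) * norm v" for x y v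
  proof -
    have "norm (frechet_derivative G (at x) v - frechet_derivative G (at y) v) =
       norm (\<Sum>b\<in>Basis. (v \<bullet> b) *\<^sub>R (frechet_derivative G (at x) b - frechet_derivative G (at y) b))"
      by (simp add: scaleR_diff_right sum_subtractf bounded_linear_basis_expansion[OF bl, symmetric])
    also have "\<dots> \<le> (\<Sum>b\<in>Basis. norm ((v \<bullet> b) *\<^sub>R (frechet_derivative G (at x) b - frechet_derivative G (at y) b)))"
      by (rule norm_sum)
    also have "\<dots> \<le> (\<Sum>b\<in>Basis. norm v * (B b * norm (x - y)))"
      using B by (intro sum_mono) (auto intro!: mult_mono Basis_le_norm intro: less_imp_le)
    also have "\<dots> = (\<Sum>b\<in>Basis. B b) * (norm (x - y) * norm v)" unfolding sum_distrib_right by (simp add: mult_ac)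
    also have "\<dots> \<le> (M * norm (x - y)) * norm v" by (simp add: M_def algebra_simps)
    finally show ?thesis .
  qed
  have "norm (G (x + h) - G x - frechet_derivative G (at x) h) \<le> M * (norm h)\<^sup>2" for x h
  proof -
    let ?f = "\<lambda>y. G y - frechet_derivative G (at x) y"
    have "norm (?f (x + h) - ?f x) \<le> (M * norm h) * norm ((x + h) - x)"
    proof (rule differentiable_bound[of "cball x (norm h)" ?f "\<lambda>y v. frechet_derivative G (at y) v - frechet_derivative G (at x) v"])
      fix y assume y: "y \<in> cball x (norm h)"
      show "(?f has_derivative (\<lambda>v. frechet_derivative G (at y) v - frechet_derivative G (at x) v)) (at y within cball x (norm h))"
        by (intro has_derivative_diff has_derivative_at_withinI[OF cs_smooth_has_derivative[OF assms]]
             bounded_linear_imp_has_derivative[OF bl])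
      have "M * norm (y - x) \<le> M * norm h" using y M by (simp add: dist_norm norm_minus_commute)
      then show "onorm (\<lambda>v. frechet_derivative G (at y) v - frechet_derivative G (at x) v) \<le> M * norm h"
        using M by (intro onorm_bound) (auto intro!: order_trans[OF 1] mult_right_mono mult_nonneg_nonneg)
    qed (auto simp: dist_norm)
    then show ?thesis
      by (simp add: linear_add[OF bounded_linear.linear[OF bl]] power2_eq_square algebra_simps)
  qed
  then show thesis using that M by blast
qed

section \<open>Smooth dependence of flows on the initial value\<close>

text \<open>The value of \<open>(id - K)\<^sup>-\<^sup>1\<close> at \<open>y\<close> is the fixed point of the contraction \<open>x \<mapsto> y + K x\<close>.\<close>

lemma blinfun_id_minus_contraction_inverse:
  fixes K :: "'x::{real_normed_vector,complete_space} \<Rightarrow>\<^sub>L 'x"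
  assumes "norm K \<le> 1/2"
  obtains R where "(id_blinfun - K) o\<^sub>L R = id_blinfun" "R o\<^sub>L (id_blinfun - K) = id_blinfun"
proof -
  have Kx: "norm (K x) \<le> 1/2 * norm x" for x
    using norm_blinfun[of K x] assms mult_right_mono[OF assms norm_ge_zero[of x]] by linarith
  have "\<exists>!x. y + K x = x" for y
    by (rule banach_fix_type[of "1/2"])
       (use Kx in \<open>auto simp: dist_norm blinfun.diff_right[symmetric]\<close>)
  then obtain r where r: "\<And>y. y + K (r y) = r y" and uniq: "\<And>x y. y + K x = x \<Longrightarrow> x = r y"
    by metis
  have "bounded_linear r"
  proof (rule bounded_linear_intro[of _ 2])
    show "r (x + y) = r x + r y" for x y
      by (rule uniq[symmetric]) (metis r blinfun.add_right add.assoc add.commute)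
    show "r (a *\<^sub>R x) = a *\<^sub>R r x" for a x
      by (rule uniq[symmetric]) (metis r blinfun.scaleR_right scaleR_add_right)
    show "norm (r x) \<le> norm x * 2" for x
      using norm_triangle_ineq[of x "K (r x)"] Kx[of "r x"] r[of x] by (simp add: r)
  qed
  then have ap: "blinfun_apply (Blinfun r) = r" by (rule bounded_linear_Blinfun_apply)
  show thesis
  proof (rule that[of "Blinfun r"])
    show "(id_blinfun - K) o\<^sub>L Blinfun r = id_blinfun"
      by (rule blinfun_eqI) (use r in \<open>simp add: ap blinfun.bilinear_simps algebra_simps\<close>)
    show "Blinfun r o\<^sub>L (id_blinfun - K) = id_blinfun"
      by (rule blinfun_eqI) (simp add: ap blinfun.bilinear_simps uniq[symmetric])
  qed
qed

text \<open>The superposition (Nemytskii) operator \<open>\<phi> \<mapsto> G \<circ> \<phi>\<close> on bounded continuous curves.\<close>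

definition nemytskii :: "('z \<Rightarrow> 'z) \<Rightarrow> (real \<Rightarrow>\<^sub>C 'z) \<Rightarrow> (real \<Rightarrow>\<^sub>C 'z::euclidean_space)" where
  "nemytskii G \<phi> = Bcontfun (\<lambda>t. G (\<phi> t))"

lemma nemytskii_apply:
  assumes "cs_smooth G"
  shows "nemytskii G \<phi> t = G (\<phi> t)"
proof -
  obtain B where B: "\<And>x. norm (G x) \<le> B" using cs_smooth_bounded[OF assms] by metis
  have "continuous_on UNIV G" using assms smooth_on_imp_continuous_on by (auto simp: cs_smooth_def)
  then have "continuous_on UNIV (\<lambda>t. G (\<phi> t))"
    by (rule continuous_on_compose2) auto
  then have "(\<lambda>t. G (\<phi> t)) \<in> bcontfun" using B by (rule bcontfun_normI)
  then show ?thesis by (simp add: nemytskii_def Bcontfun_inverse)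
qed

text \<open>The bilinear building block for the derivative of a superposition operator: in
\<open>DG(\<phi>) h = (\<Sum>b. (h \<bullet> b) D\<^sub>bG(\<phi>))\<close> each summand is such a product of \<open>h\<close> with a superposition
operator for the map \<open>D\<^sub>bG\<close>, which has the same type as \<open>G\<close>.\<close>

definition coord_mult :: "'z \<Rightarrow> (real \<Rightarrow>\<^sub>C 'z) \<Rightarrow> (real \<Rightarrow>\<^sub>C 'z) \<Rightarrow> (real \<Rightarrow>\<^sub>C 'z::euclidean_space)" where
  "coord_mult b \<psi> h = Bcontfun (\<lambda>t. (h t \<bullet> b) *\<^sub>R \<psi> t)"

lemma coord_mult_apply: "coord_mult b \<psi> h t = (h t \<bullet> b) *\<^sub>R \<psi> t"
proof -
  have "(\<lambda>t. (h t \<bullet> b) *\<^sub>R \<psi> t) \<in> bcontfun"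
  proof (rule bcontfun_normI)
    show "continuous_on UNIV (\<lambda>t. (h t \<bullet> b) *\<^sub>R \<psi> t)" by (intro continuous_intros) auto
    show "norm ((h t \<bullet> b) *\<^sub>R \<psi> t) \<le> norm h * norm b * norm \<psi>" for t
      by (simp, intro mult_mono order_trans[OF Cauchy_Schwarz_ineq2] norm_bounded) auto
  qed
  then show ?thesis by (simp add: coord_mult_def Bcontfun_inverse)
qed

lemma bounded_bilinear_coord_mult: "bounded_bilinear (coord_mult b)"
proof
  fix f g h k :: "real \<Rightarrow>\<^sub>C 'a" and r :: real
  show "coord_mult b (f + g) h = coord_mult b f h + coord_mult b g h"
    by (rule bcontfun_eqI) (simp add: coord_mult_apply algebra_simps)
  show "coord_mult b f (h + k) = coord_mult b f h + coord_mult b f k"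
    by (rule bcontfun_eqI) (simp add: coord_mult_apply algebra_simps)
  show "coord_mult b (r *\<^sub>R f) h = r *\<^sub>R coord_mult b f h"
    by (rule bcontfun_eqI) (simp add: coord_mult_apply)
  show "coord_mult b f (r *\<^sub>R h) = r *\<^sub>R coord_mult b f h"
    by (rule bcontfun_eqI) (simp add: coord_mult_apply)
  show "\<exists>K. \<forall>f h. norm (coord_mult b f h) \<le> norm f * norm h * K"
  proof (intro exI allI)
    fix f h :: "real \<Rightarrow>\<^sub>C 'a"
    show "norm (coord_mult b f h) \<le> norm f * norm h * norm b"
    proof (rule norm_bound)
      fix t
      have "norm (coord_mult b f h t) \<le> (norm h * norm b) * norm f"
        unfolding coord_mult_apply
        by (simp, intro mult_mono order_trans[OF Cauchy_Schwarz_ineq2] norm_bounded) auto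
      then show "norm (coord_mult b f h t) \<le> norm f * norm h * norm b" by (simp add: mult_ac)
    qed
  qed
qed

definition nemytskii_deriv :: "('z \<Rightarrow> 'z) \<Rightarrow> (real \<Rightarrow>\<^sub>C 'z) \<Rightarrow> (real \<Rightarrow>\<^sub>C 'z) \<Rightarrow>\<^sub>L (real \<Rightarrow>\<^sub>C 'z::euclidean_space)" where
  "nemytskii_deriv G \<phi> = (\<Sum>b\<in>Basis.
     bounded_bilinear.prod_right (coord_mult b) (nemytskii (\<lambda>x. frechet_derivative G (at x) b) \<phi>))"

lemma bcontfun_apply_sum: "apply_bcontfun (sum f I) x = (\<Sum>i\<in>I. apply_bcontfun (f i) x)"
  by (induction I rule: infinite_finite_induct) auto

lemma nemytskii_deriv_sum:
  "blinfun_apply (nemytskii_deriv G \<phi>) h = (\<Sum>b\<in>Basis. coord_mult b (nemytskii (\<lambda>x. frechet_derivative G (at x) b) \<phi>) h)"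
  by (simp add: nemytskii_deriv_def blinfun_apply_sum bounded_bilinear.prod_right.rep_eq[OF bounded_bilinear_coord_mult])

lemma nemytskii_deriv_apply:
  assumes "cs_smooth G"
  shows "blinfun_apply (nemytskii_deriv G \<phi>) h t = frechet_derivative G (at (\<phi> t)) (h t)"
  unfolding nemytskii_deriv_sum bcontfun_apply_sum coord_mult_apply nemytskii_apply[OF cs_smooth_frechet[OF assms]]
  by (rule bounded_linear_basis_expansion[OF has_derivative_bounded_linear[OF cs_smooth_has_derivative[OF assms]], symmetric])

lemma has_derivative_quadratic_remainder:
  assumes "bounded_linear D" "\<And>h. norm (f (x + h) - f x - D h) \<le> M * (norm h)\<^sup>2"
  shows "(f has_derivative D) (at x)"
  unfolding has_derivative_at
proof (intro conjI assms(1))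
  have "((\<lambda>h. \<bar>M\<bar> * norm h) \<longlongrightarrow> 0) (at (0 :: 'a))"
    by (auto intro!: tendsto_eq_intros)
  then show "(\<lambda>h. norm (f (x + h) - f x - D h) / norm h) \<midarrow>0\<rightarrow> 0"
  proof (rule tendsto_sandwich[OF _ _ tendsto_const, rotated 2])
    show "\<forall>\<^sub>F h in at 0. norm (f (x + h) - f x - D h) / norm h \<le> \<bar>M\<bar> * norm h"
    proof (rule always_eventually, rule allI)
      fix h
      have "norm (f (x + h) - f x - D h) \<le> \<bar>M\<bar> * (norm h)\<^sup>2"
        using assms(2)[of h] by (smt (verit) mult_right_mono zero_le_power2)
      then show "norm (f (x + h) - f x - D h) / norm h \<le> \<bar>M\<bar> * norm h"
        by (cases "h = 0") (auto simp: divide_le_eq power2_eq_square mult.assoc)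
    qed
  qed auto
qed

text \<open>The second-order Taylor remainder of \<open>G\<close> is \<open>O(\<parallel>h\<parallel>\<^sup>2)\<close> uniformly in the base point, hence the
pointwise estimate is one in the supremum norm.\<close>

lemma nemytskii_has_derivative:
  assumes "cs_smooth G"
  shows "(nemytskii G has_derivative blinfun_apply (nemytskii_deriv G \<phi>)) (at \<phi>)"
proof -
  obtain M where M: "M > 0"
    "\<And>x h. norm (G (x + h) - G x - frechet_derivative G (at x) h) \<le> M * (norm h)\<^sup>2"
    using cs_smooth_second_order_bound[OF assms] by metis
  show ?thesis
  proof (rule has_derivative_quadratic_remainder[OF blinfun.bounded_linear_right, of _ _ _ M])
    fix h
    show "norm (nemytskii G (\<phi> + h) - nemytskii G \<phi> - nemytskii_deriv G \<phi> h) \<le> M * (norm h)\<^sup>2"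
    proof (rule norm_bound)
      fix t
      have "norm ((nemytskii G (\<phi> + h) - nemytskii G \<phi> - nemytskii_deriv G \<phi> h) t) \<le> M * (norm (h t))\<^sup>2"
        using M(2)[of "\<phi> t" "h t"] by (simp add: nemytskii_apply nemytskii_deriv_apply assms)
      also have "\<dots> \<le> M * (norm h)\<^sup>2"
        using M(1) by (intro mult_left_mono power_mono norm_bounded) auto
      finally show "norm ((nemytskii G (\<phi> + h) - nemytskii G \<phi> - nemytskii_deriv G \<phi> h) t) \<le> M * (norm h)\<^sup>2" .
    qed
  qed
qed

text \<open>The derivative of \<open>G \<circ> U z\<close> in \<open>z\<close> only involves \<open>DU\<close> and superposition operators for the
directional derivatives of \<open>G\<close>; therefore the induction on \<open>k\<close> runs over all \<open>G\<close> at once.\<close>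

lemma Ck_on_nemytskii:
  assumes "open S" "Ck_on k S U" "cs_smooth G"
  shows "Ck_on k S (\<lambda>z. nemytskii G (U z))"
  using assms(2,3)
proof (induction k arbitrary: G)
  case 0
  have "continuous_on UNIV (nemytskii G)"
    using nemytskii_has_derivative[OF 0(2)] has_derivative_continuous by (blast intro: continuous_at_imp_continuous_on)
  then show ?case using 0(1) by (auto intro: continuous_on_compose2)
next
  case (Suc k)
  show ?case
  proof (rule Ck_on_SucI[OF \<open>open S\<close>])
    show "((\<lambda>z. nemytskii G (U z)) has_derivative
        (\<lambda>v. nemytskii_deriv G (U z) (frechet_derivative U (at z) v))) (at z)" if "z \<in> S" for z
      by (rule has_derivative_compose[OF Ck_on_has_derivative[OF Suc.prems(1) assms(1) that] nemytskii_has_derivative[OF Suc.prems(2)]])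
    fix v
    show "Ck_on k S (\<lambda>z. nemytskii_deriv G (U z) (frechet_derivative U (at z) v))"
      unfolding nemytskii_deriv_sum
    proof (intro Ck_on_sum Ck_on_bounded_bilinear[OF bounded_bilinear_coord_mult] assms(1))
      show "Ck_on k S (\<lambda>z. nemytskii (\<lambda>x. frechet_derivative G (at x) b) (U z))" for b
        by (rule Suc.IH[OF Ck_on_SucD[OF Suc.prems(1)] cs_smooth_frechet[OF Suc.prems(2)]])
      show "Ck_on k S (\<lambda>z. frechet_derivative U (at z) v)" using Suc.prems(1) by simp
    qed
  qed
qed

lemma Ck_on_nemytskii_deriv:
  assumes "open S" "Ck_on k S U" "cs_smooth G"
  shows "Ck_on k S (\<lambda>z. nemytskii_deriv G (U z))"
  unfolding nemytskii_deriv_def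
  by (intro Ck_on_sum Ck_on_bounded_linear_compose[OF bounded_bilinear.bounded_linear_prod_right[OF bounded_bilinear_coord_mult]]
      Ck_on_nemytskii cs_smooth_frechet assms)

definition time_clamp :: "real \<Rightarrow> real \<Rightarrow> real" where
  "time_clamp \<tau> t = max (- \<tau>) (min \<tau> t)"

text \<open>The primitive that vanishes at \<open>0\<close>, extended by constants outside \<open>[-\<tau>, \<tau>]\<close>.  It is a bounded
function, and the operator norm is at most \<open>\<tau>\<close>.\<close>

definition primitive :: "real \<Rightarrow> (real \<Rightarrow>\<^sub>C 'z) \<Rightarrow> (real \<Rightarrow>\<^sub>C 'z::euclidean_space)" where
  "primitive \<tau> \<phi> = Bcontfun (\<lambda>t. integral {- \<tau>..time_clamp \<tau> t} \<phi> - integral {- \<tau>..0} \<phi>)"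

lemma primitive_bound:
  fixes \<phi> :: "real \<Rightarrow>\<^sub>C 'z::euclidean_space"
  assumes "\<tau> > 0" "t \<in> {-\<tau>..\<tau>}"
  shows "norm (integral {- \<tau>..t} (apply_bcontfun \<phi>) - integral {- \<tau>..0} (apply_bcontfun \<phi>)) \<le> norm \<phi> * \<tau>"
proof -
  have "norm (integral {- \<tau>..t} (apply_bcontfun \<phi>) - integral {- \<tau>..0} (apply_bcontfun \<phi>)) \<le> norm \<phi> * norm (t - 0)"
  proof (rule differentiable_bound[of "{-\<tau>..\<tau>}" _ "\<lambda>t h. h *\<^sub>R \<phi> t"])
    show "((\<lambda>t. integral {- \<tau>..t} (apply_bcontfun \<phi>)) has_derivative (\<lambda>h. h *\<^sub>R \<phi> t)) (at t within {-\<tau>..\<tau>})" if "t \<in> {-\<tau>..\<tau>}" for t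
      using integral_has_vector_derivative[OF continuous_on_apply_bcontfun that] unfolding has_vector_derivative_def .
    show "onorm (\<lambda>h. h *\<^sub>R \<phi> t) \<le> norm \<phi>" for t
      by (rule onorm_bound) (auto simp: mult.commute[of "norm \<phi>"] intro!: mult_left_mono norm_bounded)
  qed (use assms in auto)
  also have "\<dots> \<le> norm \<phi> * \<tau>" using assms by (intro mult_left_mono) auto
  finally show ?thesis .
qed

lemma primitive_apply:
  assumes "\<tau> > 0"
  shows "primitive \<tau> \<phi> t = integral {- \<tau>..time_clamp \<tau> t} \<phi> - integral {- \<tau>..0} \<phi>"
proof -
  have "(\<lambda>t. integral {- \<tau>..time_clamp \<tau> t} (apply_bcontfun \<phi>) - integral {- \<tau>..0} (apply_bcontfun \<phi>)) \<in> bcontfun"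
  proof (rule bcontfun_normI)
    have "continuous_on {-\<tau>..\<tau>} (\<lambda>t. integral {- \<tau>..t} (apply_bcontfun \<phi>))"
      by (intro indefinite_integral_continuous_1 integrable_continuous_real) auto
    moreover have "continuous_on UNIV (time_clamp \<tau>)" unfolding time_clamp_def by (intro continuous_intros)
    ultimately have "continuous_on UNIV (\<lambda>t. integral {- \<tau>..time_clamp \<tau> t} (apply_bcontfun \<phi>))"
      by (rule continuous_on_compose2) (use assms in \<open>auto simp: time_clamp_def\<close>)
    then show "continuous_on UNIV (\<lambda>t. integral {- \<tau>..time_clamp \<tau> t} (apply_bcontfun \<phi>) - integral {- \<tau>..0} (apply_bcontfun \<phi>))"
      by (intro continuous_intros)
    show "norm (integral {- \<tau>..time_clamp \<tau> t} (apply_bcontfun \<phi>) - integral {- \<tau>..0} (apply_bcontfun \<phi>)) \<le> norm \<phi> * \<tau>" for t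
      by (rule primitive_bound[OF assms]) (use assms in \<open>auto simp: time_clamp_def\<close>)
  qed
  then show ?thesis by (simp add: primitive_def Bcontfun_inverse)
qed

lemma primitive_norm:
  assumes "\<tau> > 0"
  shows "norm (primitive \<tau> \<phi>) \<le> norm \<phi> * \<tau>"
  by (rule norm_bound) (unfold primitive_apply[OF assms],
     rule primitive_bound[OF assms], use assms in \<open>auto simp: time_clamp_def\<close>)

lemma bounded_linear_primitive:
  assumes "\<tau> > 0"
  shows "bounded_linear (primitive \<tau>)"
proof (rule bounded_linear_intro[of _ \<tau>])
  have i: "apply_bcontfun \<phi> integrable_on {a..b}" for \<phi> :: "real \<Rightarrow>\<^sub>C 'a" and a b
    by (intro integrable_continuous_real) auto
  show "primitive \<tau> (x + y) = primitive \<tau> x + primitive \<tau> y" for x y :: "real \<Rightarrow>\<^sub>C 'a"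
    by (rule bcontfun_eqI) (simp add: primitive_apply[OF assms] integral_add[OF i i])
  show "primitive \<tau> (r *\<^sub>R x) = r *\<^sub>R primitive \<tau> x" for r and x :: "real \<Rightarrow>\<^sub>C 'a"
    by (rule bcontfun_eqI) (simp add: primitive_apply[OF assms] scaleR_diff_right)
qed (rule primitive_norm[OF assms])

lemma primitive_zero: "\<tau> > 0 \<Longrightarrow> primitive \<tau> \<phi> 0 = 0"
  by (simp add: primitive_apply time_clamp_def)

lemma primitive_has_vector_derivative:
  assumes "\<bar>t\<bar> < \<tau>"
  shows "(primitive \<tau> \<phi> has_vector_derivative \<phi> t) (at t)"
proof -
  have "((\<lambda>t. integral {- \<tau>..t} (apply_bcontfun \<phi>)) has_vector_derivative \<phi> t) (at t within {-\<tau>..\<tau>})"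
    by (rule integral_has_vector_derivative) (use assms in auto)
  then have "((\<lambda>t. integral {- \<tau>..t} (apply_bcontfun \<phi>)) has_vector_derivative \<phi> t) (at t)"
    using assms by (subst (asm) at_within_interior) (auto simp: abs_less_iff)
  then have "((\<lambda>t. integral {- \<tau>..t} (apply_bcontfun \<phi>) - integral {- \<tau>..0} (apply_bcontfun \<phi>)) has_vector_derivative \<phi> t) (at t)"
    by (auto intro!: derivative_eq_intros)
  then show ?thesis
    by (rule has_vector_derivative_transform_within_open[of _ _ _ "{-\<tau><..<\<tau>}"])
       (use assms in \<open>auto simp: primitive_apply time_clamp_def\<close>)
qed

text \<open>The flow \<open>u z t\<close> of a compactly supported smooth vector field for times \<open>|t| < \<tau>\<close>.  It is found as
the fixed point of \<open>\<phi> \<mapsto> z + J (G \<circ> \<phi>)\<close> on the space of bounded continuous curves, where \<open>J\<close> takes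
primitives.  The last property is the variational equation: \<open>W\<close> is the derivative of the flow in
direction \<open>v\<close>, and it solves the linearized system with initial value \<open>v\<close>.\<close>

lemma flow_exists:
  fixes G :: "'z::euclidean_space \<Rightarrow> 'z"
  assumes "cs_smooth G"
  obtains \<tau> u where "\<tau> > 0"
    "\<And>t. smooth_on UNIV (\<lambda>z. u z t)" "\<And>z. u z 0 = z"
    "\<And>z t. \<bar>t\<bar> < \<tau> \<Longrightarrow> (u z has_vector_derivative G (u z t)) (at t)"
    "\<And>z y t. norm (u z t - u y t) \<le> 2 * norm (z - y)"
    "\<And>z. G z = 0 \<Longrightarrow> u z = (\<lambda>t. z)"
    "\<And>z v. \<exists>W. W 0 = v \<and> (\<forall>t. W t = frechet_derivative (\<lambda>z. u z t) (at z) v) \<and>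
       (\<forall>t. \<bar>t\<bar> < \<tau> \<longrightarrow> (W has_vector_derivative frechet_derivative G (at (u z t)) (W t)) (at t))"
proof -
  obtain L where L: "L > 0" "\<And>x v. norm (frechet_derivative G (at x) v) \<le> L * norm v"
    "\<And>x y. norm (G x - G y) \<le> L * norm (x - y)"
    using cs_smooth_derivative_bound[OF assms] by metis
  \<comment> \<open>For this time span the integral operator is a contraction with constant \<open>1/2\<close>.\<close>
  define \<tau> where "\<tau> = 1 / (2 * L)"
  have \<tau>: "\<tau> > 0" "L * \<tau> = 1/2" using L(1) by (auto simp: \<tau>_def)
  define J where "J = Blinfun (primitive \<tau> :: (real \<Rightarrow>\<^sub>C 'z) \<Rightarrow> _)"
  have J: "blinfun_apply J = primitive \<tau>"
    unfolding J_def by (rule bounded_linear_Blinfun_apply[OF bounded_linear_primitive[OF \<tau>(1)]])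
  define N where "N = nemytskii G"
  have N: "norm (N \<phi> - N \<psi>) \<le> L * norm (\<phi> - \<psi>)" for \<phi> \<psi>
  proof (rule norm_bound)
    fix t
    have "norm ((N \<phi> - N \<psi>) t) \<le> L * norm ((\<phi> - \<psi>) t)"
      using L(3) by (simp add: N_def nemytskii_apply[OF assms])
    also have "\<dots> \<le> L * norm (\<phi> - \<psi>)" using L(1) by (intro mult_left_mono norm_bounded) auto
    finally show "norm ((N \<phi> - N \<psi>) t) \<le> L * norm (\<phi> - \<psi>)" .
  qed
  have JN: "norm (J (N \<phi>) - J (N \<psi>)) \<le> 1/2 * norm (\<phi> - \<psi>)" for \<phi> \<psi>
  proof -
    have "norm (J (N \<phi>) - J (N \<psi>)) \<le> norm (N \<phi> - N \<psi>) * \<tau>"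
      unfolding blinfun.diff_right[symmetric] unfolding J by (rule primitive_norm[OF \<tau>(1)])
    also have "\<dots> \<le> L * norm (\<phi> - \<psi>) * \<tau>" using N \<tau>(1) by (intro mult_right_mono) auto
    also have "\<dots> = 1/2 * norm (\<phi> - \<psi>)" using \<tau>(2) by (metis mult.assoc mult.commute)
    finally show ?thesis .
  qed
  have "\<exists>!\<phi>. w + J (N \<phi>) = \<phi>" for w
    by (rule banach_fix_type[of "1/2"]) (use JN in \<open>auto simp: dist_norm\<close>)
  \<comment> \<open>\<open>\<Psi>\<close> inverts \<open>\<phi> \<mapsto> \<phi> - J (N \<phi>)\<close> on the space of curves; the flow is its restriction to constants.\<close>
  then obtain \<Psi> where \<Psi>: "\<And>w. w + J (N (\<Psi> w)) = \<Psi> w" and uniq: "\<And>w \<phi>. w + J (N \<phi>) = \<phi> \<Longrightarrow> \<phi> = \<Psi> w"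
    by metis
  have lip: "norm (\<Psi> w - \<Psi> w') \<le> 2 * norm (w - w')" for w w'
  proof -
    have "\<Psi> w - \<Psi> w' = (w - w') + (J (N (\<Psi> w)) - J (N (\<Psi> w')))"
      using \<Psi>[of w] \<Psi>[of w'] by (metis add_diff_add)
    then have "norm (\<Psi> w - \<Psi> w') \<le> norm (w - w') + norm (J (N (\<Psi> w)) - J (N (\<Psi> w')))"
      by (metis norm_triangle_ineq)
    with JN[of "\<Psi> w" "\<Psi> w'"] show ?thesis by linarith
  qed
  have "isCont \<Psi> w" for w
  proof -
    have "((\<lambda>y. 2 * norm (y - w)) \<longlongrightarrow> 0) (at w)" by (auto intro!: tendsto_eq_intros)
    then have "((\<lambda>y. norm (\<Psi> y - \<Psi> w)) \<longlongrightarrow> 0) (at w)"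
      by (rule tendsto_sandwich[OF _ _ tendsto_const, rotated 2]) (use lip in auto)
    then show ?thesis by (simp add: isCont_def LIM_zero_iff tendsto_norm_zero_iff)
  qed
  note cont = this
  let ?A = "\<lambda>\<phi>. id_blinfun - (J o\<^sub>L nemytskii_deriv G \<phi>)"
  have "\<exists>R. ?A \<phi> o\<^sub>L R = id_blinfun \<and> R o\<^sub>L ?A \<phi> = id_blinfun" for \<phi>
  proof -
    have "norm (J o\<^sub>L nemytskii_deriv G \<phi>) \<le> 1/2"
    proof (rule norm_blinfun_bound)
      fix h
      have "norm (nemytskii_deriv G \<phi> h) \<le> L * norm h"
      proof (rule norm_bound)
        fix t
        have "norm (nemytskii_deriv G \<phi> h t) \<le> L * norm (h t)"
          using L(2) by (simp add: nemytskii_deriv_apply[OF assms])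
        also have "\<dots> \<le> L * norm h" using L(1) by (intro mult_left_mono norm_bounded) auto
        finally show "norm (nemytskii_deriv G \<phi> h t) \<le> L * norm h" .
      qed
      then have "norm (nemytskii_deriv G \<phi> h) * \<tau> \<le> L * norm h * \<tau>" using \<tau>(1) by (intro mult_right_mono) auto
      also have "\<dots> = 1/2 * norm h" using \<tau>(2) by (metis mult.assoc mult.commute)
      finally show "norm ((J o\<^sub>L nemytskii_deriv G \<phi>) h) \<le> 1/2 * norm h"
        using primitive_norm[OF \<tau>(1), of "nemytskii_deriv G \<phi> h"] by (simp add: J)
    qed auto
    then show ?thesis using blinfun_id_minus_contraction_inverse by metis
  qed
  then obtain R where R: "\<And>\<phi>. ?A \<phi> o\<^sub>L R \<phi> = id_blinfun" "\<And>\<phi>. R \<phi> o\<^sub>L ?A \<phi> = id_blinfun" by metis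
  \<comment> \<open>The derivative of an inverse map is the inverse \<open>R\<close> of the derivative \<open>?A\<close>.\<close>
  have d\<Psi>: "(\<Psi> has_derivative blinfun_apply (R (\<Psi> w))) (at w)" for w
  proof (rule has_derivative_inverse_basic[where f = "\<lambda>\<phi>. \<phi> - J (N \<phi>)" and T = UNIV])
    show "((\<lambda>\<phi>. \<phi> - J (N \<phi>)) has_derivative blinfun_apply (?A (\<Psi> w))) (at (\<Psi> w))"
    proof -
      have "((\<lambda>\<phi>. \<phi> - J (N \<phi>)) has_derivative (\<lambda>h. h - J (nemytskii_deriv G (\<Psi> w) h))) (at (\<Psi> w))"
        unfolding N_def
        by (intro has_derivative_diff has_derivative_ident
            bounded_linear.has_derivative[OF blinfun.bounded_linear_right] nemytskii_has_derivative assms)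
      then show ?thesis by (rule has_derivative_eq_rhs) (auto simp: blinfun.bilinear_simps)
    qed
    show "blinfun_apply (R (\<Psi> w)) \<circ> blinfun_apply (?A (\<Psi> w)) = id"
      unfolding fun_eq_iff comp_apply blinfun_apply_blinfun_compose[symmetric] R(2) by simp
    show "\<Psi> z - J (N (\<Psi> z)) = z" for z using \<Psi>[of z] by (metis add_diff_cancel_right')
  qed (auto intro: cont blinfun.bounded_linear_right)
  define C where "C = (const_bcontfun :: 'z \<Rightarrow> (real \<Rightarrow>\<^sub>C 'z))"
  have C: "bounded_linear C"
    unfolding C_def
    by (rule bounded_linear_intro[of _ 1]) (auto intro!: bcontfun_eqI norm_bound simp: const_bcontfun.rep_eq)
  define U where "U z = \<Psi> (C z)" for z
  have dU: "(U has_derivative (\<lambda>v. R (U z) (C v))) (at z)" for z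
    unfolding U_def
    by (rule has_derivative_compose[OF bounded_linear_imp_has_derivative[OF C] d\<Psi>])
  \<comment> \<open>If \<open>U\<close> is \<open>C\<^sup>k\<close>, so are the operators \<open>?A (U z)\<close> and their inverses, hence the derivative of \<open>U\<close>.\<close>
  have CkU: "Ck_on k UNIV U" for k
  proof (induction k)
    case 0
    show ?case
      unfolding Ck_on.simps by (intro continuous_at_imp_continuous_on ballI has_derivative_continuous[OF dU])
  next
    case (Suc k)
    have "Ck_on k UNIV (\<lambda>z. ?A (U z))"
    proof -
      have "Ck_on k UNIV (\<lambda>z. id_blinfun + - (J o\<^sub>L nemytskii_deriv G (U z)))"
        by (intro Ck_on_add Ck_on_const open_UNIV Ck_on_nemytskii_deriv Suc assms
           Ck_on_bounded_linear_compose[OF bounded_linear_minus[OF bounded_bilinear.bounded_linear_right[OF bounded_bilinear_blinfun_compose]]])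
      then show ?thesis by simp
    qed
    then have "Ck_on k UNIV (\<lambda>z. R (U z))"
      by (rule Ck_on_blinfun_inverse[OF open_UNIV]) (rule R)+
    then show ?case
      by (intro Ck_on_SucI[OF open_UNIV dU] Ck_on_bounded_linear_compose[OF blinfun.bounded_linear_left] open_UNIV)
  qed
  have bl: "bounded_linear (\<lambda>\<phi>::real \<Rightarrow>\<^sub>C 'z. apply_bcontfun \<phi> t)" for t
    by (rule bounded_linear_intro[of _ 1]) (auto intro: norm_bounded)
  define u where "u z = apply_bcontfun (U z)" for z
  have Ueq: "U z = C z + primitive \<tau> (N (U z))" for z
    using \<Psi>[of "C z"] by (simp add: U_def J)
  have ueq: "u z t = z + primitive \<tau> (N (U z)) t" for z t
    unfolding u_def by (subst Ueq) (simp add: C_def const_bcontfun.rep_eq)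
  have c: "smooth_on UNIV (\<lambda>z. u z t)" for t
    unfolding u_def smooth_on_def by (intro allI Ck_on_bounded_linear_compose[OF bl] CkU open_UNIV)
  moreover have "u z 0 = z" for z by (simp add: ueq primitive_zero \<tau>)
  moreover have "(u z has_vector_derivative G (u z t)) (at t)" if "\<bar>t\<bar> < \<tau>" for z t
  proof -
    have "((\<lambda>t. z + primitive \<tau> (N (U z)) t) has_vector_derivative (0 + N (U z) t)) (at t)"
      by (intro has_vector_derivative_add primitive_has_vector_derivative that has_vector_derivative_const)
    moreover have "(\<lambda>t. z + primitive \<tau> (N (U z)) t) = u z" by (rule ext) (rule ueq[symmetric])
    ultimately show ?thesis by (simp add: N_def nemytskii_apply[OF assms] u_def)
  qed
  moreover have "norm (u z t - u y t) \<le> 2 * norm (z - y)" for z y t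
  proof -
    have "norm (u z t - u y t) \<le> norm (U z - U y)"
      unfolding u_def by (metis minus_bcontfun.rep_eq norm_bounded)
    also have "\<dots> \<le> 2 * norm (C z - C y)" unfolding U_def by (rule lip)
    also have "norm (C z - C y) \<le> norm (z - y)"
      by (rule norm_bound) (simp add: C_def const_bcontfun.rep_eq)
    finally show ?thesis by simp
  qed
  moreover have "u z = (\<lambda>t. z)" if "G z = 0" for z
  proof -
    have "N (C z) = 0" by (rule bcontfun_eqI) (simp add: N_def nemytskii_apply[OF assms] C_def const_bcontfun.rep_eq that)
    then have "C z + J (N (C z)) = C z" by (simp add: blinfun.zero_right)
    then have "U z = C z" unfolding U_def by (rule uniq[symmetric])
    then show ?thesis by (simp add: u_def C_def const_bcontfun.rep_eq)
  qed
  moreover have "\<exists>W. W 0 = v \<and> (\<forall>t. W t = frechet_derivative (\<lambda>z. u z t) (at z) v) \<and>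
       (\<forall>t. \<bar>t\<bar> < \<tau> \<longrightarrow> (W has_vector_derivative frechet_derivative G (at (u z t)) (W t)) (at t))" for z v
  proof -
    define W where "W = R (U z) (C v)"
    have "?A (U z) W = C v"
      unfolding W_def blinfun_apply_blinfun_compose[symmetric] R(1) by simp
    then have "W - primitive \<tau> (nemytskii_deriv G (U z) W) = C v"
      by (simp add: blinfun.bilinear_simps J)
    then have Weq: "W = C v + primitive \<tau> (nemytskii_deriv G (U z) W)" by (metis diff_add_cancel)
    have Wt: "apply_bcontfun W = (\<lambda>t. v + primitive \<tau> (nemytskii_deriv G (U z) W) t)"
      by (subst Weq) (auto simp add: C_def const_bcontfun.rep_eq)
    have "((\<lambda>z. u z t) has_derivative (\<lambda>v. R (U z) (C v) t)) (at z)" for t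
      unfolding u_def by (rule bounded_linear.has_derivative[OF bl dU])
    then have "frechet_derivative (\<lambda>z. u z t) (at z) = (\<lambda>v. R (U z) (C v) t)" for t
      using frechet_derivative_at by metis
    moreover have "W 0 = v" by (subst Wt) (simp add: primitive_zero \<tau>)
    moreover have "(apply_bcontfun W has_vector_derivative frechet_derivative G (at (u z t)) (W t)) (at t)" if "\<bar>t\<bar> < \<tau>" for t
    proof -
      have "((\<lambda>t. v + primitive \<tau> (nemytskii_deriv G (U z) W) t) has_vector_derivative (0 + nemytskii_deriv G (U z) W t)) (at t)"
        by (intro has_vector_derivative_add primitive_has_vector_derivative that has_vector_derivative_const)
      then show ?thesis using Wt by (simp add: nemytskii_deriv_apply[OF assms] u_def)
    qed
    ultimately show ?thesis by (intro exI[of _ "apply_bcontfun W"]) (auto simp: W_def)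
  qed
  ultimately show thesis using that[of \<tau> u] \<tau>(1) by blast
qed

text \<open>On an interval of radius \<open>e\<close> with \<open>L e \<le> 1/2\<close> the difference of two solutions is bounded by half of
its own maximum.\<close>

lemma ode_local_uniqueness_lipschitz:
  fixes z1 z2 :: "real \<Rightarrow> 'z::real_normed_vector"
  assumes L: "L > 0" "\<And>x y. norm (G x - G y) \<le> L * norm (x - y)"
    and "\<delta> > 0" "\<And>t. \<bar>t - t0\<bar> < \<delta> \<Longrightarrow> (z1 has_vector_derivative G (z1 t)) (at t)"
    "\<And>t. \<bar>t - t0\<bar> < \<delta> \<Longrightarrow> (z2 has_vector_derivative G (z2 t)) (at t)"
    and "z1 t0 = z2 t0"
  shows "\<exists>\<epsilon>>0. \<forall>t. \<bar>t - t0\<bar> < \<epsilon> \<longrightarrow> z1 t = z2 t"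
proof -
  define e where "e = min (\<delta> / 2) (1 / (2 * L))"
  have e: "e > 0" "e < \<delta>" "L * e \<le> 1/2"
    using L(1) \<open>\<delta> > 0\<close> by (auto simp: e_def min_def field_simps)
  define w where "w t = z1 t - z2 t" for t
  let ?I = "{t0 - e..t0 + e}"
  have dw: "(w has_derivative (\<lambda>h. h *\<^sub>R (G (z1 t) - G (z2 t)))) (at t)" if "t \<in> ?I" for t
    using has_vector_derivative_diff[OF assms(4,5), of t] that e
    unfolding w_def has_vector_derivative_def by (auto simp: abs_less_iff)
  have "continuous_on ?I w"
    using dw has_derivative_continuous by (blast intro: continuous_at_imp_continuous_on)
  then have "continuous_on ?I (\<lambda>t. norm (w t))" by (intro continuous_intros)
  then obtain s where s: "s \<in> ?I" "\<And>t. t \<in> ?I \<Longrightarrow> norm (w t) \<le> norm (w s)"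
    using continuous_attains_sup[of ?I "\<lambda>t. norm (w t)"] e by auto
  have "norm (w s - w t0) \<le> (L * norm (w s)) * norm (s - t0)"
  proof (rule differentiable_bound[of ?I w "\<lambda>t h. h *\<^sub>R (G (z1 t) - G (z2 t))"])
    fix t assume t: "t \<in> ?I"
    show "(w has_derivative (\<lambda>h. h *\<^sub>R (G (z1 t) - G (z2 t)))) (at t within ?I)"
      using dw[OF t] by (rule has_derivative_at_withinI)
    have "norm (G (z1 t) - G (z2 t)) \<le> L * norm (w s)"
      using order_trans[OF L(2)[of "z1 t" "z2 t"] mult_left_mono[OF s(2)[OF t, unfolded w_def], of L]] L(1)
      by (simp add: w_def)
    then show "onorm (\<lambda>h. h *\<^sub>R (G (z1 t) - G (z2 t))) \<le> L * norm (w s)"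
      using L(1) by (intro onorm_bound) (auto simp: mult.commute[of _ "\<bar>_\<bar>"] intro!: mult_left_mono)
  qed (use s e in auto)
  also have "\<dots> \<le> (L * norm (w s)) * e" using s(1) L(1) by (intro mult_left_mono) auto
  also have "\<dots> = (L * e) * norm (w s)" by simp
  also have "\<dots> \<le> 1/2 * norm (w s)" using e(3) by (intro mult_right_mono) auto
  finally have "norm (w s) \<le> 0" using assms(6) by (simp add: w_def)
  then have "w t = 0" if "t \<in> ?I" for t using s(2)[OF that] by simp
  then show ?thesis using e(1) by (intro exI[of _ e]) (auto simp: w_def abs_less_iff)
qed

lemma ode_local_uniqueness:
  fixes F :: "'z::euclidean_space \<Rightarrow> 'z"
  assumes "open U" "smooth_on U F"
    and "\<delta> > 0" "\<And>t. \<bar>t - t0\<bar> < \<delta> \<Longrightarrow> (z1 has_vector_derivative F (z1 t)) (at t)"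
    "\<And>t. \<bar>t - t0\<bar> < \<delta> \<Longrightarrow> (z2 has_vector_derivative F (z2 t)) (at t)"
    and "z1 t0 = z2 t0" "z1 t0 \<in> U"
  shows "\<exists>\<epsilon>>0. \<forall>t. \<bar>t - t0\<bar> < \<epsilon> \<longrightarrow> z1 t = z2 t"
proof -
  obtain r G R where G: "r > 0" "ball (z1 t0) r \<subseteq> U" "smooth_on UNIV G"
    "\<And>z. z \<in> ball (z1 t0) r \<Longrightarrow> G z = F z" "\<And>z. z \<notin> cball (z1 t0) R \<Longrightarrow> G z = 0"
    using smooth_cutoff[OF assms(1,7,2)] by metis
  have "cs_smooth G" using G by (auto simp: cs_smooth_def)
  then obtain L where L: "L > 0" "\<And>x y. norm (G x - G y) \<le> L * norm (x - y)"
    using cs_smooth_derivative_bound by metis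
  have "\<exists>d>0. \<forall>t. \<bar>t - t0\<bar> < d \<longrightarrow> z t \<in> ball (z1 t0) r"
    if "\<And>t. \<bar>t - t0\<bar> < \<delta> \<Longrightarrow> (z has_vector_derivative F (z t)) (at t)" "z t0 = z1 t0" for z
  proof -
    have "isCont z t0" using that(1)[of t0] \<open>\<delta> > 0\<close> has_vector_derivative_continuous by force
    then show ?thesis using G(1) unfolding continuous_at_eps_delta that(2)
      by (auto simp: dist_commute dist_real_def)
  qed
  from this[OF assms(4)] this[OF assms(5)] obtain d1 d2 where
    d: "d1 > 0" "\<And>t. \<bar>t - t0\<bar> < d1 \<Longrightarrow> z1 t \<in> ball (z1 t0) r"
       "d2 > 0" "\<And>t. \<bar>t - t0\<bar> < d2 \<Longrightarrow> z2 t \<in> ball (z1 t0) r"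
    using assms(6) by auto
  show ?thesis
    by (rule ode_local_uniqueness_lipschitz[OF L, of "min \<delta> (min d1 d2)"])
       (use assms(3-6) d G(4) in auto)
qed

text \<open>If a solution is \<open>C\<^sup>k\<close>, so is its derivative \<open>F \<circ> z\<close>.\<close>

lemma ode_solution_smooth:
  fixes F :: "'z::euclidean_space \<Rightarrow> 'z"
  assumes "open I" "open U" "smooth_on U F" "z ` I \<subseteq> U"
    "\<And>t. t \<in> I \<Longrightarrow> (z has_vector_derivative F (z t)) (at t)"
  shows "smooth_on I z"
  unfolding smooth_on_def
proof
  fix k show "Ck_on k I z"
  proof (induction k)
    case 0
    show ?case
      unfolding Ck_on.simps
      by (intro continuous_at_imp_continuous_on ballI has_vector_derivative_continuous[OF assms(5)])
  next
    case (Suc k)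
    show ?case
    proof (rule Ck_on_SucI[OF assms(1)])
      show "(z has_derivative (\<lambda>h. h *\<^sub>R F (z t))) (at t)" if "t \<in> I" for t
        using assms(5)[OF that] by (simp add: has_vector_derivative_def)
      show "Ck_on k I (\<lambda>t. v *\<^sub>R F (z t))" for v
        using assms by (intro Ck_on_scaleR Ck_on_const Ck_on_compose[OF _ assms(2) _ Suc] smooth_onD)
    qed
  qed
qed

section \<open>Coordinates and vector fields on a manifold\<close>

locale smooth_mfd =
  fixes A :: "('m::{t2_space,second_countable_topology}, 'e::euclidean_space) chart set"
  assumes smooth_manifold: "smooth_manifold A"
begin

lemma chart_homeomorphism:
  assumes "c \<in> A"
  shows "open (fst c)" "homeomorphism (fst c) (snd c ` fst c) (snd c) (chart_inv c)" "open (snd c ` fst c)"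
  using smooth_manifold assms by (auto simp: smooth_manifold_def is_chart_def)

lemma chart_inv_apply: "c \<in> A \<Longrightarrow> p \<in> fst c \<Longrightarrow> chart_inv c (snd c p) = p"
  using chart_homeomorphism(2) homeomorphism_apply1 by blast

lemma apply_chart_inv: "c \<in> A \<Longrightarrow> x \<in> snd c ` fst c \<Longrightarrow> snd c (chart_inv c x) = x"
  using chart_homeomorphism(2) homeomorphism_apply2 by blast

lemma chart_inv_mem: "c \<in> A \<Longrightarrow> x \<in> snd c ` fst c \<Longrightarrow> chart_inv c x \<in> fst c"
  by (metis chart_inv_apply imageE)

lemma open_chart_image:
  assumes "c \<in> A" "open W" "W \<subseteq> fst c"
  shows "open (snd c ` W)"
proof -
  have "openin (top_of_set (snd c ` fst c)) (snd c ` W)"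
    using homeomorphism_imp_open_map[OF chart_homeomorphism(2)[OF assms(1)]] assms
    by (simp add: openin_open_eq chart_homeomorphism)
  then show ?thesis using chart_homeomorphism(3)[OF assms(1)] openin_open_eq by blast
qed

lemma continuous_chart: "c \<in> A \<Longrightarrow> continuous_on (fst c) (snd c)"
  using chart_homeomorphism(2) homeomorphism_cont1 by blast

lemma continuous_chart_inv: "c \<in> A \<Longrightarrow> continuous_on (snd c ` fst c) (chart_inv c)"
  using chart_homeomorphism(2) homeomorphism_cont2 by blast

lemma chart_at: "chart_at A p \<in> A" "p \<in> fst (chart_at A p)"
proof -
  have "\<exists>c. c \<in> A \<and> p \<in> fst c"
    using smooth_manifold unfolding smooth_manifold_def by blast
  then have "chart_at A p \<in> A \<and> p \<in> fst (chart_at A p)"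
    unfolding chart_at_def by (rule someI_ex)
  then show "chart_at A p \<in> A" "p \<in> fst (chart_at A p)" by auto
qed

abbreviation transition :: "('m, 'e) chart \<Rightarrow> ('m, 'e) chart \<Rightarrow> 'e \<Rightarrow> 'e" where
  "transition c d \<equiv> snd d \<circ> chart_inv c"

lemma smooth_transition:
  assumes "c \<in> A" "d \<in> A"
  shows "smooth_on (snd c ` (fst c \<inter> fst d)) (transition c d)"
  using smooth_manifold assms by (auto simp: smooth_manifold_def)

lemma open_overlap: "c \<in> A \<Longrightarrow> open W \<Longrightarrow> open (snd c ` (fst c \<inter> W))"
  by (intro open_chart_image) (auto simp: chart_homeomorphism)

lemma transition_has_derivative:
  assumes "c \<in> A" "d \<in> A" "p \<in> fst c" "p \<in> fst d"
  shows "(transition c d has_derivative frechet_derivative (transition c d) (at (snd c p))) (at (snd c p))"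
  using assms by (intro smooth_on_has_derivative[OF smooth_transition open_overlap]) (auto simp: chart_homeomorphism)

text \<open>All coordinate computations reduce to this chain rule for \<open>f \<circ> c\<^sup>-\<^sup>1 = (f \<circ> d\<^sup>-\<^sup>1) \<circ> (d \<circ> c\<^sup>-\<^sup>1)\<close>.\<close>

lemma has_derivative_chart_change:
  assumes "c \<in> A" "d \<in> A" "p \<in> fst c" "p \<in> fst d"
    and "(f \<circ> chart_inv d has_derivative f') (at (snd d p))"
  shows "(f \<circ> chart_inv c has_derivative (\<lambda>v. f' (frechet_derivative (transition c d) (at (snd c p)) v))) (at (snd c p))"
proof -
  have f: "(f \<circ> chart_inv d has_derivative f') (at (transition c d (snd c p)))"
    using assms by (simp add: chart_inv_apply)
  have "((\<lambda>x. (f \<circ> chart_inv d) (transition c d x)) has_derivative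
      (\<lambda>v. f' (frechet_derivative (transition c d) (at (snd c p)) v))) (at (snd c p))"
    by (rule has_derivative_compose[OF transition_has_derivative[OF assms(1-4)] f])
  then show ?thesis
    by (rule has_derivative_transform_within_open[OF _ open_overlap[OF assms(1) chart_homeomorphism(1)[OF assms(2)]]])
       (use assms in \<open>auto simp: chart_inv_apply\<close>)
qed

text \<open>The coordinates in the chart \<open>c\<close> of a tangent vector \<open>v\<close> at \<open>p\<close>, where \<open>v\<close> itself is given with
respect to the chart selected at \<open>p\<close>.  The map \<open>tvec c p\<close> defined below is the inverse.\<close>

definition coord :: "('m, 'e) chart \<Rightarrow> 'm \<Rightarrow> 'e \<Rightarrow> 'e" where
  "coord c p v = tangent_deriv A (snd c) p v"

definition tvec :: "('m, 'e) chart \<Rightarrow> 'm \<Rightarrow> 'e \<Rightarrow> 'e" where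
  "tvec c p w = frechet_derivative (transition c (chart_at A p)) (at (snd c p)) w"

lemma coord_eq: "coord c p = frechet_derivative (transition (chart_at A p) c) (at (snd (chart_at A p) p))"
  by (rule ext) (simp add: coord_def tangent_deriv_def)

lemma bounded_linear_coord:
  assumes "c \<in> A" "p \<in> fst c" shows "bounded_linear (coord c p)"
  unfolding coord_eq
  by (rule has_derivative_bounded_linear[OF transition_has_derivative]) (use assms chart_at in auto)

lemma transition_self_derivative:
  assumes "c \<in> A" "p \<in> fst c"
  shows "frechet_derivative (transition c c) (at (snd c p)) = (\<lambda>v. v)"
proof -
  have "(transition c c has_derivative (\<lambda>v. v)) (at (snd c p))"
    by (rule has_derivative_transform_within_open[OF has_derivative_ident chart_homeomorphism(3)[OF assms(1)]])
       (use assms in \<open>auto simp: apply_chart_inv chart_inv_apply\<close>)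
  then show ?thesis using frechet_derivative_at by metis
qed

lemma transition_derivative_inverse:
  assumes "c \<in> A" "d \<in> A" "p \<in> fst c" "p \<in> fst d"
  shows "frechet_derivative (transition d c) (at (snd d p)) (frechet_derivative (transition c d) (at (snd c p)) v) = v"
proof -
  have "(transition c c has_derivative (\<lambda>v. frechet_derivative (transition d c) (at (snd d p))
     (frechet_derivative (transition c d) (at (snd c p)) v))) (at (snd c p))"
    by (rule has_derivative_chart_change[OF assms transition_has_derivative]) (use assms in auto)
  then have "frechet_derivative (transition c c) (at (snd c p)) = (\<lambda>v. frechet_derivative (transition d c) (at (snd d p))
     (frechet_derivative (transition c d) (at (snd c p)) v))"
    by (rule frechet_derivative_at[symmetric])
  then show ?thesis using transition_self_derivative[OF assms(1,3)] by metis
qed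

lemma coord_tvec: "c \<in> A \<Longrightarrow> p \<in> fst c \<Longrightarrow> coord c p (tvec c p w) = w"
  unfolding coord_eq tvec_def by (rule transition_derivative_inverse) (auto simp: chart_at)

lemma tvec_coord: "c \<in> A \<Longrightarrow> p \<in> fst c \<Longrightarrow> tvec c p (coord c p v) = v"
  unfolding coord_eq tvec_def by (rule transition_derivative_inverse) (auto simp: chart_at)

lemma coord_inject: "c \<in> A \<Longrightarrow> p \<in> fst c \<Longrightarrow> coord c p v = coord c p w \<longleftrightarrow> v = w"
  by (metis tvec_coord)

lemma coord_chart_at: "coord (chart_at A p) p v = v"
  unfolding coord_eq by (simp add: transition_self_derivative chart_at)

lemma tangent_deriv_chart:
  assumes "c \<in> A" "p \<in> fst c" "(f \<circ> chart_inv c has_derivative f') (at (snd c p))"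
  shows "tangent_deriv A f p v = f' (coord c p v)"
proof -
  have "(f \<circ> chart_inv (chart_at A p) has_derivative (\<lambda>v. f' (coord c p v))) (at (snd (chart_at A p) p))"
    unfolding coord_eq by (rule has_derivative_chart_change[OF _ assms(1) _ assms(2,3)]) (auto simp: chart_at)
  then show ?thesis unfolding tangent_deriv_def using frechet_derivative_at by metis
qed

lemma coord_change:
  assumes "c \<in> A" "d \<in> A" "p \<in> fst c" "p \<in> fst d"
  shows "coord d p v = frechet_derivative (transition c d) (at (snd c p)) (coord c p v)"
  unfolding coord_def[of d]
  by (rule tangent_deriv_chart[OF assms(1,3) transition_has_derivative[OF assms]])

text \<open>It suffices to test smoothness near each point in one chart of the atlas, since the transition maps
are smooth.\<close>

lemma smooth_from_localI:
  assumes "open W"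
    and loc: "\<And>p. p \<in> W \<Longrightarrow> \<exists>c\<in>A. \<exists>N. open N \<and> p \<in> N \<and> N \<subseteq> fst c \<and> smooth_on (snd c ` N) (f \<circ> chart_inv c)"
  shows "smooth_from A W f"
  unfolding smooth_from_def
proof
  fix d assume d: "d \<in> A"
  show "smooth_on (snd d ` (fst d \<inter> W)) (f \<circ> chart_inv d)"
  proof (rule smooth_on_local[OF open_overlap[OF d assms(1)]])
    fix x assume "x \<in> snd d ` (fst d \<inter> W)"
    then obtain p where p: "p \<in> fst d" "p \<in> W" "x = snd d p" by auto
    from loc[OF p(2)] obtain c N where c: "c \<in> A" "open N" "p \<in> N" "N \<subseteq> fst c"
      "smooth_on (snd c ` N) (f \<circ> chart_inv c)" by blast
    let ?T = "snd d ` (fst d \<inter> N)"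
    have T: "open ?T" by (rule open_overlap[OF d c(2)])
    have "smooth_on ?T (transition d c)"
      by (rule smooth_on_subset[OF smooth_transition[OF d c(1)] _ T])
         (use c in \<open>auto intro: open_overlap d chart_homeomorphism\<close>)
    moreover have "transition d c ` ?T \<subseteq> snd c ` N" using d by (auto simp: chart_inv_apply)
    ultimately have "smooth_on ?T (\<lambda>x. (f \<circ> chart_inv c) (transition d c x))"
      using smooth_on_compose[OF T open_chart_image[OF c(1,2,4)] c(5)] by blast
    then have "smooth_on ?T (f \<circ> chart_inv d)"
      by (rule smooth_on_cong[OF T]) (use c d in \<open>auto simp: chart_inv_apply subset_iff\<close>)
    then show "\<exists>T. open T \<and> x \<in> T \<and> smooth_on T (f \<circ> chart_inv d)"
      using T p c(3) by blast
  qed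
qed

lemma smooth_fromD:
  assumes "smooth_from A W f" "open W" "c \<in> A" "open N" "N \<subseteq> fst c \<inter> W"
  shows "smooth_on (snd c ` N) (f \<circ> chart_inv c)"
  by (rule smooth_on_subset[of "snd c ` (fst c \<inter> W)"])
     (use assms in \<open>auto simp: smooth_from_def intro: open_overlap open_chart_image\<close>)

text \<open>The coordinate representation of a vector field in a chart, as a map between vector spaces.\<close>

definition crep :: "('m, 'e) chart \<Rightarrow> ('m \<Rightarrow> 'e) \<Rightarrow> 'e \<Rightarrow> 'e" where
  "crep c X x = coord c (chart_inv c x) (X (chart_inv c x))"

abbreviation svf :: "('m \<Rightarrow> 'e) \<Rightarrow> bool" where
  "svf \<equiv> smooth_vector_field A UNIV"

lemma svf_localI:
  assumes "\<And>p. \<exists>c\<in>A. \<exists>N. open N \<and> p \<in> N \<and> N \<subseteq> fst c \<and> smooth_on (snd c ` N) (crep c X)"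
  shows "svf X"
  unfolding smooth_vector_field_def
proof
  fix d assume d: "d \<in> A"
  show "smooth_from A (fst d \<inter> UNIV) (\<lambda>p. tangent_deriv A (snd d) p (X p))"
  proof (rule smooth_from_localI)
    fix p assume p: "p \<in> fst d \<inter> UNIV"
    obtain c N where c: "c \<in> A" "open N" "p \<in> N" "N \<subseteq> fst c" "smooth_on (snd c ` N) (crep c X)"
      using assms by blast
    let ?N = "N \<inter> fst d"
    have N: "open ?N" using c(2) chart_homeomorphism(1)[OF d] by auto
    then have T: "open (snd c ` ?N)" using c by (intro open_chart_image) auto
    have "smooth_on (snd c ` ?N) (\<lambda>x. frechet_derivative (transition c d) (at x) (crep c X x))"
    proof (rule smooth_on_frechet_apply[OF T])
      show "smooth_on (snd c ` ?N) (transition c d)"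
        by (rule smooth_on_subset[OF smooth_transition[OF c(1) d] open_overlap[OF c(1) chart_homeomorphism(1)[OF d]] T])
           (use c in auto)
      show "smooth_on (snd c ` ?N) (crep c X)"
        by (rule smooth_on_subset[OF c(5) open_chart_image[OF c(1,2,4)] T]) auto
    qed
    then have "smooth_on (snd c ` ?N) ((\<lambda>p. tangent_deriv A (snd d) p (X p)) \<circ> chart_inv c)"
    proof (rule smooth_on_cong[OF T])
      fix x assume "x \<in> snd c ` ?N"
      then obtain p where "p \<in> N" "p \<in> fst d" "x = snd c p" by auto
      then show "frechet_derivative (transition c d) (at x) (crep c X x) = ((\<lambda>p. tangent_deriv A (snd d) p (X p)) \<circ> chart_inv c) x"
        using coord_change[OF c(1) d, of p "X p"] c(1,4) by (auto simp: crep_def chart_inv_apply coord_def)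
    qed
    then show "\<exists>c\<in>A. \<exists>N. open N \<and> p \<in> N \<and> N \<subseteq> fst c \<and> smooth_on (snd c ` N) ((\<lambda>p. tangent_deriv A (snd d) p (X p)) \<circ> chart_inv c)"
      using c N p by blast
  qed (use d chart_homeomorphism in auto)
qed

lemma svfD:
  assumes "svf X" "c \<in> A"
  shows "smooth_on (snd c ` fst c) (crep c X)"
proof -
  have "smooth_on (snd c ` fst c) ((\<lambda>p. tangent_deriv A (snd c) p (X p)) \<circ> chart_inv c)"
    by (rule smooth_fromD[of "fst c"]) (use assms in \<open>auto simp: smooth_vector_field_def chart_homeomorphism\<close>)
  then show ?thesis by (simp add: crep_def[abs_def] coord_def comp_def)
qed

lemma svfI:
  assumes "\<And>c. c \<in> A \<Longrightarrow> smooth_on (snd c ` fst c) (crep c X)"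
  shows "svf X"
  by (rule svf_localI) (meson assms chart_at chart_homeomorphism(1) order_refl)

lemma svf_add: assumes "svf X" "svf Y" shows "svf (\<lambda>p. X p + Y p)"
proof (rule svfI)
  fix c assume c: "c \<in> A"
  show "smooth_on (snd c ` fst c) (crep c (\<lambda>p. X p + Y p))"
    by (rule smooth_on_cong[OF chart_homeomorphism(3)[OF c] smooth_on_add[OF _ svfD[OF assms(1) c] svfD[OF assms(2) c]]])
       (use c in \<open>auto simp: crep_def chart_inv_apply chart_homeomorphism linear_add[OF bounded_linear.linear[OF bounded_linear_coord]]\<close>)
qed

lemma svf_scale: assumes "smooth_from A UNIV f" "svf X" shows "svf (\<lambda>p. f p *\<^sub>R X p)"
proof (rule svfI)
  fix c assume c: "c \<in> A"
  have f: "smooth_on (snd c ` fst c) (f \<circ> chart_inv c)"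
    by (rule smooth_fromD[OF assms(1) _ c]) (auto simp: c chart_homeomorphism)
  show "smooth_on (snd c ` fst c) (crep c (\<lambda>p. f p *\<^sub>R X p))"
    by (rule smooth_on_cong[OF chart_homeomorphism(3)[OF c] smooth_on_scaleR[OF _ f svfD[OF assms(2) c]]])
       (use c in \<open>auto simp: crep_def chart_inv_apply chart_homeomorphism linear_scale[OF bounded_linear.linear[OF bounded_linear_coord]]\<close>)
qed

lemma smooth_from_const: "smooth_from A W (\<lambda>p. k)"
  by (simp add: smooth_from_def comp_def smooth_on_const)

lemma svf_zero: "svf (\<lambda>p. 0)"
proof (rule svfI)
  fix c assume c: "c \<in> A"
  show "smooth_on (snd c ` fst c) (crep c (\<lambda>p. 0))"
    by (rule smooth_on_cong[OF chart_homeomorphism(3)[OF c] smooth_on_const[of _ 0]])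
       (use c in \<open>auto simp: crep_def chart_inv_apply linear_0[OF bounded_linear.linear[OF bounded_linear_coord]]\<close>)
qed

lemma svf_scale_const: "svf X \<Longrightarrow> svf (\<lambda>p. k *\<^sub>R X p)"
  using svf_scale[OF smooth_from_const] .

lemma svf_sum: "(\<And>i. i \<in> I \<Longrightarrow> svf (X i)) \<Longrightarrow> svf (\<lambda>p. \<Sum>i\<in>I. X i p)"
  by (induction I rule: infinite_finite_induct) (auto intro: svf_zero svf_add)

text \<open>Functions given in a chart and supported in a closed subset of its domain extend by zero.  Fields
behave in the same way, and both facts together turn local data into arguments for \<open>nabla\<close>.\<close>

lemma smooth_from_extend_zero:
  assumes "c \<in> A" "open N" "N \<subseteq> fst c" "closed K" "K \<subseteq> N" "smooth_on (snd c ` N) (f \<circ> chart_inv c)"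
    "\<And>p. p \<notin> K \<Longrightarrow> f p = 0"
  shows "smooth_from A UNIV f"
proof (rule smooth_from_localI[OF open_UNIV])
  fix p
  show "\<exists>c\<in>A. \<exists>N. open N \<and> p \<in> N \<and> N \<subseteq> fst c \<and> smooth_on (snd c ` N) (f \<circ> chart_inv c)"
  proof (cases "p \<in> N")
    case False
    let ?d = "chart_at A p" and ?N = "fst (chart_at A p) - K"
    have N: "open ?N" "p \<in> ?N" using False assms(4,5) chart_at(2) chart_homeomorphism(1)[OF chart_at(1)] by auto
    have "smooth_on (snd ?d ` ?N) (f \<circ> chart_inv ?d)"
      by (rule smooth_on_cong[OF open_chart_image[OF chart_at(1) N(1)] smooth_on_const[of _ 0]])
         (auto simp: chart_inv_apply chart_at assms(7))
    then show ?thesis using N chart_at(1) by blast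
  qed (use assms in blast)
qed

lemma svf_extend_zero:
  assumes "c \<in> A" "open N" "N \<subseteq> fst c" "closed K" "K \<subseteq> N" "smooth_on (snd c ` N) (crep c X)"
    "\<And>p. p \<notin> K \<Longrightarrow> X p = 0"
  shows "svf X"
proof (rule svf_localI)
  fix p
  show "\<exists>c\<in>A. \<exists>N. open N \<and> p \<in> N \<and> N \<subseteq> fst c \<and> smooth_on (snd c ` N) (crep c X)"
  proof (cases "p \<in> N")
    case False
    let ?d = "chart_at A p" and ?N = "fst (chart_at A p) - K"
    have N: "open ?N" "p \<in> ?N" using False assms(4,5) chart_at(2) chart_homeomorphism(1)[OF chart_at(1)] by auto
    have "smooth_on (snd ?d ` ?N) (crep ?d X)"
      by (rule smooth_on_cong[OF open_chart_image[OF chart_at(1) N(1)] smooth_on_const[of _ 0]])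
         (auto simp: crep_def chart_inv_apply chart_at assms(7) linear_0[OF bounded_linear.linear[OF bounded_linear_coord]])
    then show ?thesis using N chart_at(1) by blast
  qed (use assms in blast)
qed

text \<open>A bump function in coordinates is transported to the manifold.  Its support \<open>K\<close> is the image of a
compact ball, hence closed because the manifold is Hausdorff.\<close>

lemma manifold_bump:
  assumes "c \<in> A" "open W" "p0 \<in> W" "W \<subseteq> fst c"
  obtains \<beta> :: "'m \<Rightarrow> real" and V K where "smooth_from A UNIV \<beta>" "open V" "p0 \<in> V" "V \<subseteq> W"
    "\<And>p. p \<in> V \<Longrightarrow> \<beta> p = 1" "closed K" "K \<subseteq> W" "\<And>p. p \<notin> K \<Longrightarrow> \<beta> p = 0"
proof -
  have oW: "open (snd c ` W)" using open_chart_image assms by blast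
  obtain R where R: "R > 0" "cball (snd c p0) R \<subseteq> snd c ` W"
    using oW assms(3) open_contains_cball by blast
  obtain h :: "'e \<Rightarrow> real" where h: "smooth_on UNIV h"
    "\<And>x. x \<in> ball (snd c p0) (R / 2) \<Longrightarrow> h x = 1" "\<And>x. x \<notin> ball (snd c p0) R \<Longrightarrow> h x = 0"
    using smooth_bump[OF R(1)] by blast
  define \<beta> where "\<beta> p = (if p \<in> fst c then h (snd c p) else 0)" for p
  define K where "K = chart_inv c ` cball (snd c p0) R"
  define V where "V = W \<inter> (snd c -` ball (snd c p0) (R / 2) \<inter> fst c)"
  have sub: "cball (snd c p0) R \<subseteq> snd c ` fst c" using R assms(4) by blast
  have "compact K"
    unfolding K_def
    by (rule compact_continuous_image[OF continuous_on_subset[OF continuous_chart_inv[OF assms(1)] sub] compact_cball])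
  then have "closed K" by (rule compact_imp_closed)
  moreover have KW: "K \<subseteq> W"
  proof
    fix p assume "p \<in> K"
    then obtain x where "x \<in> cball (snd c p0) R" "p = chart_inv c x" by (auto simp: K_def)
    then obtain p' where "p' \<in> W" "x = snd c p'" using R by blast
    then show "p \<in> W" using \<open>p = chart_inv c x\<close> assms(4) chart_inv_apply[OF assms(1), of p'] by auto
  qed
  moreover have zero: "\<beta> p = 0" if "p \<notin> K" for p
  proof (cases "p \<in> fst c")
    case True
    have "snd c p \<notin> cball (snd c p0) R"
    proof
      assume "snd c p \<in> cball (snd c p0) R"
      then have "chart_inv c (snd c p) \<in> K" unfolding K_def by blast
      with that show False using True assms(1) chart_inv_apply by simp
    qed
    then have "snd c p \<notin> ball (snd c p0) R" using ball_subset_cball by blast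
    then show ?thesis using h(3) True by (simp add: \<beta>_def)
  qed (simp add: \<beta>_def)
  moreover have "smooth_from A UNIV \<beta>"
  proof (rule smooth_from_extend_zero[OF assms(1) chart_homeomorphism(1)[OF assms(1)] order_refl \<open>closed K\<close> _ _ zero])
    show "K \<subseteq> fst c" using KW assms by blast
    show "smooth_on (snd c ` fst c) (\<beta> \<circ> chart_inv c)"
      by (rule smooth_on_cong[OF chart_homeomorphism(3)[OF assms(1)] smooth_on_subset[OF h(1)]])
         (use assms(1) in \<open>auto simp: chart_homeomorphism \<beta>_def chart_inv_apply\<close>)
  qed
  moreover have "open V"
  proof -
    have "open (snd c -` ball (snd c p0) (R / 2) \<inter> fst c)"
      using continuous_on_open_vimage[OF chart_homeomorphism(1)[OF assms(1)], of "snd c"]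
        continuous_chart[OF assms(1)] by blast
    then show ?thesis using assms(2) unfolding V_def by (rule open_Int[rotated])
  qed
  moreover have "p0 \<in> V" using assms R(1) by (auto simp: V_def)
  moreover have "V \<subseteq> W" by (auto simp: V_def)
  moreover have "\<beta> p = 1" if "p \<in> V" for p using that h(2) by (auto simp: V_def \<beta>_def)
  ultimately show thesis using that by blast
qed

end

section \<open>Christoffel symbols and covariant derivatives in a chart\<close>

locale connection_mfd = smooth_mfd A
  for A :: "('m::{t2_space,second_countable_topology}, 'e::euclidean_space) chart set" +
  fixes nabla :: "('m \<Rightarrow> 'e) \<Rightarrow> ('m \<Rightarrow> 'e) \<Rightarrow> 'm \<Rightarrow> 'e"
  assumes linear_connection: "linear_connection A nabla"
begin

abbreviation Dt :: "(real \<Rightarrow> 'm) \<Rightarrow> (real \<Rightarrow> 'e) \<Rightarrow> real \<Rightarrow> 'e" where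
  "Dt \<equiv> covariant_derivative A nabla"

abbreviation has_Dt :: "(real \<Rightarrow> 'm) \<Rightarrow> (real \<Rightarrow> 'e) \<Rightarrow> real \<Rightarrow> 'e \<Rightarrow> bool" where
  "has_Dt \<equiv> has_covariant_derivative A nabla"

abbreviation accel :: "(real \<Rightarrow> 'm) \<Rightarrow> real \<Rightarrow> 'e" where
  "accel \<gamma> \<equiv> Dt \<gamma> (velocity A \<gamma>)"

abbreviation jerk :: "(real \<Rightarrow> 'm) \<Rightarrow> real \<Rightarrow> 'e" where
  "jerk \<gamma> \<equiv> Dt \<gamma> (accel \<gamma>)"

lemma svf_nabla: "svf X \<Longrightarrow> svf Y \<Longrightarrow> svf (nabla X Y)"
  and nabla_add_left: "svf X \<Longrightarrow> svf X' \<Longrightarrow> svf Y \<Longrightarrow> nabla (\<lambda>p. X p + X' p) Y = (\<lambda>p. nabla X Y p + nabla X' Y p)"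
  and nabla_scale_left: "smooth_from A UNIV f \<Longrightarrow> svf X \<Longrightarrow> svf Y \<Longrightarrow> nabla (\<lambda>p. f p *\<^sub>R X p) Y = (\<lambda>p. f p *\<^sub>R nabla X Y p)"
  and nabla_add_right: "svf X \<Longrightarrow> svf Y \<Longrightarrow> svf Y' \<Longrightarrow> nabla X (\<lambda>p. Y p + Y' p) = (\<lambda>p. nabla X Y p + nabla X Y' p)"
  and nabla_scale_right: "svf X \<Longrightarrow> svf Y \<Longrightarrow> nabla X (\<lambda>p. a *\<^sub>R Y p) = (\<lambda>p. a *\<^sub>R nabla X Y p)"
  and nabla_product: "smooth_from A UNIV f \<Longrightarrow> svf X \<Longrightarrow> svf Y \<Longrightarrow>
        nabla X (\<lambda>p. f p *\<^sub>R Y p) = (\<lambda>p. f p *\<^sub>R nabla X Y p + tangent_deriv A f p (X p) *\<^sub>R Y p)"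
  using linear_connection unfolding linear_connection_def by blast+

lemma nabla_zero_left: assumes "svf Y" shows "nabla (\<lambda>p. 0) Y = (\<lambda>p. 0)"
  using nabla_scale_left[OF smooth_from_const[of _ 0] svf_zero assms] by simp

lemma nabla_zero_right: assumes "svf X" shows "nabla X (\<lambda>p. 0) = (\<lambda>p. 0)"
  using nabla_scale_right[OF assms svf_zero, of 0] by simp

lemma nabla_sum_left:
  assumes "\<And>i. i \<in> I \<Longrightarrow> svf (X i)" "svf Y"
  shows "nabla (\<lambda>p. \<Sum>i\<in>I. X i p) Y = (\<lambda>p. \<Sum>i\<in>I. nabla (X i) Y p)"
  using assms(1)
  by (induction I rule: infinite_finite_induct) (simp_all add: nabla_zero_left nabla_add_left svf_sum assms(2))

lemma nabla_sum_right:
  assumes "\<And>i. i \<in> I \<Longrightarrow> svf (Y i)" "svf X"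
  shows "nabla X (\<lambda>p. \<Sum>i\<in>I. Y i p) = (\<lambda>p. \<Sum>i\<in>I. nabla X (Y i) p)"
  using assms(1)
  by (induction I rule: infinite_finite_induct) (simp_all add: nabla_zero_right nabla_add_right svf_sum assms(2))

lemma bump_at:
  assumes "open W" "p \<in> W"
  obtains \<beta> :: "'m \<Rightarrow> real" where "smooth_from A UNIV \<beta>" "\<beta> p = 1" "\<And>p'. p' \<notin> W \<Longrightarrow> \<beta> p' = 0"
proof -
  have "open (W \<inter> fst (chart_at A p))"
    using assms(1) chart_homeomorphism(1)[OF chart_at(1)] by auto
  moreover have "p \<in> W \<inter> fst (chart_at A p)" using assms(2) chart_at(2) by simp
  ultimately obtain \<beta> :: "'m \<Rightarrow> real" and V K where b: "smooth_from A UNIV \<beta>" "open V" "p \<in> V"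
    "V \<subseteq> W \<inter> fst (chart_at A p)" "\<And>p. p \<in> V \<Longrightarrow> \<beta> p = 1" "closed K"
    "K \<subseteq> W \<inter> fst (chart_at A p)" "\<And>p. p \<notin> K \<Longrightarrow> \<beta> p = 0"
    by (rule manifold_bump[OF chart_at(1) _ _ Int_lower2]) (rule that)
  show thesis by (rule that[OF b(1) b(5)[OF b(3)]]) (use b(7,8) in blast)
qed

text \<open>Multiplying both fields by a function that is \<open>1\<close> at \<open>p\<close> and vanishes outside \<open>W\<close> makes them equal
everywhere, and \<open>nabla\<close> is linear over functions in its first argument.\<close>

lemma nabla_cong_left:
  assumes "open W" "p \<in> W" "svf X" "svf X'" "svf Y" "\<And>p. p \<in> W \<Longrightarrow> X p = X' p"
  shows "nabla X Y p = nabla X' Y p"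
proof -
  obtain \<beta> :: "'m \<Rightarrow> real" where b: "smooth_from A UNIV \<beta>" "\<beta> p = 1" "\<And>p'. p' \<notin> W \<Longrightarrow> \<beta> p' = 0"
    using bump_at[OF assms(1,2)] by blast
  have "(\<lambda>p. \<beta> p *\<^sub>R X p) = (\<lambda>p. \<beta> p *\<^sub>R X' p)"
    using b(3) assms(6) by (metis scaleR_zero_left)
  then have "\<beta> p *\<^sub>R nabla X Y p = \<beta> p *\<^sub>R nabla X' Y p"
    using nabla_scale_left[OF b(1) assms(3,5)] nabla_scale_left[OF b(1) assms(4,5)] by metis
  then show ?thesis by (simp add: b)
qed

text \<open>The same argument with the product rule.  The extra terms involve only the derivative of the bump
function and the common value of the two fields at \<open>p\<close>.\<close>

lemma nabla_cong_right:
  assumes "open W" "p \<in> W" "svf X" "svf Y" "svf Y'" "\<And>p. p \<in> W \<Longrightarrow> Y p = Y' p"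
  shows "nabla X Y p = nabla X Y' p"
proof -
  obtain \<beta> :: "'m \<Rightarrow> real" where b: "smooth_from A UNIV \<beta>" "\<beta> p = 1" "\<And>p'. p' \<notin> W \<Longrightarrow> \<beta> p' = 0"
    using bump_at[OF assms(1,2)] by blast
  have "(\<lambda>p. \<beta> p *\<^sub>R Y p) = (\<lambda>p. \<beta> p *\<^sub>R Y' p)"
    using b(3) assms(6) by (metis scaleR_zero_left)
  then have "\<beta> p *\<^sub>R nabla X Y p + tangent_deriv A \<beta> p (X p) *\<^sub>R Y p =
      \<beta> p *\<^sub>R nabla X Y' p + tangent_deriv A \<beta> p (X p) *\<^sub>R Y' p"
    using nabla_product[OF b(1) assms(3,4)] nabla_product[OF b(1) assms(3,5)] by metis
  then show ?thesis using assms(2,6) by (simp add: b)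
qed

text \<open>\<open>\<Gamma>\<close> are the Christoffel symbols over \<open>W\<close> in the chart \<open>c\<close>.  The last conjunct provides global
smooth fields which restrict to the coordinate frame on \<open>W\<close>; covariant derivatives along curves are
computed by expansion in this frame.\<close>

definition christoffel :: "('m, 'e) chart \<Rightarrow> 'm set \<Rightarrow> ('e \<Rightarrow> 'e \<Rightarrow> 'e \<Rightarrow> 'e) \<Rightarrow> bool" where
  "christoffel c W \<Gamma> \<longleftrightarrow> c \<in> A \<and> open W \<and> W \<subseteq> fst c \<and>
     (\<forall>v w. smooth_on (snd c ` W) (\<lambda>x. \<Gamma> x v w)) \<and>
     (\<forall>x w. linear (\<lambda>v. \<Gamma> x v w)) \<and> (\<forall>x v. linear (\<Gamma> x v)) \<and>
     (\<forall>X Y p. svf X \<longrightarrow> svf Y \<longrightarrow> p \<in> W \<longrightarrow>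
        coord c p (nabla X Y p) = frechet_derivative (crep c Y) (at (snd c p)) (coord c p (X p))
           + \<Gamma> (snd c p) (coord c p (X p)) (coord c p (Y p))) \<and>
     (\<exists>E. \<forall>b\<in>Basis. svf (E b) \<and> (\<forall>p\<in>W. coord c p (E b p) = b))"

lemma christoffelD:
  assumes "christoffel c W \<Gamma>"
  shows "c \<in> A" "open W" "W \<subseteq> fst c" "\<And>v w. smooth_on (snd c ` W) (\<lambda>x. \<Gamma> x v w)"
    "\<And>x w. linear (\<lambda>v. \<Gamma> x v w)" "\<And>x v. linear (\<Gamma> x v)"
    "\<And>X Y p. svf X \<Longrightarrow> svf Y \<Longrightarrow> p \<in> W \<Longrightarrow>
        coord c p (nabla X Y p) = frechet_derivative (crep c Y) (at (snd c p)) (coord c p (X p))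
           + \<Gamma> (snd c p) (coord c p (X p)) (coord c p (Y p))"
    "\<exists>E. \<forall>b\<in>Basis. svf (E b) \<and> (\<forall>p\<in>W. coord c p (E b p) = b)"
  using assms by (auto simp: christoffel_def)

lemma coord_sum:
  assumes "c \<in> A" "p \<in> fst c"
  shows "coord c p (\<Sum>i\<in>I. a i *\<^sub>R v i) = (\<Sum>i\<in>I. a i *\<^sub>R coord c p (v i))"
proof -
  interpret bounded_linear "coord c p" by (rule bounded_linear_coord[OF assms])
  show ?thesis by (simp add: sum scaleR)
qed

text \<open>Let \<open>\<beta>\<close> be a bump function that is \<open>1\<close> on \<open>W\<close> and supported in the chart.  The fields \<open>E j\<close> are the
coordinate fields times \<open>\<beta>\<close>, and every field \<open>Y\<close> agrees on \<open>W\<close> with \<open>\<Sum>j. (\<beta> Y\<^sub>j) E j\<close>.  By locality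
\<open>nabla X Y\<close> can be computed on \<open>W\<close> from these expansions of \<open>X\<close> and \<open>Y\<close>, which gives the classical
formula with \<open>\<Gamma>\<close> the coordinates of \<open>nabla (E i) (E j)\<close>.\<close>

lemma christoffel_exists:
  assumes c: "c \<in> A" and p0: "p0 \<in> fst c"
  obtains W \<Gamma> where "p0 \<in> W" "christoffel c W \<Gamma>"
proof -
  note oc = chart_homeomorphism(1)[OF c]
  obtain \<beta> :: "'m \<Rightarrow> real" and W K where b: "smooth_from A UNIV \<beta>" "open W" "p0 \<in> W" "W \<subseteq> fst c"
    "\<And>p. p \<in> W \<Longrightarrow> \<beta> p = 1" "closed K" "K \<subseteq> fst c" "\<And>p. p \<notin> K \<Longrightarrow> \<beta> p = 0"
    using manifold_bump[OF c oc p0] by blast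
  have \<beta>c: "smooth_on (snd c ` fst c) (\<lambda>x. \<beta> (chart_inv c x))"
    using smooth_fromD[OF b(1) open_UNIV c oc] by (simp add: comp_def)
  define E where "E v p = (if p \<in> fst c then \<beta> p *\<^sub>R tvec c p v else 0)" for v p
  have E: "svf (E v)" for v
  proof (rule svf_extend_zero[OF c oc order_refl b(6,7)])
    show "smooth_on (snd c ` fst c) (crep c (E v))"
      by (rule smooth_on_cong[OF chart_homeomorphism(3)[OF c] smooth_on_scaleR[OF _ \<beta>c smooth_on_const[of _ v]]])
         (use c in \<open>auto simp: chart_homeomorphism crep_def E_def chart_inv_apply coord_tvec
            linear_scale[OF bounded_linear.linear[OF bounded_linear_coord]]\<close>)
  qed (auto simp: E_def b)
  have coordE: "coord c p (E v p) = v" if "p \<in> W" for v p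
    using that b(4,5) c by (auto simp: E_def coord_tvec)
  define comp where "comp Y j p = (if p \<in> fst c then \<beta> p *\<^sub>R (coord c p (Y p) \<bullet> j) else 0)" for Y j p
  have comp: "smooth_from A UNIV (comp Y j)" if "svf Y" for Y j
  proof (rule smooth_from_extend_zero[OF c oc order_refl b(6,7)])
    show "smooth_on (snd c ` fst c) (comp Y j \<circ> chart_inv c)"
      by (rule smooth_on_cong[OF chart_homeomorphism(3)[OF c]
            smooth_on_scaleR[OF _ \<beta>c smooth_on_inner[OF _ svfD[OF that c] smooth_on_const[of _ j]]]])
         (use c in \<open>auto simp: chart_homeomorphism crep_def comp_def chart_inv_apply\<close>)
  qed (auto simp: comp_def b)
  have compW: "comp Y j p = coord c p (Y p) \<bullet> j" if "p \<in> W" for Y j p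
    using that b(4,5) by (auto simp: comp_def)
  define expand where "expand Y p = (\<Sum>j\<in>Basis. comp Y j p *\<^sub>R E j p)" for Y p
  have expand: "svf (expand Y)" if "svf Y" for Y
    unfolding expand_def by (intro svf_sum svf_scale comp that E)
  have expand_eq: "Y p = expand Y p" if "p \<in> W" for Y p
  proof -
    have "p \<in> fst c" using that b(4) by auto
    moreover have "coord c p (expand Y p) = coord c p (Y p)"
      unfolding expand_def by (simp add: coord_sum[OF c \<open>p \<in> fst c\<close>] coordE compW that euclidean_representation)
    ultimately show ?thesis using coord_inject[OF c] by metis
  qed
  have left: "nabla X Y p = (\<Sum>i\<in>Basis. (coord c p (X p) \<bullet> i) *\<^sub>R nabla (E i) Y p)"
    if "svf X" "svf Y" "p \<in> W" for X Y p
  proof -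
    have "nabla X Y p = nabla (expand X) Y p"
      by (rule nabla_cong_left[OF b(2) that(3,1) expand[OF that(1)] that(2) expand_eq])
    also have "\<dots> = (\<Sum>i\<in>Basis. comp X i p *\<^sub>R nabla (E i) Y p)"
      unfolding expand_def
      by (subst nabla_sum_left) (auto intro!: svf_scale comp that E simp: nabla_scale_left comp that E)
    finally show ?thesis by (simp add: compW that)
  qed
  have right: "nabla X Y p = (\<Sum>j\<in>Basis. (coord c p (Y p) \<bullet> j) *\<^sub>R nabla X (E j) p
      + tangent_deriv A (comp Y j) p (X p) *\<^sub>R E j p)"
    if "svf X" "svf Y" "p \<in> W" for X Y p
  proof -
    have "nabla X Y p = nabla X (expand Y) p"
      by (rule nabla_cong_right[OF b(2) that(3,1,2) expand[OF that(2)] expand_eq])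
    also have "\<dots> = (\<Sum>j\<in>Basis. comp Y j p *\<^sub>R nabla X (E j) p + tangent_deriv A (comp Y j) p (X p) *\<^sub>R E j p)"
      unfolding expand_def
      by (subst nabla_sum_right) (auto intro!: svf_scale comp that E simp: nabla_product comp that E)
    finally show ?thesis by (simp add: compW that)
  qed
  have td: "tangent_deriv A (comp Y j) p v = frechet_derivative (crep c Y) (at (snd c p)) (coord c p v) \<bullet> j"
    if "svf Y" "p \<in> W" for Y j p v
  proof (rule tangent_deriv_chart[OF c])
    show "p \<in> fst c" using that b by auto
    then have "(crep c Y has_derivative frechet_derivative (crep c Y) (at (snd c p))) (at (snd c p))"
      by (intro smooth_on_has_derivative[OF svfD[OF that(1) c] chart_homeomorphism(3)[OF c]]) auto
    then have "((\<lambda>x. crep c Y x \<bullet> j) has_derivative (\<lambda>v. frechet_derivative (crep c Y) (at (snd c p)) v \<bullet> j)) (at (snd c p))"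
      by (rule has_derivative_inner_left)
    then show "(comp Y j \<circ> chart_inv c has_derivative (\<lambda>v. frechet_derivative (crep c Y) (at (snd c p)) v \<bullet> j)) (at (snd c p))"
    proof (rule has_derivative_transform_within_open[OF _ open_chart_image[OF c b(2,4)]])
      show "snd c p \<in> snd c ` W" using that by blast
      fix x assume "x \<in> snd c ` W"
      then obtain p' where "p' \<in> W" "x = snd c p'" by blast
      then show "crep c Y x \<bullet> j = (comp Y j \<circ> chart_inv c) x"
        using chart_inv_apply[OF c, of p'] b(4) by (auto simp: crep_def compW)
    qed
  qed
  define \<Gamma> where "\<Gamma> x v w = (\<Sum>j\<in>Basis. (w \<bullet> j) *\<^sub>R (\<Sum>i\<in>Basis. (v \<bullet> i) *\<^sub>R crep c (nabla (E i) (E j)) x))" for x v w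
  have "christoffel c W \<Gamma>"
    unfolding christoffel_def
  proof (intro conjI allI impI)
    show "smooth_on (snd c ` W) (\<lambda>x. \<Gamma> x v w)" for v w
      unfolding \<Gamma>_def
      by (intro smooth_on_sum smooth_on_scaleR smooth_on_const open_chart_image[OF c b(2,4)]
        smooth_on_subset[OF svfD[OF svf_nabla[OF E E] c]] chart_homeomorphism(3)[OF c] image_mono b(4))
    show "linear (\<lambda>v. \<Gamma> x v w)" for x w
      by (rule linearI) (simp_all add: \<Gamma>_def algebra_simps sum.distrib scaleR_sum_right)
    show "linear (\<Gamma> x v)" for x v
      by (rule linearI) (simp_all add: \<Gamma>_def algebra_simps sum.distrib scaleR_sum_right)
    show "\<exists>E. \<forall>b\<in>Basis. svf (E b) \<and> (\<forall>p\<in>W. coord c p (E b p) = b)"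
      by (rule exI[of _ E]) (auto simp: E coordE)
    fix X Y p assume X: "svf X" and Y: "svf Y" and p: "p \<in> W"
    have pc: "p \<in> fst c" using p b by auto
    interpret bounded_linear "coord c p" by (rule bounded_linear_coord[OF c pc])
    have "coord c p (nabla X Y p) = (\<Sum>j\<in>Basis. (coord c p (Y p) \<bullet> j) *\<^sub>R coord c p (nabla X (E j) p))
        + (\<Sum>j\<in>Basis. (frechet_derivative (crep c Y) (at (snd c p)) (coord c p (X p)) \<bullet> j) *\<^sub>R j)"
      by (subst right[OF X Y p]) (simp add: sum add scaleR sum.distrib coordE[OF p] td[OF Y p])
    also have "(\<Sum>j\<in>Basis. (coord c p (Y p) \<bullet> j) *\<^sub>R coord c p (nabla X (E j) p)) =
        \<Gamma> (snd c p) (coord c p (X p)) (coord c p (Y p))"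
      unfolding \<Gamma>_def
      by (rule sum.cong[OF refl], subst left[OF X E p]) (simp add: sum scaleR crep_def chart_inv_apply c pc)
    finally show "coord c p (nabla X Y p) = frechet_derivative (crep c Y) (at (snd c p)) (coord c p (X p))
           + \<Gamma> (snd c p) (coord c p (X p)) (coord c p (Y p))"
      by (simp add: euclidean_representation add.commute)
  qed (use c b in auto)
  then show thesis using that b(3) by blast
qed

lemma eventually_isCont_open:
  "isCont \<gamma> t \<Longrightarrow> open W \<Longrightarrow> \<gamma> t \<in> W \<Longrightarrow> \<forall>\<^sub>F s in nhds t. \<gamma> s \<in> W"
  unfolding continuous_at_open eventually_nhds by blast

lemma has_vector_derivative_eventually_eq:
  assumes "(f has_vector_derivative f') (at t)" "\<forall>\<^sub>F s in nhds t. f s = g s"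
  shows "(g has_vector_derivative f') (at t)"
proof -
  obtain S where "open S" "t \<in> S" "\<And>s. s \<in> S \<Longrightarrow> f s = g s"
    using assms(2) unfolding eventually_nhds by blast
  then show ?thesis using has_vector_derivative_transform_within_open[OF assms(1)] by blast
qed

lemma has_vector_derivative_compose_at:
  assumes "(f has_vector_derivative f') (at t)" "(g has_derivative g') (at (f t))"
  shows "((\<lambda>s. g (f s)) has_vector_derivative g' f') (at t)"
  using vector_derivative_diff_chain_within[OF assms(1) has_derivative_at_withinI[OF assms(2)]]
  by (simp add: comp_def)

lemma velocity_coord:
  assumes "c \<in> A" "\<gamma> t \<in> fst c" "isCont \<gamma> t" "(snd c \<circ> \<gamma> has_vector_derivative x') (at t)"
  shows "coord c (\<gamma> t) (velocity A \<gamma> t) = x'"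
proof -
  let ?d = "chart_at A (\<gamma> t)"
  let ?T = "transition c ?d"
  have "(?T has_derivative frechet_derivative ?T (at (snd c (\<gamma> t)))) (at (snd c (\<gamma> t)))"
    by (rule transition_has_derivative[OF assms(1) chart_at(1) assms(2) chart_at(2)])
  then have "(?T has_derivative frechet_derivative ?T (at (snd c (\<gamma> t)))) (at ((snd c \<circ> \<gamma>) t))"
    by (simp only: comp_apply)
  note has_vector_derivative_compose_at[OF assms(4) this]
  moreover have "\<forall>\<^sub>F s in nhds t. ?T ((snd c \<circ> \<gamma>) s) = (snd ?d \<circ> \<gamma>) s"
  proof -
    have "\<forall>\<^sub>F s in nhds t. \<gamma> s \<in> fst c"
      by (rule eventually_isCont_open[OF assms(3) chart_homeomorphism(1)[OF assms(1)] assms(2)])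
    then show ?thesis by eventually_elim (simp add: chart_inv_apply assms(1))
  qed
  ultimately have "(snd ?d \<circ> \<gamma> has_vector_derivative frechet_derivative ?T (at (snd c (\<gamma> t))) x') (at t)"
    by (rule has_vector_derivative_eventually_eq)
  then have "velocity A \<gamma> t = tvec c (\<gamma> t) x'"
    unfolding velocity_def tvec_def by (rule vector_derivative_at)
  then show ?thesis by (simp add: coord_tvec assms)
qed

lemma has_covariant_derivativeE:
  assumes "has_Dt \<gamma> Z t w"
  obtains X and n :: nat and E and z :: "nat \<Rightarrow> real \<Rightarrow> real" where "svf X" "X (\<gamma> t) = velocity A \<gamma> t"
    "\<And>i. i < n \<Longrightarrow> svf (E i)" "\<And>i. i < n \<Longrightarrow> z i differentiable (at t)"
    "\<forall>\<^sub>F s in nhds t. Z s = (\<Sum>i<n. z i s *\<^sub>R E i (\<gamma> s))"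
    "w = (\<Sum>i<n. deriv (z i) t *\<^sub>R E i (\<gamma> t) + z i t *\<^sub>R nabla X (E i) (\<gamma> t))"
  using assms unfolding has_covariant_derivative_def by (elim exE conjE) (rule that, auto)

text \<open>In coordinates a covariant derivative of \<open>Z\<close> is \<open>Z' + \<Gamma>(x)(x', Z)\<close>, whatever representation of \<open>Z\<close>
by restricted fields is used.  This proves that the covariant derivative is unique.\<close>

lemma has_covariant_derivative_coord:
  assumes ch: "christoffel c W \<Gamma>" and W: "\<gamma> t \<in> W" and cont: "isCont \<gamma> t"
    and dx: "(snd c \<circ> \<gamma> has_vector_derivative x') (at t)"
    and cov: "has_Dt \<gamma> Z t w"
  shows "((\<lambda>s. coord c (\<gamma> s) (Z s)) has_vector_derivative
     coord c (\<gamma> t) w - \<Gamma> (snd c (\<gamma> t)) x' (coord c (\<gamma> t) (Z t))) (at t)"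
proof -
  note chD = christoffelD[OF ch]
  have c: "c \<in> A" "\<gamma> t \<in> fst c" using chD W by auto
  obtain X and n :: nat and E z where X: "svf X" "X (\<gamma> t) = velocity A \<gamma> t"
    and E: "\<And>i. i < n \<Longrightarrow> svf (E i)" and z: "\<And>i. i < n \<Longrightarrow> z i differentiable (at t)"
    and Z: "\<forall>\<^sub>F r in nhds t. Z r = (\<Sum>i<n. z i r *\<^sub>R E i (\<gamma> r))"
    and w: "w = (\<Sum>i<n. deriv (z i) t *\<^sub>R E i (\<gamma> t) + z i t *\<^sub>R nabla X (E i) (\<gamma> t))"
    using cov by (rule has_covariant_derivativeE) (rule that)
  have Xc: "coord c (\<gamma> t) (X (\<gamma> t)) = x'"
    using velocity_coord[OF c cont dx] X(2) by simp
  let ?D = "\<lambda>i. frechet_derivative (crep c (E i)) (at (snd c (\<gamma> t))) x'"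
  have "((\<lambda>s. \<Sum>i<n. z i s *\<^sub>R crep c (E i) (snd c (\<gamma> s))) has_vector_derivative
      (\<Sum>i<n. z i t *\<^sub>R ?D i + deriv (z i) t *\<^sub>R crep c (E i) (snd c (\<gamma> t)))) (at t)"
  proof (rule has_vector_derivative_sum)
    fix i assume "i \<in> {..<n}"
    then have i: "i < n" by simp
    have "(crep c (E i) has_derivative frechet_derivative (crep c (E i)) (at (snd c (\<gamma> t)))) (at (snd c (\<gamma> t)))"
      using c by (intro smooth_on_has_derivative[OF svfD[OF E[OF i] c(1)] chart_homeomorphism(3)[OF c(1)]]) auto
    then have "(crep c (E i) has_derivative frechet_derivative (crep c (E i)) (at (snd c (\<gamma> t)))) (at ((snd c \<circ> \<gamma>) t))"
      by (simp only: comp_apply)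
    from has_vector_derivative_compose_at[OF dx this]
    have "((\<lambda>s. crep c (E i) (snd c (\<gamma> s))) has_vector_derivative ?D i) (at t)" by (simp only: comp_apply)
    moreover have "(z i has_field_derivative deriv (z i) t) (at t)"
      using z[OF i] by (simp add: DERIV_deriv_iff_real_differentiable)
    ultimately show "((\<lambda>s. z i s *\<^sub>R crep c (E i) (snd c (\<gamma> s))) has_vector_derivative
       z i t *\<^sub>R ?D i + deriv (z i) t *\<^sub>R crep c (E i) (snd c (\<gamma> t))) (at t)"
      by (intro has_vector_derivative_scaleR)
  qed
  moreover have Zc: "\<forall>\<^sub>F s in nhds t. (\<Sum>i<n. z i s *\<^sub>R crep c (E i) (snd c (\<gamma> s))) = coord c (\<gamma> s) (Z s)"
    using Z eventually_isCont_open[OF cont chart_homeomorphism(1)[OF c(1)] c(2)]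
    by eventually_elim (simp add: coord_sum c(1) crep_def chart_inv_apply)
  ultimately have "((\<lambda>s. coord c (\<gamma> s) (Z s)) has_vector_derivative
      (\<Sum>i<n. z i t *\<^sub>R ?D i + deriv (z i) t *\<^sub>R crep c (E i) (snd c (\<gamma> t)))) (at t)"
    by (rule has_vector_derivative_eventually_eq)
  moreover have "(\<Sum>i<n. z i t *\<^sub>R ?D i + deriv (z i) t *\<^sub>R crep c (E i) (snd c (\<gamma> t))) =
      coord c (\<gamma> t) w - \<Gamma> (snd c (\<gamma> t)) x' (coord c (\<gamma> t) (Z t))"
  proof -
    interpret bounded_linear "coord c (\<gamma> t)" by (rule bounded_linear_coord[OF c])
    have Zt: "coord c (\<gamma> t) (Z t) = (\<Sum>i<n. z i t *\<^sub>R coord c (\<gamma> t) (E i (\<gamma> t)))"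
      using eventually_nhds_x_imp_x[OF Z] by (simp add: sum scaleR)
    have G: "\<Gamma> (snd c (\<gamma> t)) x' (coord c (\<gamma> t) (Z t)) = (\<Sum>i<n. z i t *\<^sub>R \<Gamma> (snd c (\<gamma> t)) x' (coord c (\<gamma> t) (E i (\<gamma> t))))"
      unfolding Zt by (simp add: linear_sum[OF chD(6)] linear_scale[OF chD(6)])
    have "coord c (\<gamma> t) w = (\<Sum>i<n. deriv (z i) t *\<^sub>R coord c (\<gamma> t) (E i (\<gamma> t)) + z i t *\<^sub>R coord c (\<gamma> t) (nabla X (E i) (\<gamma> t)))"
      unfolding w by (simp add: sum add scaleR)
    also have "\<dots> = (\<Sum>i<n. (z i t *\<^sub>R ?D i + deriv (z i) t *\<^sub>R crep c (E i) (snd c (\<gamma> t))) + z i t *\<^sub>R \<Gamma> (snd c (\<gamma> t)) x' (coord c (\<gamma> t) (E i (\<gamma> t))))"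
      by (rule sum.cong[OF refl]) (simp add: chD(7)[OF X(1) E W] Xc crep_def chart_inv_apply c scaleR_add_right)
    finally show ?thesis by (simp add: G sum.distrib)
  qed
  ultimately show ?thesis by simp
qed

text \<open>A field along \<open>\<gamma>\<close> with differentiable coordinates is represented by those coordinates and the
coordinate frame; the constant combination of frame fields with coefficients \<open>x'\<close> extends the
velocity.\<close>

lemma has_covariant_derivative_exists:
  assumes ch: "christoffel c W \<Gamma>" and W: "\<gamma> t \<in> W" and cont: "isCont \<gamma> t"
    and dx: "(snd c \<circ> \<gamma> has_vector_derivative x') (at t)"
    and dZ: "((\<lambda>s. coord c (\<gamma> s) (Z s)) has_vector_derivative z') (at t)"
  shows "\<exists>w. has_Dt \<gamma> Z t w"
proof -
  note chD = christoffelD[OF ch]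
  have c: "c \<in> A" "\<gamma> t \<in> fst c" using chD W by auto
  obtain E where E: "\<And>b. b \<in> Basis \<Longrightarrow> svf (E b)" "\<And>b p. b \<in> Basis \<Longrightarrow> p \<in> W \<Longrightarrow> coord c p (E b p) = b"
    using chD(8) by blast
  \<comment> \<open>Representations along curves are indexed by numbers, so the basis is enumerated.\<close>
  obtain e where e: "bij_betw e {..<DIM('e)} (Basis :: 'e set)"
    using ex_bij_betw_nat_finite[of "Basis :: 'e set"] by (auto simp: atLeast0LessThan)
  then have eB: "e i \<in> Basis" if "i < DIM('e)" for i using that bij_betwE by blast
  have expand: "(\<Sum>i<DIM('e). (v \<bullet> e i) *\<^sub>R e i) = v" for v
    using sum.reindex_bij_betw[OF e, of "\<lambda>b. (v \<bullet> b) *\<^sub>R b"] euclidean_representation[of v] by simp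
  define X where "X p = (\<Sum>b\<in>Basis. (x' \<bullet> b) *\<^sub>R E b p)" for p
  have X: "svf X" unfolding X_def by (intro svf_sum svf_scale_const E)
  have "coord c (\<gamma> t) (X (\<gamma> t)) = x'"
    unfolding X_def by (simp add: coord_sum c E W euclidean_representation)
  then have "X (\<gamma> t) = velocity A \<gamma> t"
    using velocity_coord[OF c cont dx] coord_inject[OF c] by metis
  moreover have "(\<lambda>s. coord c (\<gamma> s) (Z s) \<bullet> e i) differentiable (at t)" for i
    using has_derivative_inner_left[OF dZ[unfolded has_vector_derivative_def]] differentiableI by blast
  moreover have "\<forall>\<^sub>F s in nhds t. Z s = (\<Sum>i<DIM('e). (coord c (\<gamma> s) (Z s) \<bullet> e i) *\<^sub>R E (e i) (\<gamma> s))"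
    using eventually_isCont_open[OF cont chD(2) W]
  proof eventually_elim
    case (elim s)
    then have s: "\<gamma> s \<in> fst c" using chD(3) by auto
    have "coord c (\<gamma> s) (\<Sum>i<DIM('e). (coord c (\<gamma> s) (Z s) \<bullet> e i) *\<^sub>R E (e i) (\<gamma> s)) = coord c (\<gamma> s) (Z s)"
      by (simp add: coord_sum c(1) s E(2)[OF eB elim] expand)
    then show ?case using coord_inject[OF c(1) s] by metis
  qed
  ultimately show ?thesis
    unfolding has_covariant_derivative_def
    by (intro exI[of _ "\<Sum>i<DIM('e). deriv (\<lambda>s. coord c (\<gamma> s) (Z s) \<bullet> e i) t *\<^sub>R E (e i) (\<gamma> t) +
          (coord c (\<gamma> t) (Z t) \<bullet> e i) *\<^sub>R nabla X (E (e i)) (\<gamma> t)"] exI[of _ X] exI[of _ "DIM('e)"]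
        exI[of _ "\<lambda>i. E (e i)"] exI[of _ "\<lambda>i s. coord c (\<gamma> s) (Z s) \<bullet> e i"])
       (simp add: X E(1) eB)
qed

lemma covariant_derivative_coord:
  assumes ch: "christoffel c W \<Gamma>" and W: "\<gamma> t \<in> W" and cont: "isCont \<gamma> t"
    and dx: "(snd c \<circ> \<gamma> has_vector_derivative x') (at t)"
    and dZ: "((\<lambda>s. coord c (\<gamma> s) (Z s)) has_vector_derivative z') (at t)"
  shows "coord c (\<gamma> t) (Dt \<gamma> Z t) = z' + \<Gamma> (snd c (\<gamma> t)) x' (coord c (\<gamma> t) (Z t))"
    and "has_Dt \<gamma> Z t w \<longleftrightarrow> w = Dt \<gamma> Z t"
proof -
  note chD = christoffelD[OF ch]
  have c: "c \<in> A" "\<gamma> t \<in> fst c" using chD W by auto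
  have u: "coord c (\<gamma> t) w = z' + \<Gamma> (snd c (\<gamma> t)) x' (coord c (\<gamma> t) (Z t))"
    if "has_Dt \<gamma> Z t w" for w
    using vector_derivative_unique_at[OF has_covariant_derivative_coord[OF assms(1-4) that] dZ]
    by (simp add: algebra_simps)
  obtain w0 where w0: "has_Dt \<gamma> Z t w0"
    using has_covariant_derivative_exists[OF assms] by blast
  have uniq: "w = w0" if "has_Dt \<gamma> Z t w" for w
    using u[OF that] u[OF w0] coord_inject[OF c] by metis
  have eq: "Dt \<gamma> Z t = w0"
    unfolding covariant_derivative_def by (rule the_equality, rule w0, rule uniq)
  show "coord c (\<gamma> t) (Dt \<gamma> Z t) = z' + \<Gamma> (snd c (\<gamma> t)) x' (coord c (\<gamma> t) (Z t))"
    unfolding eq by (rule u[OF w0])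
  show "has_Dt \<gamma> Z t w \<longleftrightarrow> w = Dt \<gamma> Z t"
    unfolding eq using w0 uniq by metis
qed

end

section \<open>Curves with vanishing second covariant derivative of the velocity\<close>

lemma smooth_on_vector_derivative:
  fixes f :: "real \<Rightarrow> 'a::real_normed_vector"
  assumes "smooth_on S f" "open S" "s \<in> S"
  shows "(f has_vector_derivative frechet_derivative f (at s) 1) (at s)"
proof -
  have d: "(f has_derivative frechet_derivative f (at s)) (at s)"
    by (rule smooth_on_has_derivative[OF assms])
  have "frechet_derivative f (at s) h = h *\<^sub>R frechet_derivative f (at s) 1" for h
    using linear_scale[OF bounded_linear.linear[OF has_derivative_bounded_linear[OF d]], of h 1] by simp
  then show ?thesis unfolding has_vector_derivative_def by (intro has_derivative_eq_rhs[OF d] ext)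
qed

lemma frechet_derivative_vector:
  "(f has_vector_derivative f') (at s) \<Longrightarrow> frechet_derivative f (at s) 1 = f'"
  unfolding has_vector_derivative_def using frechet_derivative_at by (metis scaleR_one)

text \<open>The equation \<open>D\<^sub>t\<^sup>2 \<gamma>' = 0\<close> as a first-order system for \<open>(x, v, a)\<close>, the coordinates of position,
velocity and covariant acceleration.\<close>

definition jet_field :: "('e \<Rightarrow> 'e \<Rightarrow> 'e \<Rightarrow> 'e) \<Rightarrow> 'e \<times> 'e \<times> 'e \<Rightarrow> 'e \<times> 'e \<times> 'e::real_vector" where
  "jet_field \<Gamma> z = (fst (snd z), snd (snd z) - \<Gamma> (fst z) (fst (snd z)) (fst (snd z)),
      - \<Gamma> (fst z) (fst (snd z)) (snd (snd z)))"

context connection_mfd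
begin

lemma christoffel_expansion:
  assumes "christoffel c W \<Gamma>"
  shows "\<Gamma> x v w = (\<Sum>i\<in>Basis. \<Sum>j\<in>Basis. (v \<bullet> i) *\<^sub>R (w \<bullet> j) *\<^sub>R \<Gamma> x i j)"
proof -
  note ch = christoffelD[OF assms]
  have "\<Gamma> x v w = (\<Sum>i\<in>Basis. (v \<bullet> i) *\<^sub>R \<Gamma> x i w)"
    using ch(5) by (intro bounded_linear_basis_expansion) (simp add: linear_conv_bounded_linear)
  also have "\<dots> = (\<Sum>i\<in>Basis. (v \<bullet> i) *\<^sub>R (\<Sum>j\<in>Basis. (w \<bullet> j) *\<^sub>R \<Gamma> x i j))"
    using ch(6) by (intro sum.cong refl arg_cong2[where f = scaleR] bounded_linear_basis_expansion)
       (simp add: linear_conv_bounded_linear)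
  finally show ?thesis by (simp add: scaleR_sum_right)
qed

lemma smooth_on_christoffel:
  assumes ch: "christoffel c W \<Gamma>" and "open S" "smooth_on S f" "smooth_on S g" "smooth_on S h"
    and "f ` S \<subseteq> snd c ` W"
  shows "smooth_on S (\<lambda>s. \<Gamma> (f s) (g s) (h s))"
proof -
  note chD = christoffelD[OF ch]
  have "open (snd c ` W)" by (rule open_chart_image[OF chD(1-3)])
  then show ?thesis
    unfolding christoffel_expansion[OF ch, of "f _" "g _"]
    by (intro smooth_on_sum smooth_on_scaleR smooth_on_inner smooth_on_const assms(2-5)
        smooth_on_compose[OF assms(2) _ chD(4) assms(3,6)])
qed

lemma smooth_on_jet_field:
  assumes ch: "christoffel c W \<Gamma>"
  shows "open (snd c ` W \<times> (UNIV :: ('e \<times> 'e) set))" "smooth_on (snd c ` W \<times> UNIV) (jet_field \<Gamma>)"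
proof -
  note chD = christoffelD[OF ch]
  show o: "open (snd c ` W \<times> (UNIV :: ('e \<times> 'e) set))"
    by (intro open_Times open_chart_image[OF chD(1-3)] open_UNIV)
  have s: "smooth_on (snd c ` W \<times> (UNIV :: ('e \<times> 'e) set)) (\<lambda>z. fst z)"
    "smooth_on (snd c ` W \<times> (UNIV :: ('e \<times> 'e) set)) (\<lambda>z. fst (snd z))"
    "smooth_on (snd c ` W \<times> (UNIV :: ('e \<times> 'e) set)) (\<lambda>z. snd (snd z))"
    by (auto intro!: smooth_on_bounded_linear o bounded_linear_fst bounded_linear_snd
        bounded_linear_compose[OF bounded_linear_fst] bounded_linear_compose[OF bounded_linear_snd])
  have im: "(\<lambda>z. fst z) ` (snd c ` W \<times> (UNIV :: ('e \<times> 'e) set)) \<subseteq> snd c ` W" by auto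
  show "smooth_on (snd c ` W \<times> UNIV) (jet_field \<Gamma>)"
    unfolding jet_field_def
    by (intro smooth_on_Pair smooth_on_diff smooth_on_uminus o s smooth_on_christoffel[OF ch o _ _ _ im])
qed

definition jet :: "('m, 'e) chart \<Rightarrow> (real \<Rightarrow> 'm) \<Rightarrow> real \<Rightarrow> 'e \<times> 'e \<times> 'e" where
  "jet c \<gamma> t = (snd c (\<gamma> t), coord c (\<gamma> t) (velocity A \<gamma> t),
     coord c (\<gamma> t) (accel \<gamma> t))"

lemma smooth_into_isCont: "smooth_into A I \<gamma> \<Longrightarrow> open I \<Longrightarrow> s \<in> I \<Longrightarrow> isCont \<gamma> s"
  by (simp add: smooth_into_def continuous_on_eq_continuous_at)

lemma smooth_into_coord:
  fixes \<gamma> :: "real \<Rightarrow> 'm"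
  assumes "smooth_into A I \<gamma>" "open I" "c \<in> A" "open W" "W \<subseteq> fst c"
  shows "open {s \<in> I. \<gamma> s \<in> W}" "smooth_on {s \<in> I. \<gamma> s \<in> W} (snd c \<circ> \<gamma>)"
proof -
  have o: "open {s \<in> I. \<gamma> s \<in> W}" if "open W" for W
    using continuous_open_preimage[OF _ assms(2) that, of \<gamma>] assms(1)
    by (simp add: smooth_into_def vimage_def Int_def)
  show "open {s \<in> I. \<gamma> s \<in> W}" by (rule o[OF assms(4)])
  show "smooth_on {s \<in> I. \<gamma> s \<in> W} (snd c \<circ> \<gamma>)"
    by (rule smooth_on_subset[of "{s \<in> I. \<gamma> s \<in> fst c}"])
       (use assms in \<open>auto simp: smooth_into_def intro!: o chart_homeomorphism\<close>)
qed

text \<open>Coordinate expressions for the first three derivatives of a smooth curve, and uniqueness of the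
covariant derivatives that occur in the initial value problem.\<close>

lemma curve_coords:
  assumes ch: "christoffel c W \<Gamma>" and I: "open I" "smooth_into A I \<gamma>"
    and J_def: "J = {s \<in> I. \<gamma> s \<in> W}" and x_def: "x = snd c \<circ> \<gamma>"
    and v_def: "v = (\<lambda>s. frechet_derivative x (at s) 1)"
    and a_def: "a = (\<lambda>s. frechet_derivative v (at s) 1 + \<Gamma> (x s) (v s) (v s))"
  shows "open J" "smooth_on J x" "smooth_on J v" "smooth_on J a"
    and "\<And>s. s \<in> J \<Longrightarrow> jet c \<gamma> s = (x s, v s, a s)"
    and "\<And>s. s \<in> J \<Longrightarrow> coord c (\<gamma> s) (jerk \<gamma> s)
            = frechet_derivative a (at s) 1 + \<Gamma> (x s) (v s) (a s)"
    and "\<And>s w. s \<in> J \<Longrightarrow> has_Dt \<gamma> (velocity A \<gamma>) s w \<longleftrightarrow>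
           w = accel \<gamma> s"
    and "\<And>s w. s \<in> J \<Longrightarrow> has_Dt \<gamma> (accel \<gamma>) s w \<longleftrightarrow>
           w = jerk \<gamma> s"
proof -
  note chD = christoffelD[OF ch]
  show J: "open J" and x: "smooth_on J x"
    unfolding J_def x_def by (rule smooth_into_coord[OF I(2,1) chD(1-3)])+
  show v: "smooth_on J v" unfolding v_def by (rule smooth_on_frechet[OF x])
  have im: "x ` J \<subseteq> snd c ` W" by (auto simp: J_def x_def)
  show a: "smooth_on J a"
    unfolding a_def by (intro smooth_on_add J smooth_on_frechet v smooth_on_christoffel[OF ch J x _ _ im])
  have W: "\<gamma> s \<in> W" "isCont \<gamma> s" "\<gamma> s \<in> fst c" if "s \<in> J" for s
    using that chD(3) smooth_into_isCont[OF I(2,1)] by (auto simp: J_def)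
  have dx: "(snd c \<circ> \<gamma> has_vector_derivative v s) (at s)" if "s \<in> J" for s
    using smooth_on_vector_derivative[OF x J that] by (simp add: v_def x_def)
  have vel: "coord c (\<gamma> s) (velocity A \<gamma> s) = v s" if "s \<in> J" for s
    by (rule velocity_coord[OF chD(1) W(3,2) dx]) (rule that)+
  have ev: "\<forall>\<^sub>F r in nhds s. r \<in> J" if "s \<in> J" for s
    using J that by (rule eventually_nhds_in_open)
  have dv: "((\<lambda>s. coord c (\<gamma> s) (velocity A \<gamma> s)) has_vector_derivative frechet_derivative v (at s) 1) (at s)" if "s \<in> J" for s
    by (rule has_vector_derivative_eventually_eq[OF smooth_on_vector_derivative[OF v J that]])
       (use ev[OF that] in eventually_elim, simp add: vel)
  note cov1 = covariant_derivative_coord[OF ch W(1,2) dx dv]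
  have acc: "coord c (\<gamma> s) (accel \<gamma> s) = a s" if "s \<in> J" for s
    using cov1(1)[OF that that that that] by (simp add: a_def vel[OF that] x_def)
  show "jet c \<gamma> s = (x s, v s, a s)" if "s \<in> J" for s
    by (simp add: jet_def vel acc that x_def)
  show "has_Dt \<gamma> (velocity A \<gamma>) s w \<longleftrightarrow>
           w = accel \<gamma> s" if "s \<in> J" for s w
    by (rule cov1(2)[OF that that that that])
  have da: "((\<lambda>s. coord c (\<gamma> s) (accel \<gamma> s)) has_vector_derivative frechet_derivative a (at s) 1) (at s)" if "s \<in> J" for s
    by (rule has_vector_derivative_eventually_eq[OF smooth_on_vector_derivative[OF a J that]])
       (use ev[OF that] in eventually_elim, simp add: acc)
  note cov2 = covariant_derivative_coord[OF ch W(1,2) dx da]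
  show "coord c (\<gamma> s) (jerk \<gamma> s)
            = frechet_derivative a (at s) 1 + \<Gamma> (x s) (v s) (a s)" if "s \<in> J" for s
    using cov2(1)[OF that that that that] by (simp add: acc[OF that] x_def)
  show "has_Dt \<gamma> (accel \<gamma>) s w \<longleftrightarrow>
           w = jerk \<gamma> s" if "s \<in> J" for s w
    by (rule cov2(2)[OF that that that that])
qed

lemma jet_ode:
  assumes ch: "christoffel c W \<Gamma>" and I: "open I" "smooth_into A I \<gamma>" and t: "t \<in> I" "\<gamma> t \<in> W"
    and zero: "jerk \<gamma> t = 0"
  shows "(jet c \<gamma> has_vector_derivative jet_field \<Gamma> (jet c \<gamma> t)) (at t)"
proof -
  note chD = christoffelD[OF ch]
  define J where "J = {s \<in> I. \<gamma> s \<in> W}"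
  define x where "x = snd c \<circ> \<gamma>"
  define v where "v = (\<lambda>s. frechet_derivative x (at s) 1)"
  define a where "a = (\<lambda>s. frechet_derivative v (at s) 1 + \<Gamma> (x s) (v s) (v s))"
  note cc = curve_coords[OF ch I J_def x_def v_def a_def]
  have tJ: "t \<in> J" using t by (simp add: J_def)
  have "coord c (\<gamma> t) 0 = 0"
    using linear_0[OF bounded_linear.linear[OF bounded_linear_coord]] chD(1,3) t(2) by blast
  then have da: "frechet_derivative a (at t) 1 = - \<Gamma> (x t) (v t) (a t)"
    using cc(6)[OF tJ] by (simp add: zero add_eq_0_iff)
  have dv: "frechet_derivative v (at t) 1 = a t - \<Gamma> (x t) (v t) (v t)" by (simp add: a_def)
  have "((\<lambda>s. (x s, v s, a s)) has_vector_derivative (v t, a t - \<Gamma> (x t) (v t) (v t), - \<Gamma> (x t) (v t) (a t))) (at t)"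
    using smooth_on_vector_derivative[OF cc(2,1) tJ] smooth_on_vector_derivative[OF cc(3,1) tJ] smooth_on_vector_derivative[OF cc(4,1) tJ]
    unfolding da dv v_def[symmetric] by (intro has_vector_derivative_Pair) (simp_all add: v_def)
  then have "(jet c \<gamma> has_vector_derivative (v t, a t - \<Gamma> (x t) (v t) (v t), - \<Gamma> (x t) (v t) (a t))) (at t)"
    by (rule has_vector_derivative_transform_within_open[OF _ cc(1) tJ]) (simp add: cc(5))
  then show ?thesis by (simp add: cc(5)[OF tJ] jet_field_def)
qed

text \<open>Conversely, the position component of a solution of the first-order system is a curve whose jet is
the whole solution.\<close>

lemma curve_from_jet:
  assumes ch: "christoffel c W \<Gamma>" and I: "open I"
    and z: "\<And>t. t \<in> I \<Longrightarrow> (z has_vector_derivative jet_field \<Gamma> (z t)) (at t)"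
    and zW: "\<And>t. t \<in> I \<Longrightarrow> fst (z t) \<in> snd c ` W"
  defines "\<gamma> \<equiv> \<lambda>t. chart_inv c (fst (z t))"
  shows "smooth_into A I \<gamma>" "\<And>t. t \<in> I \<Longrightarrow> jet c \<gamma> t = z t"
    "\<And>t. t \<in> I \<Longrightarrow> jerk \<gamma> t = 0"
proof -
  note chD = christoffelD[OF ch]
  have im: "z ` I \<subseteq> snd c ` W \<times> UNIV" using zW by (intro image_subsetI) (simp add: mem_Times_iff)
  have sz: "smooth_on I z"
    by (rule ode_solution_smooth[OF I smooth_on_jet_field[OF ch] im z])
  have sx: "smooth_on I (\<lambda>t. fst (z t))"
    by (rule smooth_on_bounded_linear_compose[OF bounded_linear_fst I sz])
  have \<gamma>W: "\<gamma> t \<in> W" "snd c (\<gamma> t) = fst (z t)" if "t \<in> I" for t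
  proof -
    have "fst (z t) \<in> snd c ` W" by (rule zW[OF that])
    then obtain p where p: "p \<in> W" "fst (z t) = snd c p" by blast
    then show "\<gamma> t \<in> W" "snd c (\<gamma> t) = fst (z t)"
      using chart_inv_apply[OF chD(1), of p] chD(3) by (auto simp: \<gamma>_def)
  qed
  have cont: "continuous_on I \<gamma>"
    unfolding \<gamma>_def
    by (rule continuous_on_compose2[OF continuous_chart_inv[OF chD(1)] smooth_on_imp_continuous_on[OF sx]])
       (use zW chD(3) in blast)
  show into: "smooth_into A I \<gamma>"
    unfolding smooth_into_def
  proof (intro conjI ballI cont)
    fix d assume d: "d \<in> A"
    let ?S = "{t \<in> I. \<gamma> t \<in> fst d}"
    have S: "open ?S"
      using continuous_open_preimage[OF cont I chart_homeomorphism(1)[OF d]] by (simp add: vimage_def Int_def)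
    have "smooth_on ?S (\<lambda>t. transition c d (fst (z t)))"
    proof (rule smooth_on_compose[OF S open_overlap[OF chD(1) chart_homeomorphism(1)[OF d]] smooth_transition[OF chD(1) d]])
      show "smooth_on ?S (\<lambda>t. fst (z t))" by (rule smooth_on_subset[OF sx I S]) auto
      show "(\<lambda>t. fst (z t)) ` ?S \<subseteq> snd c ` (fst c \<inter> fst d)"
      proof (rule image_subsetI)
        fix t assume t: "t \<in> ?S"
        then have "\<gamma> t \<in> fst c \<inter> fst d" using \<gamma>W(1)[of t] chD(3) by auto
        then show "fst (z t) \<in> snd c ` (fst c \<inter> fst d)" using \<gamma>W(2)[of t] t by (metis (no_types, lifting) image_eqI mem_Collect_eq)
      qed
    qed
    then show "smooth_on ?S (snd d \<circ> \<gamma>)" by (simp add: comp_def \<gamma>_def)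
  qed
  define J where "J = {s \<in> I. \<gamma> s \<in> W}"
  define x where "x = snd c \<circ> \<gamma>"
  define v where "v = (\<lambda>s. frechet_derivative x (at s) 1)"
  define a where "a = (\<lambda>s. frechet_derivative v (at s) 1 + \<Gamma> (x s) (v s) (v s))"
  note cc = curve_coords[OF ch I into J_def x_def v_def a_def]
  have J: "J = I" using \<gamma>W by (auto simp: J_def)
  have dz: "((\<lambda>t. fst (z t)) has_vector_derivative fst (snd (z t))) (at t)"
    "((\<lambda>t. fst (snd (z t))) has_vector_derivative snd (snd (z t)) - \<Gamma> (fst (z t)) (fst (snd (z t))) (fst (snd (z t)))) (at t)"
    "((\<lambda>t. snd (snd (z t))) has_vector_derivative - \<Gamma> (fst (z t)) (fst (snd (z t))) (snd (snd (z t)))) (at t)" if "t \<in> I" for t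
    using bounded_linear.has_vector_derivative[OF bounded_linear_fst z[OF that]]
      bounded_linear.has_vector_derivative[OF bounded_linear_compose[OF bounded_linear_fst bounded_linear_snd] z[OF that]]
      bounded_linear.has_vector_derivative[OF bounded_linear_compose[OF bounded_linear_snd bounded_linear_snd] z[OF that]]
    by (simp_all add: jet_field_def)
  have xz: "x t = fst (z t)" if "t \<in> I" for t using \<gamma>W(2)[OF that] by (simp add: x_def)
  have vz: "v t = fst (snd (z t))" if "t \<in> I" for t
    unfolding v_def
    by (rule frechet_derivative_vector, rule has_vector_derivative_transform_within_open[OF dz(1)[OF that] I that])
       (simp add: xz)
  have dv: "frechet_derivative v (at t) 1 = snd (snd (z t)) - \<Gamma> (fst (z t)) (fst (snd (z t))) (fst (snd (z t)))" if "t \<in> I" for t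
    by (rule frechet_derivative_vector, rule has_vector_derivative_transform_within_open[OF dz(2)[OF that] I that])
       (simp add: vz)
  have az: "a t = snd (snd (z t))" if "t \<in> I" for t
    by (simp add: a_def dv xz vz that)
  have da: "frechet_derivative a (at t) 1 = - \<Gamma> (fst (z t)) (fst (snd (z t))) (snd (snd (z t)))" if "t \<in> I" for t
    by (rule frechet_derivative_vector, rule has_vector_derivative_transform_within_open[OF dz(3)[OF that] I that])
       (simp add: az)
  show "jet c \<gamma> t = z t" if "t \<in> I" for t
    using cc(5)[of t] that by (simp add: J xz vz az)
  show "jerk \<gamma> t = 0" if "t \<in> I" for t
  proof -
    have "\<gamma> t \<in> fst c" using \<gamma>W(1)[OF that] chD(3) by auto
    moreover have "coord c (\<gamma> t) (jerk \<gamma> t) = 0"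
      using cc(6)[of t] that by (simp add: J da xz vz az)
    ultimately show ?thesis
      using coord_inject[OF chD(1)] linear_0[OF bounded_linear.linear[OF bounded_linear_coord[OF chD(1)]]] by metis
  qed
qed

lemma velocity_germ:
  assumes "\<forall>\<^sub>F s in nhds t. \<gamma> s = \<gamma>' s"
  shows "velocity A \<gamma> t = velocity A \<gamma>' t"
proof -
  have e: "\<gamma> t = \<gamma>' t" using eventually_nhds_x_imp_x[OF assms] .
  let ?d = "chart_at A (\<gamma>' t)"
  have "(snd ?d \<circ> \<gamma> has_vector_derivative w) (at t) \<longleftrightarrow> (snd ?d \<circ> \<gamma>' has_vector_derivative w) (at t)" for w
  proof
    assume "(snd ?d \<circ> \<gamma> has_vector_derivative w) (at t)"
    then show "(snd ?d \<circ> \<gamma>' has_vector_derivative w) (at t)"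
      by (rule has_vector_derivative_eventually_eq) (use assms in eventually_elim, simp)
  next
    assume "(snd ?d \<circ> \<gamma>' has_vector_derivative w) (at t)"
    then show "(snd ?d \<circ> \<gamma> has_vector_derivative w) (at t)"
      by (rule has_vector_derivative_eventually_eq) (use assms in eventually_elim, simp)
  qed
  then show ?thesis by (simp add: velocity_def e vector_derivative_def)
qed

text \<open>Everything in sight depends only on germs of curves; this is needed to compare two solutions at
points near which they agree.\<close>

lemma has_covariant_derivative_germ:
  assumes "has_Dt \<gamma> Z t w"
    and e: "\<forall>\<^sub>F s in nhds t. \<gamma> s = \<gamma>' s" "\<forall>\<^sub>F s in nhds t. Z s = Z' s"
  shows "has_Dt \<gamma>' Z' t w"
proof -
  have 1: "\<gamma>' t = \<gamma> t" "velocity A \<gamma>' t = velocity A \<gamma> t"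
    using eventually_nhds_x_imp_x[OF e(1)] velocity_germ[OF e(1)] by auto
  have 2: "\<forall>\<^sub>F s in nhds t. Z' s = (\<Sum>i<n. z i s *\<^sub>R E i (\<gamma>' s))"
    if "\<forall>\<^sub>F s in nhds t. Z s = (\<Sum>i<n. z i s *\<^sub>R E i (\<gamma> s))" for n :: nat and z :: "nat \<Rightarrow> real \<Rightarrow> real" and E
    using that e by eventually_elim simp
  show ?thesis
    using assms(1) unfolding has_covariant_derivative_def 1 using 2 by blast
qed

lemma covariant_derivative_germ:
  assumes e: "\<forall>\<^sub>F s in nhds t. \<gamma> s = \<gamma>' s" "\<forall>\<^sub>F s in nhds t. Z s = Z' s"
  shows "Dt \<gamma> Z t = Dt \<gamma>' Z' t"
proof -
  have "\<forall>\<^sub>F s in nhds t. \<gamma>' s = \<gamma> s" "\<forall>\<^sub>F s in nhds t. Z' s = Z s"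
    using e by (auto simp: eq_commute)
  then have "has_Dt \<gamma> Z t w \<longleftrightarrow> has_Dt \<gamma>' Z' t w" for w
    using has_covariant_derivative_germ e by blast
  then show ?thesis by (simp add: covariant_derivative_def)
qed

lemma jet_germ:
  assumes "\<forall>\<^sub>F s in nhds t. \<gamma> s = \<gamma>' s"
  shows "jet c \<gamma> t = jet c \<gamma>' t"
proof -
  have "\<forall>\<^sub>F s in nhds t. \<forall>\<^sub>F r in nhds s. \<gamma> r = \<gamma>' r"
    using assms eventually_eventually by blast
  then have "\<forall>\<^sub>F s in nhds t. velocity A \<gamma> s = velocity A \<gamma>' s"
    by eventually_elim (rule velocity_germ)
  then show ?thesis
    using eventually_nhds_x_imp_x[OF assms]
    by (simp add: jet_def velocity_germ[OF assms] covariant_derivative_germ[OF assms])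
qed

lemma solves_ivpD:
  assumes "solves_ivp A nabla q X Y I \<gamma>"
  shows "open I" "is_interval I" "0 \<in> I" "smooth_into A I \<gamma>" "\<gamma> 0 = q" "velocity A \<gamma> 0 = X"
    "accel \<gamma> 0 = Y"
    "\<And>t. t \<in> I \<Longrightarrow> jerk \<gamma> t = 0"
  using assms by (auto simp: solves_ivp_def)

text \<open>If two solutions have the same jet at \<open>t\<close>, both jets solve the same first-order system near \<open>t\<close>.\<close>

lemma solution_local_uniqueness:
  assumes s: "solves_ivp A nabla q X Y I \<gamma>" "solves_ivp A nabla q' X' Y' I' \<gamma>'"
    and t: "t \<in> I" "t \<in> I'" and ch: "christoffel c W \<Gamma>" "\<gamma> t \<in> W" "jet c \<gamma> t = jet c \<gamma>' t" "\<gamma> t = \<gamma>' t"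
  shows "\<forall>\<^sub>F r in nhds t. \<gamma> r = \<gamma>' r"
proof -
  note chD = christoffelD[OF ch(1)]
  note s1 = solves_ivpD[OF s(1)] and s2 = solves_ivpD[OF s(2)]
  define J where "J = {r \<in> I. \<gamma> r \<in> W} \<inter> {r \<in> I'. \<gamma>' r \<in> W}"
  have "open J" unfolding J_def
    by (intro open_Int smooth_into_coord(1)[OF s1(4,1) chD(1-3)] smooth_into_coord(1)[OF s2(4,1) chD(1-3)])
  moreover have "t \<in> J" using t ch by (simp add: J_def)
  ultimately obtain \<delta> where \<delta>: "\<delta> > 0" "\<And>r. \<bar>r - t\<bar> < \<delta> \<Longrightarrow> r \<in> J"
    unfolding open_dist by (auto simp: dist_real_def)
  have "\<exists>\<epsilon>>0. \<forall>r. \<bar>r - t\<bar> < \<epsilon> \<longrightarrow> jet c \<gamma> r = jet c \<gamma>' r"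
  proof (rule ode_local_uniqueness[OF smooth_on_jet_field[OF ch(1)] \<delta>(1)])
    show "(jet c \<gamma> has_vector_derivative jet_field \<Gamma> (jet c \<gamma> r)) (at r)" if "\<bar>r - t\<bar> < \<delta>" for r
      using \<delta>(2)[OF that] by (intro jet_ode[OF ch(1) s1(1,4) _ _ s1(8)]) (auto simp: J_def)
    show "(jet c \<gamma>' has_vector_derivative jet_field \<Gamma> (jet c \<gamma>' r)) (at r)" if "\<bar>r - t\<bar> < \<delta>" for r
      using \<delta>(2)[OF that] by (intro jet_ode[OF ch(1) s2(1,4) _ _ s2(8)]) (auto simp: J_def)
  qed (use ch in \<open>auto simp: jet_def\<close>)
  then obtain \<epsilon> where \<epsilon>: "\<epsilon> > 0" "\<And>r. \<bar>r - t\<bar> < \<epsilon> \<Longrightarrow> jet c \<gamma> r = jet c \<gamma>' r" by blast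
  show ?thesis
    unfolding eventually_nhds_metric
  proof (intro exI[of _ "min \<delta> \<epsilon>"] conjI allI impI)
    fix r assume "dist r t < min \<delta> \<epsilon>"
    then have r: "\<bar>r - t\<bar> < \<delta>" "\<bar>r - t\<bar> < \<epsilon>" by (auto simp: dist_real_def)
    have "snd c (\<gamma> r) = snd c (\<gamma>' r)" using \<epsilon>(2)[OF r(2)] by (simp add: jet_def)
    moreover have "\<gamma> r \<in> fst c" "\<gamma>' r \<in> fst c" using \<delta>(2)[OF r(1)] chD(3) by (auto simp: J_def)
    ultimately show "\<gamma> r = \<gamma>' r" using chart_inv_apply[OF chD(1)] by metis
  qed (use \<delta> \<epsilon> in auto)
qed

lemma isCont_eq_at_limit_point:
  fixes f g :: "real \<Rightarrow> 'b::t2_space"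
  assumes "isCont f t" "isCont g t" "t islimpt S" "\<And>r. r \<in> S \<Longrightarrow> f r = g r"
  shows "f t = g t"
proof -
  have "(f \<longlongrightarrow> f t) (at t within S)" "(g \<longlongrightarrow> g t) (at t within S)"
    using assms(1,2) by (auto simp: isCont_def intro: tendsto_within_subset)
  moreover have "\<forall>\<^sub>F r in at t within S. f r = g r"
    using assms(4) by (auto simp: eventually_at_filter)
  ultimately have "(g \<longlongrightarrow> f t) (at t within S)"
    using tendsto_cong by blast
  then show ?thesis
    using tendsto_unique[of "at t within S"] \<open>(g \<longlongrightarrow> g t) (at t within S)\<close> assms(3)
    by (metis trivial_limit_within)
qed

text \<open>The set \<open>S\<close> of times near which the two curves agree is open and contains \<open>0\<close>.  At a limit point of
\<open>S\<close> the positions agree by the Hausdorff property, then the jets agree by continuity, and local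
uniqueness shows that the point belongs to \<open>S\<close>.  Hence \<open>S\<close> contains the connected set \<open>I \<inter> I'\<close>.\<close>

lemma solution_unique:
  assumes s: "solves_ivp A nabla q X Y I \<gamma>" "solves_ivp A nabla q X Y I' \<gamma>'" and t: "t \<in> I" "t \<in> I'"
  shows "\<gamma> t = \<gamma>' t"
proof -
  note s1 = solves_ivpD[OF s(1)] and s2 = solves_ivpD[OF s(2)]
  let ?C = "I \<inter> I'"
  define S where "S = {t. \<forall>\<^sub>F r in nhds t. \<gamma> r = \<gamma>' r}"
  have C: "open ?C" "connected ?C" "0 \<in> ?C"
    using s1 s2 by (auto intro!: is_interval_connected is_interval_Int)
  have S: "open S"
  proof (subst open_subopen, rule ballI)
    fix t assume "t \<in> S"
    then obtain T where "open T" "t \<in> T" "\<forall>r\<in>T. \<gamma> r = \<gamma>' r" by (auto simp: S_def eventually_nhds)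
    then show "\<exists>T. open T \<and> t \<in> T \<and> T \<subseteq> S" by (auto simp: S_def eventually_nhds)
  qed
  have "0 \<in> S"
  proof -
    obtain W \<Gamma> where W: "q \<in> W" "christoffel (chart_at A q) W \<Gamma>"
      using christoffel_exists[OF chart_at] by metis
    show ?thesis unfolding S_def mem_Collect_eq
      by (rule solution_local_uniqueness[OF s s1(3) s2(3) W(2)])
         (simp_all add: W s1(5-7) s2(5-7) jet_def)
  qed
  \<comment> \<open>\<open>S\<close> is closed relative to the common interval.\<close>
  have clos: "t \<in> S" if t: "t \<in> ?C" "t \<in> closure S" for t
  proof -
    have c1: "isCont \<gamma> t" and c2: "isCont \<gamma>' t"
      using smooth_into_isCont s1(1,4) s2(1,4) t(1) by auto
    have lim: "t islimpt S \<or> t \<in> S" using t(2) by (auto simp: closure_def)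
    show ?thesis
    proof (cases "t \<in> S")
      case False
      then have isl: "t islimpt S" using lim by simp
      have pe: "\<gamma> t = \<gamma>' t"
        by (rule isCont_eq_at_limit_point[OF c1 c2 isl]) (use eventually_nhds_x_imp_x in \<open>auto simp: S_def\<close>)
      obtain W \<Gamma> where W: "\<gamma> t \<in> W" "christoffel (chart_at A (\<gamma> t)) W \<Gamma>"
        using christoffel_exists[OF chart_at] by metis
      let ?c = "chart_at A (\<gamma> t)"
      have "isCont (jet ?c \<gamma>) t"
        by (rule has_vector_derivative_continuous[OF jet_ode[OF W(2) s1(1,4) _ W(1) s1(8)]]) (use t in auto)
      moreover have "isCont (jet ?c \<gamma>') t"
        by (rule has_vector_derivative_continuous[OF jet_ode[OF W(2) s2(1,4) _ _ s2(8)]]) (use t W(1) pe in auto)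
      ultimately have "jet ?c \<gamma> t = jet ?c \<gamma>' t"
        by (rule isCont_eq_at_limit_point[OF _ _ isl]) (use jet_germ in \<open>auto simp: S_def\<close>)
      from solution_local_uniqueness[OF s _ _ W(2,1) this pe] t(1) show ?thesis
        unfolding S_def by simp
    qed auto
  qed
  have "?C \<subseteq> S"
  proof (rule ccontr)
    assume "\<not> ?C \<subseteq> S"
    then have "?C \<inter> (- closure S) \<noteq> {}" using clos by blast
    moreover have "?C \<subseteq> S \<union> (- closure S)" using clos by blast
    moreover have "S \<inter> (- closure S) \<inter> ?C = {}" using closure_subset by blast
    moreover have "S \<inter> ?C \<noteq> {}" using \<open>0 \<in> S\<close> C(3) by blast
    ultimately show False
      using connectedD[OF C(2) S, of "- closure S"] by (auto simp: Int_commute)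
  qed
  then have "t \<in> S" using t by auto
  then show ?thesis using eventually_nhds_x_imp_x by (auto simp: S_def)
qed

lemma max_curve_eq:
  assumes "solves_ivp A nabla q X Y I \<gamma>" "t \<in> I"
  shows "t \<in> max_domain A nabla q X Y" "max_curve A nabla q X Y t = \<gamma> t"
proof -
  show "t \<in> max_domain A nabla q X Y" using assms by (auto simp: max_domain_def)
  show "max_curve A nabla q X Y t = \<gamma> t"
    unfolding max_curve_def
  proof (rule the_equality)
    show "\<exists>I' \<gamma>'. solves_ivp A nabla q X Y I' \<gamma>' \<and> t \<in> I' \<and> \<gamma> t = \<gamma>' t" using assms by blast
    fix p assume "\<exists>I' \<gamma>'. solves_ivp A nabla q X Y I' \<gamma>' \<and> t \<in> I' \<and> p = \<gamma>' t"
    then show "p = \<gamma> t" using solution_unique[OF assms(1)] assms(2) by metis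
  qed
qed

text \<open>Under \<open>t \<mapsto> k t\<close> the coefficients are differentiated with a factor \<open>k\<close> and the velocity is multiplied
by \<open>k\<close>, so both terms of a covariant derivative acquire this factor.\<close>

lemma has_covariant_derivative_scale:
  assumes "has_Dt \<gamma> Z (k * s) w"
    and vel: "velocity A (\<lambda>t. \<gamma> (k * t)) s = k *\<^sub>R velocity A \<gamma> (k * s)" and k: "k \<noteq> 0"
  shows "has_Dt (\<lambda>t. \<gamma> (k * t)) (\<lambda>t. m *\<^sub>R Z (k * t)) s ((m * k) *\<^sub>R w)"
proof -
  obtain X and n :: nat and E z where X: "svf X" "X (\<gamma> (k * s)) = velocity A \<gamma> (k * s)"
    and E: "\<And>i. i < n \<Longrightarrow> svf (E i)" and z: "\<And>i. i < n \<Longrightarrow> z i differentiable (at (k * s))"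
    and Z: "\<forall>\<^sub>F r in nhds (k * s). Z r = (\<Sum>i<n. z i r *\<^sub>R E i (\<gamma> r))"
    and w: "w = (\<Sum>i<n. deriv (z i) (k * s) *\<^sub>R E i (\<gamma> (k * s)) + z i (k * s) *\<^sub>R nabla X (E i) (\<gamma> (k * s)))"
    using assms(1) by (rule has_covariant_derivativeE) (rule that)
  have dz: "((\<lambda>t. m * z i (k * t)) has_field_derivative m * k * deriv (z i) (k * s)) (at s)" if "i < n" for i
  proof -
    have "(z i has_field_derivative deriv (z i) (k * s)) (at (k * s))"
      using z[OF that] by (simp add: DERIV_deriv_iff_real_differentiable)
    then have "((\<lambda>t. z i (k * t)) has_field_derivative deriv (z i) (k * s) * k) (at s)"
      by (rule DERIV_chain2) (auto intro!: derivative_eq_intros)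
    then show ?thesis by (auto intro!: derivative_eq_intros)
  qed
  have nX: "nabla (\<lambda>p. k *\<^sub>R X p) (E i) p = k *\<^sub>R nabla X (E i) p" if "i < n" for i p
    using nabla_scale_left[OF smooth_from_const X(1) E[OF that], of k] by metis
  have ev: "\<forall>\<^sub>F t in nhds s. m *\<^sub>R Z (k * t) = (\<Sum>i<n. (m * z i (k * t)) *\<^sub>R E i (\<gamma> (k * t)))"
  proof -
    have "filterlim (\<lambda>t. k * t) (nhds (k * s)) (nhds s)" by (intro tendsto_intros filterlim_ident)
    from eventually_compose_filterlim[OF Z this] show ?thesis
      by eventually_elim (simp add: scaleR_sum_right)
  qed
  show ?thesis
    unfolding has_covariant_derivative_def
  proof (intro exI[of _ "\<lambda>p. k *\<^sub>R X p"] exI[of _ n] exI[of _ E] exI[of _ "\<lambda>i t. m * z i (k * t)"] conjI allI impI)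
    show "svf (\<lambda>p. k *\<^sub>R X p)" by (rule svf_scale_const[OF X(1)])
    show "k *\<^sub>R X (\<gamma> (k * s)) = velocity A (\<lambda>t. \<gamma> (k * t)) s" by (simp add: X vel)
    show "(\<lambda>t. m * z i (k * t)) differentiable (at s)" if "i < n" for i
      using dz[OF that] by (auto simp: real_differentiable_def)
    show "(m * k) *\<^sub>R w = (\<Sum>i<n. deriv (\<lambda>t. m * z i (k * t)) s *\<^sub>R E i (\<gamma> (k * s)) +
        (m * z i (k * s)) *\<^sub>R nabla (\<lambda>p. k *\<^sub>R X p) (E i) (\<gamma> (k * s)))"
      unfolding w scaleR_sum_right
      by (rule sum.cong[OF refl]) (subst DERIV_imp_deriv[OF dz], simp_all add: nX scaleR_add_right mult_ac)
  qed (use E ev in auto)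
qed

lemma solves_ivp_scale:
  assumes s: "solves_ivp A nabla q X Y I \<gamma>" and k: "k \<noteq> 0"
  shows "solves_ivp A nabla q (k *\<^sub>R X) (k\<^sup>2 *\<^sub>R Y) {t. k * t \<in> I} (\<lambda>t. \<gamma> (k * t))"
proof -
  note sD = solves_ivpD[OF s]
  let ?I = "{t. k * t \<in> I}" and ?g = "\<lambda>t. \<gamma> (k * t)"
  have o: "open ?I"
  proof -
    have "open ((\<lambda>t. k * t) -` I)" by (rule continuous_open_vimage[OF sD(1)]) auto
    then show ?thesis by (simp add: vimage_def)
  qed
  have int: "is_interval ?I"
  proof -
    have "convex ((\<lambda>t. k * t) -` I)"
      by (rule convex_linear_vimage) (use sD(2) in \<open>auto simp: is_interval_convex_1 intro!: linearI simp: algebra_simps\<close>)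
    then show ?thesis by (simp add: is_interval_convex_1 vimage_def)
  qed
  have lin: "smooth_on S (\<lambda>t. k * t)" if "open S" for S :: "real set"
    by (rule smooth_on_bounded_linear[OF bounded_linear_mult_right that])
  have into: "smooth_into A ?I ?g"
    unfolding smooth_into_def
  proof (intro conjI ballI)
    show "continuous_on ?I ?g"
      by (rule continuous_on_compose2[of I \<gamma>]) (use sD(4) in \<open>auto simp: smooth_into_def intro!: continuous_intros\<close>)
    fix c assume c: "c \<in> A"
    note sc = smooth_into_coord[OF sD(4,1) c chart_homeomorphism(1)[OF c] order_refl]
    have eq: "{t \<in> ?I. ?g t \<in> fst c} = (\<lambda>t. k * t) -` {r \<in> I. \<gamma> r \<in> fst c}" by auto
    have o': "open {t \<in> ?I. ?g t \<in> fst c}"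
      unfolding eq by (intro continuous_open_vimage sc(1)) auto
    have "smooth_on {t \<in> ?I. ?g t \<in> fst c} (\<lambda>t. (snd c \<circ> \<gamma>) (k * t))"
      by (rule smooth_on_compose[OF o' sc(1) sc(2) lin[OF o']]) auto
    then show "smooth_on {t \<in> ?I. ?g t \<in> fst c} (snd c \<circ> ?g)" by (simp add: comp_def)
  qed
  have vel: "velocity A ?g t = k *\<^sub>R velocity A \<gamma> (k * t)" if "t \<in> ?I" for t
  proof -
    let ?d = "chart_at A (\<gamma> (k * t))"
    note sc = smooth_into_coord[OF sD(4,1) chart_at(1)[of "\<gamma> (k * t)"] chart_homeomorphism(1)[OF chart_at(1)] order_refl]
    have "(snd ?d \<circ> \<gamma> has_vector_derivative frechet_derivative (snd ?d \<circ> \<gamma>) (at (k * t)) 1) (at (k * t))"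
      by (rule smooth_on_vector_derivative[OF sc(2,1)]) (use that chart_at(2)[of "\<gamma> (k * t)"] in auto)
    then have d: "(snd ?d \<circ> \<gamma> has_vector_derivative velocity A \<gamma> (k * t)) (at (k * t))"
      unfolding velocity_def by (simp add: vector_derivative_at)
    have "((\<lambda>t. k * t) has_vector_derivative k) (at t)"
      by (auto intro!: derivative_eq_intros simp: has_vector_derivative_def)
    from has_vector_derivative_compose_at[OF this d[unfolded has_vector_derivative_def]]
    have "(snd ?d \<circ> ?g has_vector_derivative k *\<^sub>R velocity A \<gamma> (k * t)) (at t)" by (simp add: comp_def)
    then show ?thesis unfolding velocity_def[of A ?g] by (rule vector_derivative_at)
  qed
  have ev: "\<forall>\<^sub>F r in nhds t. r \<in> ?I" if "t \<in> ?I" for t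
    using o that by (rule eventually_nhds_in_open)
  let ?acc = "accel \<gamma>"
  have acc: "accel ?g t = k\<^sup>2 *\<^sub>R ?acc (k * t)" if t: "t \<in> ?I" for t
  proof -
    obtain c W \<Gamma> where W: "\<gamma> (k * t) \<in> W" "christoffel c W \<Gamma>"
      using christoffel_exists[OF chart_at] by metis
    have "has_Dt \<gamma> (velocity A \<gamma>) (k * t) (?acc (k * t))"
      using curve_coords(7)[OF W(2) sD(1,4) refl refl refl refl] t W(1) by simp
    from has_covariant_derivative_scale[OF this vel[OF t] k, of k]
    have "has_Dt ?g (\<lambda>r. k *\<^sub>R velocity A \<gamma> (k * r)) t (k\<^sup>2 *\<^sub>R ?acc (k * t))"
      by (simp add: power2_eq_square)
    then have "has_Dt ?g (velocity A ?g) t (k\<^sup>2 *\<^sub>R ?acc (k * t))"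
      by (rule has_covariant_derivative_germ) (auto intro: eventually_mono[OF ev[OF t]] simp: vel)
    then show ?thesis
      using curve_coords(7)[OF W(2) o into refl refl refl refl, of t] t W(1) by simp
  qed
  have third: "jerk ?g t = 0" if t: "t \<in> ?I" for t
  proof -
    obtain c W \<Gamma> where W: "\<gamma> (k * t) \<in> W" "christoffel c W \<Gamma>"
      using christoffel_exists[OF chart_at] by metis
    have "has_Dt \<gamma> ?acc (k * t) 0"
      using curve_coords(8)[OF W(2) sD(1,4) refl refl refl refl, of "k * t" 0] t W(1) sD(8)[of "k * t"] by simp
    from has_covariant_derivative_scale[OF this vel[OF t] k, of "k\<^sup>2"]
    have "has_Dt ?g (\<lambda>r. k\<^sup>2 *\<^sub>R ?acc (k * r)) t 0" by simp
    then have "has_Dt ?g (accel ?g) t 0"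
      by (rule has_covariant_derivative_germ) (auto intro: eventually_mono[OF ev[OF t]] simp: acc)
    then show ?thesis
      using curve_coords(8)[OF W(2) o into refl refl refl refl, of t 0] t W(1) by simp
  qed
  show ?thesis
    unfolding solves_ivp_def using o int into third acc[of 0] vel[of 0] sD by auto
qed

text \<open>Reparametrization by \<open>k\<close> and by \<open>1/k\<close> puts the solutions of the two problems in correspondence.\<close>

lemma max_curve_scale:
  assumes k: "k \<noteq> 0"
  shows "1 \<in> max_domain A nabla q (k *\<^sub>R X) (k\<^sup>2 *\<^sub>R Y) \<longleftrightarrow> k \<in> max_domain A nabla q X Y"
    and "max_curve A nabla q (k *\<^sub>R X) (k\<^sup>2 *\<^sub>R Y) 1 = max_curve A nabla q X Y k"
proof -
  have "(\<exists>I \<gamma>. solves_ivp A nabla q (k *\<^sub>R X) (k\<^sup>2 *\<^sub>R Y) I \<gamma> \<and> 1 \<in> I \<and> p = \<gamma> 1) \<longleftrightarrow>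
        (\<exists>I \<gamma>. solves_ivp A nabla q X Y I \<gamma> \<and> k \<in> I \<and> p = \<gamma> k)" for p
  proof
    assume "\<exists>I \<gamma>. solves_ivp A nabla q (k *\<^sub>R X) (k\<^sup>2 *\<^sub>R Y) I \<gamma> \<and> 1 \<in> I \<and> p = \<gamma> 1"
    then obtain I \<gamma> where 1: "solves_ivp A nabla q (k *\<^sub>R X) (k\<^sup>2 *\<^sub>R Y) I \<gamma>" "1 \<in> I" "p = \<gamma> 1" by blast
    \<comment> \<open>Rescaling by \<open>1 / k\<close> restores the data \<open>(X, Y)\<close>.\<close>
    from solves_ivp_scale[OF this(1), of "1 / k"]
    have "solves_ivp A nabla q X Y {t. 1 / k * t \<in> I} (\<lambda>t. \<gamma> (1 / k * t))"
      using k by (simp add: power_divide)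
    moreover have "k \<in> {t. 1 / k * t \<in> I}" "p = \<gamma> (1 / k * k)" using 1 k by auto
    ultimately show "\<exists>I \<gamma>. solves_ivp A nabla q X Y I \<gamma> \<and> k \<in> I \<and> p = \<gamma> k" by blast
  next
    assume "\<exists>I \<gamma>. solves_ivp A nabla q X Y I \<gamma> \<and> k \<in> I \<and> p = \<gamma> k"
    then obtain I \<gamma> where 1: "solves_ivp A nabla q X Y I \<gamma>" "k \<in> I" "p = \<gamma> k" by blast
    from solves_ivp_scale[OF this(1) k]
    show "\<exists>I \<gamma>. solves_ivp A nabla q (k *\<^sub>R X) (k\<^sup>2 *\<^sub>R Y) I \<gamma> \<and> 1 \<in> I \<and> p = \<gamma> 1"
      using 1 by (intro exI[of _ "{t. k * t \<in> I}"] exI[of _ "\<lambda>t. \<gamma> (k * t)"]) auto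
  qed
  note eq = this
  show "max_curve A nabla q (k *\<^sub>R X) (k\<^sup>2 *\<^sub>R Y) 1 = max_curve A nabla q X Y k"
    unfolding max_curve_def eq ..
  show "1 \<in> max_domain A nabla q (k *\<^sub>R X) (k\<^sup>2 *\<^sub>R Y) \<longleftrightarrow> k \<in> max_domain A nabla q X Y"
    using eq unfolding max_domain_def by blast
qed

end

section \<open>The map \<open>\<Psi>\<close> near the origin\<close>

lemma has_vector_derivative_zero_on_interval:
  fixes h :: "real \<Rightarrow> 'a::real_normed_vector"
  assumes "\<And>t. \<bar>t\<bar> < \<tau> \<Longrightarrow> (h has_vector_derivative 0) (at t)" "\<bar>s\<bar> < \<tau>"
  shows "h s = h 0"
proof -
  have "norm (h s - h 0) \<le> 0 * norm (s - 0)"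
  proof (rule differentiable_bound[of "{-\<tau><..<\<tau>}" h "\<lambda>t x. 0"])
    fix t assume "t \<in> {-\<tau><..<\<tau>}"
    then have "(h has_vector_derivative 0) (at t)" by (intro assms(1)) auto
    then show "(h has_derivative (\<lambda>x. 0)) (at t within {-\<tau><..<\<tau>})"
      unfolding has_vector_derivative_def by (simp add: has_derivative_at_withinI)
  qed (use assms(2) in \<open>auto simp: onorm_zero\<close>)
  then show ?thesis by simp
qed

context connection_mfd
begin

text \<open>The Christoffel terms of the system are quadratic in velocity and acceleration, so they do not
contribute to the linearization at rest.\<close>

lemma christoffel_quadratic_derivative:
  assumes ch: "christoffel c W \<Gamma>" and x0: "x0 \<in> snd c ` W"
    and pq: "bounded_linear P" "bounded_linear Q" "P (x0, 0, 0) = 0" "Q (x0, 0, 0) = 0"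
  shows "((\<lambda>z::'e \<times> 'e \<times> 'e. \<Gamma> (fst z) (P z) (Q z)) has_derivative (\<lambda>h. 0)) (at (x0, 0, 0))"
proof -
  note chD = christoffelD[OF ch]
  let ?z = "(x0, 0, 0) :: 'e \<times> 'e \<times> 'e"
  have o: "open (snd c ` W)" by (rule open_chart_image[OF chD(1-3)])
  have "((\<lambda>z. (P z \<bullet> i) *\<^sub>R (Q z \<bullet> j) *\<^sub>R \<Gamma> (fst z) i j) has_derivative (\<lambda>h. 0)) (at ?z)" for i j
  proof -
    have "(\<Gamma>' has_derivative frechet_derivative \<Gamma>' (at x0)) (at x0)" if "\<Gamma>' = (\<lambda>x. \<Gamma> x i j)" for \<Gamma>'
      unfolding that by (rule smooth_on_has_derivative[OF chD(4) o x0])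
    from this[OF refl] have "((\<lambda>x. \<Gamma> x i j) has_derivative frechet_derivative (\<lambda>x. \<Gamma> x i j) (at x0)) (at (fst ?z))"
      by simp
    from has_derivative_compose[OF bounded_linear_imp_has_derivative[OF bounded_linear_fst] this]
    have 1: "((\<lambda>z. \<Gamma> (fst z) i j) has_derivative (\<lambda>h. frechet_derivative (\<lambda>x. \<Gamma> x i j) (at x0) (fst h))) (at ?z)" .
    have 2: "((\<lambda>z. Q z \<bullet> j) has_derivative (\<lambda>h. Q h \<bullet> j)) (at ?z)"
      by (intro has_derivative_inner_left bounded_linear_imp_has_derivative pq)
    have 3: "((\<lambda>z. (Q z \<bullet> j) *\<^sub>R \<Gamma> (fst z) i j) has_derivative
        (\<lambda>h. (Q ?z \<bullet> j) *\<^sub>R frechet_derivative (\<lambda>x. \<Gamma> x i j) (at x0) (fst h) + (Q h \<bullet> j) *\<^sub>R \<Gamma> (fst ?z) i j)) (at ?z)"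
      by (rule has_derivative_scaleR[OF 2 1])
    have "isCont (\<lambda>z. P z \<bullet> i) ?z"
      using linear_continuous_at[OF pq(1)] by (intro continuous_intros)
    from has_derivative_bilinear_vanishing[OF bounded_bilinear_scaleR this 3]
    show ?thesis by (simp add: pq)
  qed
  then have "((\<lambda>z. \<Sum>i\<in>Basis. \<Sum>j\<in>Basis. (P z \<bullet> i) *\<^sub>R (Q z \<bullet> j) *\<^sub>R \<Gamma> (fst z) i j) has_derivative
      (\<lambda>h. \<Sum>i\<in>(Basis :: 'e set). \<Sum>j\<in>(Basis :: 'e set). 0)) (at ?z)"
    by (intro has_derivative_sum)
  then show ?thesis
    unfolding christoffel_expansion[OF ch, of "fst _" "P _" "Q _"] by simp
qed

lemma jet_field_derivative_at_rest:
  assumes ch: "christoffel c W \<Gamma>" and x0: "x0 \<in> snd c ` W"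
  shows "(jet_field \<Gamma> has_derivative (\<lambda>h. (fst (snd h), snd (snd h), 0))) (at (x0, 0, 0))"
proof -
  have P: "bounded_linear (\<lambda>z :: 'e \<times> 'e \<times> 'e. fst (snd z))" "bounded_linear (\<lambda>z :: 'e \<times> 'e \<times> 'e. snd (snd z))"
    by (intro bounded_linear_compose[OF bounded_linear_fst] bounded_linear_compose[OF bounded_linear_snd] bounded_linear_snd)+
  have "((\<lambda>z. (fst (snd z), snd (snd z) - \<Gamma> (fst z) (fst (snd z)) (fst (snd z)),
      - \<Gamma> (fst z) (fst (snd z)) (snd (snd z)))) has_derivative
    (\<lambda>h. (fst (snd h), snd (snd h) - 0, - 0))) (at (x0, 0, 0))"
    by (intro has_derivative_Pair has_derivative_diff has_derivative_minus bounded_linear_imp_has_derivative P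
       christoffel_quadratic_derivative[OF ch x0]) auto
  then show ?thesis by (simp add: jet_field_def[abs_def])
qed

text \<open>For small data, \<open>f (X, Y)\<close> is the position at a fixed time \<open>\<epsilon>\<close> in the chart selected at \<open>q\<close>.  In this
chart tangent vectors at \<open>q\<close> are their own coordinates, so that \<open>(X, Y)\<close> is the initial value of
\<open>(v, a)\<close>.  The derivative of \<open>f\<close> is found by solving the linearized system \<open>(\<xi>, \<eta>, \<zeta>)' = (\<eta>, \<zeta>, 0)\<close>.\<close>

lemma local_solutions:
  fixes q :: 'm
  defines "c \<equiv> chart_at A q"
  obtains \<epsilon> r and f :: "'e \<times> 'e \<Rightarrow> 'e" where "\<epsilon> > 0" "r > 0" "smooth_on UNIV f" "f 0 = snd c q"
    "(f has_derivative (\<lambda>w. \<epsilon> *\<^sub>R fst w + (\<epsilon>\<^sup>2 / 2) *\<^sub>R snd w)) (at 0)"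
    "\<And>X Y. (X, Y) \<in> ball 0 r \<Longrightarrow> f (X, Y) \<in> snd c ` fst c \<and>
       (\<exists>I \<gamma>. solves_ivp A nabla q X Y I \<gamma> \<and> \<epsilon> \<in> I \<and> \<gamma> \<epsilon> = chart_inv c (f (X, Y)))"
proof -
  have c: "c \<in> A" "q \<in> fst c" by (simp_all add: c_def chart_at)
  obtain W \<Gamma> where W: "q \<in> W" and ch: "christoffel c W \<Gamma>"
    using christoffel_exists[OF c] by metis
  note chD = christoffelD[OF ch]
  define x0 where "x0 = snd c q"
  define z0 where "z0 = (x0, 0 :: 'e, 0 :: 'e)"
  have x0: "x0 \<in> snd c ` W" using W by (simp add: x0_def)
  have z0: "z0 \<in> snd c ` W \<times> UNIV" using x0 by (simp add: z0_def)
  obtain r G R where G: "r > 0" "ball z0 r \<subseteq> snd c ` W \<times> UNIV" "smooth_on UNIV G"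
    "\<And>z. z \<in> ball z0 r \<Longrightarrow> G z = jet_field \<Gamma> z" "\<And>z. z \<notin> cball z0 R \<Longrightarrow> G z = 0"
    by (rule smooth_cutoff[OF smooth_on_jet_field(1)[OF ch] z0 smooth_on_jet_field(2)[OF ch]]) (rule that)
  have csG: "cs_smooth G" unfolding cs_smooth_def using G(3,5) by blast
  have Gz0: "G z0 = 0"
    using G(1) G(4)[of z0] by (simp add: jet_field_def z0_def linear_0[OF chD(6)] zero_prod_def)
  have dG: "frechet_derivative G (at z0) = (\<lambda>h. (fst (snd h), snd (snd h), 0))"
  proof -
    have "(G has_derivative (\<lambda>h. (fst (snd h), snd (snd h), 0))) (at z0)"
      by (rule has_derivative_transform_within_open[OF jet_field_derivative_at_rest[OF ch x0, folded z0_def] open_ball[of z0 r]])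
         (use G in auto)
    then show ?thesis by (rule frechet_derivative_at[symmetric])
  qed
  obtain \<tau> u where \<tau>: "\<tau> > 0"
    and u: "\<And>t. smooth_on UNIV (\<lambda>z. u z t)" "\<And>z. u z 0 = z"
    "\<And>z t. \<bar>t\<bar> < \<tau> \<Longrightarrow> (u z has_vector_derivative G (u z t)) (at t)"
    "\<And>z y t. norm (u z t - u y t) \<le> 2 * norm (z - y)"
    "\<And>z. G z = 0 \<Longrightarrow> u z = (\<lambda>t. z)"
    "\<And>z v. \<exists>W. W 0 = v \<and> (\<forall>t. W t = frechet_derivative (\<lambda>z. u z t) (at z) v) \<and>
       (\<forall>t. \<bar>t\<bar> < \<tau> \<longrightarrow> (W has_vector_derivative frechet_derivative G (at (u z t)) (W t)) (at t))"
    by (rule flow_exists[OF csG]) (rule that)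
  define \<epsilon> where "\<epsilon> = \<tau> / 2"
  have \<epsilon>: "\<epsilon> > 0" "\<bar>\<epsilon>\<bar> < \<tau>" using \<tau> by (auto simp: \<epsilon>_def)
  define f where "f w = fst (u (x0, w) \<epsilon>)" for w
  have uz0: "u z0 = (\<lambda>t. z0)" by (rule u(5)[OF Gz0])
  have affine: "(\<lambda>w. (x0, w)) = (\<lambda>w. z0 + (0, w))" by (auto simp: z0_def)
  have bl: "bounded_linear (\<lambda>w :: 'e \<times> 'e. (0 :: 'e, w))"
    by (intro bounded_linear_Pair bounded_linear_zero bounded_linear_ident)
  have "smooth_on UNIV f"
  proof -
    have "smooth_on UNIV (\<lambda>w. z0 + (0 :: 'e, w))"
      by (intro smooth_on_add smooth_on_const smooth_on_bounded_linear bl open_UNIV)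
    then have "smooth_on UNIV (\<lambda>w. u (x0, w) \<epsilon>)"
      unfolding affine[symmetric]
      using smooth_on_compose[OF open_UNIV open_UNIV u(1)[of \<epsilon>], of "\<lambda>w. (x0, w)"] by simp
    then show ?thesis unfolding f_def[abs_def]
      by (rule smooth_on_bounded_linear_compose[OF bounded_linear_fst open_UNIV])
  qed
  moreover have "f 0 = snd c q"
    using uz0 by (simp add: f_def z0_def x0_def zero_prod_def)
  moreover have "(f has_derivative (\<lambda>w. \<epsilon> *\<^sub>R fst w + (\<epsilon>\<^sup>2 / 2) *\<^sub>R snd w)) (at 0)"
  proof -
    have d1: "((\<lambda>w. (x0, w)) has_derivative (\<lambda>w. (0 :: 'e, w))) (at 0)"
      by (intro has_derivative_Pair has_derivative_const has_derivative_ident)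
    have "((\<lambda>z. u z \<epsilon>) has_derivative frechet_derivative (\<lambda>z. u z \<epsilon>) (at z0)) (at (x0, 0))"
      using smooth_on_has_derivative[OF u(1) open_UNIV, of z0 \<epsilon>] by (simp add: z0_def zero_prod_def)
    from bounded_linear.has_derivative[OF bounded_linear_fst has_derivative_compose[OF d1 this]]
    have "(f has_derivative (\<lambda>w. fst (frechet_derivative (\<lambda>z. u z \<epsilon>) (at z0) (0, w)))) (at 0)"
      by (simp add: f_def[abs_def])
    moreover have "fst (frechet_derivative (\<lambda>z. u z \<epsilon>) (at z0) (0, w)) = \<epsilon> *\<^sub>R fst w + (\<epsilon>\<^sup>2 / 2) *\<^sub>R snd w" for w
    proof -
      obtain \<omega> where \<omega>: "\<omega> 0 = (0, w)" "\<And>t. \<omega> t = frechet_derivative (\<lambda>z. u z t) (at z0) (0, w)"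
        "\<And>t. \<bar>t\<bar> < \<tau> \<Longrightarrow> (\<omega> has_vector_derivative frechet_derivative G (at (u z0 t)) (\<omega> t)) (at t)"
        using u(6)[of "(0, w)" z0] by blast
      have d: "(\<omega> has_vector_derivative (fst (snd (\<omega> t)), snd (snd (\<omega> t)), 0)) (at t)" if "\<bar>t\<bar> < \<tau>" for t
        using \<omega>(3)[OF that] by (simp add: uz0 dG)
      have d1: "((\<lambda>t. fst (\<omega> t)) has_vector_derivative fst (snd (\<omega> t))) (at t)"
        and d2: "((\<lambda>t. fst (snd (\<omega> t))) has_vector_derivative snd (snd (\<omega> t))) (at t)"
        and d3: "((\<lambda>t. snd (snd (\<omega> t))) has_vector_derivative 0) (at t)" if "\<bar>t\<bar> < \<tau>" for t
        using bounded_linear.has_vector_derivative[OF bounded_linear_fst d[OF that]]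
          bounded_linear.has_vector_derivative[OF bounded_linear_compose[OF bounded_linear_fst bounded_linear_snd] d[OF that]]
          bounded_linear.has_vector_derivative[OF bounded_linear_compose[OF bounded_linear_snd bounded_linear_snd] d[OF that]]
        by simp_all
      \<comment> \<open>The linearized system is integrated from the last component upwards.\<close>
      have e3: "snd (snd (\<omega> t)) = snd w" if "\<bar>t\<bar> < \<tau>" for t
        using has_vector_derivative_zero_on_interval[OF d3 that] \<omega>(1) by simp
      have "((\<lambda>t. fst (snd (\<omega> t)) - t *\<^sub>R snd w) has_vector_derivative (snd w - snd w)) (at t)" if "\<bar>t\<bar> < \<tau>" for t
        using d2[OF that] unfolding e3[OF that]
        by (intro has_vector_derivative_diff) (auto intro!: derivative_eq_intros simp: has_vector_derivative_def)
      from has_vector_derivative_zero_on_interval[of \<tau> "\<lambda>t. fst (snd (\<omega> t)) - t *\<^sub>R snd w", OF this[simplified]]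
      have e2: "fst (snd (\<omega> t)) = fst w + t *\<^sub>R snd w" if "\<bar>t\<bar> < \<tau>" for t
        using that \<omega>(1) by (simp add: algebra_simps)
      have "((\<lambda>t. fst (\<omega> t) - (t *\<^sub>R fst w + (t\<^sup>2 / 2) *\<^sub>R snd w)) has_vector_derivative
          ((fst w + t *\<^sub>R snd w) - (fst w + t *\<^sub>R snd w))) (at t)" if "\<bar>t\<bar> < \<tau>" for t
        using d1[OF that] unfolding e2[OF that]
        by (intro has_vector_derivative_diff)
           (auto intro!: derivative_eq_intros simp: has_vector_derivative_def algebra_simps)
      from has_vector_derivative_zero_on_interval[of \<tau> "\<lambda>t. fst (\<omega> t) - (t *\<^sub>R fst w + (t\<^sup>2 / 2) *\<^sub>R snd w)", OF this[simplified] \<epsilon>(2)]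
      show ?thesis using \<omega>(1,2) by simp
    qed
    ultimately show ?thesis by simp
  qed
  moreover have "f (X, Y) \<in> snd c ` fst c \<and>
       (\<exists>I \<gamma>. solves_ivp A nabla q X Y I \<gamma> \<and> \<epsilon> \<in> I \<and> \<gamma> \<epsilon> = chart_inv c (f (X, Y)))"
    if XY: "(X, Y) \<in> ball 0 (r / 2)" for X Y
  proof -
    let ?z = "(x0, X, Y)" and ?I = "{-\<tau><..<\<tau>}"
    have "norm (?z - z0) = norm (X, Y)" by (simp add: z0_def norm_Pair)
    then have "norm (?z - z0) < r / 2" using XY by simp
    \<comment> \<open>The flow is 2-Lipschitz in the initial value and fixes \<open>z0\<close>, so the solution stays where the cutoff
has not changed the system.\<close>
    then have near: "u ?z t \<in> ball z0 r" for t
      using u(4)[of ?z t z0] by (simp add: uz0 dist_norm norm_minus_commute)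
    have z: "(u ?z has_vector_derivative jet_field \<Gamma> (u ?z t)) (at t)" if "t \<in> ?I" for t
      using u(3)[of t ?z] that G(4)[OF near] by (simp add: abs_less_iff)
    have zW: "fst (u ?z t) \<in> snd c ` W" for t
      using subsetD[OF G(2) near[of t]] unfolding mem_Times_iff by (rule conjunct1)
    define \<gamma> where "\<gamma> t = chart_inv c (fst (u ?z t))" for t
    note cj = curve_from_jet[where I = ?I, OF ch open_greaterThanLessThan z zW, folded \<gamma>_def[abs_def]]
    have g0: "\<gamma> 0 = q" by (simp add: \<gamma>_def u(2) x0_def chart_inv_apply c)
    have "jet c \<gamma> 0 = ?z" using cj(2)[of 0] \<tau> u(2) by simp
    then have "velocity A \<gamma> 0 = X" "accel \<gamma> 0 = Y"
      by (simp_all add: jet_def g0 c_def coord_chart_at)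
    then have "solves_ivp A nabla q X Y ?I \<gamma>"
      unfolding solves_ivp_def using cj(1,3) g0 \<tau> by (auto simp: is_interval_oo)
    moreover have "\<epsilon> \<in> ?I" using \<epsilon> by auto
    moreover have "\<gamma> \<epsilon> = chart_inv c (f (X, Y))" by (simp add: \<gamma>_def f_def)
    moreover have "f (X, Y) \<in> snd c ` fst c" using zW[of \<epsilon>] chD(3) by (auto simp: f_def)
    ultimately show ?thesis by blast
  qed
  ultimately show thesis using that[of \<epsilon> "r / 2" f] \<epsilon>(1) G(1) by auto
qed

end

lemma component_add:
  assumes "subspace S" "subspace T" "S \<inter> T = {0}" "x \<in> S" "y \<in> T"
  shows "component S T (x + y) = x"
  unfolding component_def
proof (rule the_equality)
  show "x \<in> S \<and> x + y - x \<in> T" using assms by simp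
  fix x' assume x': "x' \<in> S \<and> x + y - x' \<in> T"
  then have "x - x' \<in> S" using assms subspace_diff by blast
  moreover have "(x + y - x') - y \<in> T" using x' assms subspace_diff by blast
  then have "x - x' \<in> T" by (simp add: algebra_simps)
  ultimately show "x' = x" using assms(3) by (metis Int_iff right_minus_eq singletonD)
qed

locale splitting =
  fixes S T :: "'e::euclidean_space set"
  assumes subspace: "subspace S" "subspace T" and trivial: "S \<inter> T = {0}" and total: "\<And>u. \<exists>x\<in>S. \<exists>y\<in>T. u = x + y"
begin

lemma component_sum: "x \<in> S \<Longrightarrow> y \<in> T \<Longrightarrow> component S T (x + y) = x"
  "x \<in> S \<Longrightarrow> y \<in> T \<Longrightarrow> component T S (x + y) = y"
  using component_add[OF subspace trivial, of x y] component_add[OF subspace(2,1), of y x] trivial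
  by (auto simp: Int_commute add.commute)

lemma component_decomp: "component S T u \<in> S" "component T S u \<in> T" "component S T u + component T S u = u"
  using total[of u] component_sum by auto

lemma linear_component: "linear (component S T)"
proof (rule linearI)
  fix u v :: 'e and r :: real
  have "component S T ((component S T u + component S T v) + (component T S u + component T S v)) = component S T u + component S T v"
    by (intro component_sum subspace_add subspace component_decomp)
  moreover have "(component S T u + component S T v) + (component T S u + component T S v) = u + v"
    using component_decomp(3)[of u] component_decomp(3)[of v] by (metis add.assoc add.left_commute)
  ultimately show "component S T (u + v) = component S T u + component S T v" by simp
  have "component S T (r *\<^sub>R component S T u + r *\<^sub>R component T S u) = r *\<^sub>R component S T u"
    by (intro component_sum subspace_scale subspace component_decomp)
  then show "component S T (r *\<^sub>R u) = r *\<^sub>R component S T u"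
    by (simp add: scaleR_add_right[symmetric] component_decomp(3))
qed

lemma splitting_swap: "splitting T S"
  by unfold_locales (use subspace trivial total in \<open>auto simp: Int_commute\<close>, metis add.commute)

lemma bounded_linear_component: "bounded_linear (component S T)" "bounded_linear (component T S)"
  using linear_component splitting.linear_component[OF splitting_swap] by (simp_all add: linear_conv_bounded_linear)

end

lemma distribution_splitting:
  assumes "distribution A H" "distribution A V" "direct_sum_decomposition H V"
  shows "splitting (H q) (V q)"
proof
  have *: "subspace (D q)" if D: "distribution A D" for D
  proof -
    obtain B where "D q = span B" using D unfolding distribution_def by blast
    then show ?thesis by (simp add: subspace_span)
  qed
  show "subspace (H q)" by (rule *[OF assms(1)])
  show "subspace (V q)" by (rule *[OF assms(2)])
  show "H q \<inter> V q = {0}" using assms(3) by (simp add: direct_sum_decomposition_def)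
  show "\<exists>x\<in>H q. \<exists>y\<in>V q. u = x + y" for u
  proof -
    have "u \<in> {X + Y | X Y. X \<in> H q \<and> Y \<in> V q}" using assms(3) by (simp add: direct_sum_decomposition_def)
    then show ?thesis by blast
  qed
qed

context connection_mfd
begin

text \<open>By scaling, \<open>\<Psi>(u)\<close> has the coordinates \<open>\<phi>(u) = f (u\<^sub>H / \<epsilon>, u\<^sub>V / \<epsilon>\<^sup>2)\<close>, where \<open>u\<^sub>H\<close> and \<open>u\<^sub>V\<close> are the
components of \<open>u\<close>.  The factors cancel in the derivative of \<open>\<phi>\<close> at \<open>0\<close>, which is \<open>u\<^sub>H + u\<^sub>V / 2\<close>.\<close>

lemma Psi_local_diffeomorphism:
  assumes "splitting (H q) (V q)"
  obtains N W where "open N" "0 \<in> N" "open W" "q \<in> W" "N \<subseteq> Psi_domain A nabla H V q"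
    "diffeomorphism_into A N W (Psi A nabla H V q)" "Psi A nabla H V q 0 = q"
proof -
  interpret splitting "H q" "V q" by fact
  define c where "c = chart_at A q"
  have c: "c \<in> A" "q \<in> fst c" by (simp_all add: c_def chart_at)
  obtain \<epsilon> r and f :: "'e \<times> 'e \<Rightarrow> 'e" where f: "\<epsilon> > 0" "r > 0" "smooth_on UNIV f" "f 0 = snd c q"
    "(f has_derivative (\<lambda>w. \<epsilon> *\<^sub>R fst w + (\<epsilon>\<^sup>2 / 2) *\<^sub>R snd w)) (at 0)"
    "\<And>X Y. (X, Y) \<in> ball 0 r \<Longrightarrow> f (X, Y) \<in> snd c ` fst c \<and>
       (\<exists>I \<gamma>. solves_ivp A nabla q X Y I \<gamma> \<and> \<epsilon> \<in> I \<and> \<gamma> \<epsilon> = chart_inv c (f (X, Y)))"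
    by (rule local_solutions[of q, folded c_def]) (rule that)
  let ?h = "component (H q) (V q)" and ?v = "component (V q) (H q)"
  define s where "s u = ((1 / \<epsilon>) *\<^sub>R ?h u, (1 / \<epsilon>\<^sup>2) *\<^sub>R ?v u)" for u
  have s: "bounded_linear s"
    unfolding s_def by (intro bounded_linear_Pair bounded_linear_scaleR_right[THEN bounded_linear_compose] bounded_linear_component)
  define U where "U = s -` ball 0 r"
  have U: "open U" unfolding U_def
    by (rule continuous_open_vimage[OF open_ball]) (rule linear_continuous_at[OF s])
  have s0: "s 0 = 0" using linear_0[OF bounded_linear.linear[OF s]] .
  have U0: "0 \<in> U" using f(2) s0 by (simp add: U_def)
  define \<phi> where "\<phi> u = f (s u)" for u
  have \<phi>: "smooth_on UNIV \<phi>"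
    unfolding \<phi>_def by (intro smooth_on_compose[OF open_UNIV open_UNIV f(3)] smooth_on_bounded_linear s open_UNIV) auto
  have \<phi>0: "\<phi> 0 = snd c q" by (simp add: \<phi>_def s0 f(4))
  have d\<phi>: "(\<phi> has_derivative (\<lambda>u. ?h u + (1 / 2) *\<^sub>R ?v u)) (at 0)"
  proof -
    have "(f has_derivative (\<lambda>w. \<epsilon> *\<^sub>R fst w + (\<epsilon>\<^sup>2 / 2) *\<^sub>R snd w)) (at (s 0))" using f(5) by (simp add: s0)
    from has_derivative_compose[OF bounded_linear_imp_has_derivative[OF s] this]
    show ?thesis using f(1) by (simp add: \<phi>_def[abs_def] s_def)
  qed
  have k: "bounded_linear (\<lambda>u. ?h u + 2 *\<^sub>R ?v u)"
    by (intro bounded_linear_add bounded_linear_scaleR_right[THEN bounded_linear_compose] bounded_linear_component)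
  \<comment> \<open>The inverse of \<open>u\<^sub>H + u\<^sub>V / 2\<close> is \<open>u\<^sub>H + 2 u\<^sub>V\<close>.\<close>
  have kd: "?h (?h u + (1 / 2) *\<^sub>R ?v u) + 2 *\<^sub>R ?v (?h u + (1 / 2) *\<^sub>R ?v u) = u" for u
    using component_sum[OF component_decomp(1) subspace_scale[OF subspace(2) component_decomp(2), of "1/2"], of u u]
      component_decomp(3)[of u] by simp
  obtain N V' g where g: "open N" "N \<subseteq> U" "0 \<in> N" "open V'" "homeomorphism N V' \<phi> g" "smooth_on V' g"
    by (rule smooth_inverse_function[OF U smooth_on_subset[OF \<phi> open_UNIV U subset_UNIV] U0 d\<phi> k kd]) (rule that)
  have \<phi>U: "\<phi> u \<in> snd c ` fst c" and sol: "\<exists>I \<gamma>. solves_ivp A nabla q ((1 / \<epsilon>) *\<^sub>R ?h u) ((1 / \<epsilon>\<^sup>2) *\<^sub>R ?v u) I \<gamma> \<and> \<epsilon> \<in> I \<and> \<gamma> \<epsilon> = chart_inv c (\<phi> u)"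
    if "u \<in> U" for u
    using f(6)[of "(1 / \<epsilon>) *\<^sub>R ?h u" "(1 / \<epsilon>\<^sup>2) *\<^sub>R ?v u"] that by (auto simp: U_def \<phi>_def s_def)
  have Psi: "u \<in> Psi_domain A nabla H V q \<and> Psi A nabla H V q u = chart_inv c (\<phi> u)" if u: "u \<in> U" for u
  proof -
    obtain I \<gamma> where 1: "solves_ivp A nabla q ((1 / \<epsilon>) *\<^sub>R ?h u) ((1 / \<epsilon>\<^sup>2) *\<^sub>R ?v u) I \<gamma>" "\<epsilon> \<in> I" "\<gamma> \<epsilon> = chart_inv c (\<phi> u)"
      using sol[OF u] by blast
    have "\<epsilon> *\<^sub>R (1 / \<epsilon>) *\<^sub>R ?h u = ?h u" "\<epsilon>\<^sup>2 *\<^sub>R (1 / \<epsilon>\<^sup>2) *\<^sub>R ?v u = ?v u" using f(1) by simp_all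
    then show ?thesis
      using max_curve_scale[of \<epsilon> q "(1 / \<epsilon>) *\<^sub>R ?h u" "(1 / \<epsilon>\<^sup>2) *\<^sub>R ?v u"] max_curve_eq[OF 1(1,2)] 1(3) f(1)
      by (simp add: Psi_domain_def Psi_def)
  qed
  have V'sub: "V' \<subseteq> snd c ` fst c"
    using \<phi>U g(2) homeomorphism_image1[OF g(5)] by blast
  define W where "W = snd c -` V' \<inter> fst c"
  have W: "open W"
    unfolding W_def using continuous_on_open_vimage[OF chart_homeomorphism(1)[OF c(1)]] continuous_chart[OF c(1)] g(4) by blast
  have imW: "snd c ` W = V'" using V'sub by (auto simp: W_def)
  have N: "Psi A nabla H V q u = chart_inv c (\<phi> u)" "\<phi> u \<in> V'" if "u \<in> N" for u
    using Psi g(2) that homeomorphism_image1[OF g(5)] by auto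
  have bij: "bij_betw (Psi A nabla H V q) N W"
  proof (rule bij_betw_byWitness[of _ "\<lambda>p. g (snd c p)"])
    show "\<forall>u\<in>N. g (snd c (Psi A nabla H V q u)) = u"
    proof
      fix u assume u: "u \<in> N"
      then have "\<phi> u \<in> snd c ` fst c" using N(2) V'sub by blast
      then show "g (snd c (Psi A nabla H V q u)) = u"
        using N(1)[OF u] apply_chart_inv[OF c(1)] homeomorphism_apply1[OF g(5) u] by simp
    qed
    show "\<forall>p\<in>W. Psi A nabla H V q (g (snd c p)) = p"
    proof
      fix p assume "p \<in> W"
      then have p: "snd c p \<in> V'" "p \<in> fst c" by (auto simp: W_def)
      then have "g (snd c p) \<in> N" using homeomorphism_image2[OF g(5)] by blast
      then show "Psi A nabla H V q (g (snd c p)) = p"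
        using N(1) homeomorphism_apply2[OF g(5) p(1)] chart_inv_apply[OF c(1) p(2)] by simp
    qed
    show "Psi A nabla H V q ` N \<subseteq> W"
    proof (rule image_subsetI)
      fix u assume u: "u \<in> N"
      then have "\<phi> u \<in> snd c ` fst c" using N(2) V'sub by blast
      then show "Psi A nabla H V q u \<in> W"
        using N[OF u] chart_inv_mem[OF c(1)] apply_chart_inv[OF c(1)] by (simp add: W_def)
    qed
    show "(\<lambda>p. g (snd c p)) ` W \<subseteq> N" using imW homeomorphism_image2[OF g(5)] by blast
  qed
  have s\<phi>: "smooth_on N \<phi>" by (rule smooth_on_subset[OF \<phi> open_UNIV g(1) subset_UNIV])
  have cont: "continuous_on N (Psi A nabla H V q)"
  proof -
    have "continuous_on N (\<lambda>u. chart_inv c (\<phi> u))"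
      by (rule continuous_on_compose2[OF continuous_chart_inv[OF c(1)] smooth_on_imp_continuous_on[OF s\<phi>]])
         (use N(2) V'sub in blast)
    then show ?thesis by (rule continuous_on_eq) (simp add: N)
  qed
  have into: "smooth_into A N (Psi A nabla H V q)"
    unfolding smooth_into_def
  proof (intro conjI ballI cont)
    fix d assume d: "d \<in> A"
    let ?S = "{u \<in> N. Psi A nabla H V q u \<in> fst d}"
    have S: "open ?S"
      using continuous_open_preimage[OF cont g(1) chart_homeomorphism(1)[OF d]] by (simp add: vimage_def Int_def)
    have "smooth_on ?S (\<lambda>u. transition c d (\<phi> u))"
    proof (rule smooth_on_compose[OF S open_overlap[OF c(1) chart_homeomorphism(1)[OF d]] smooth_transition[OF c(1) d]])
      show "smooth_on ?S \<phi>" by (rule smooth_on_subset[OF s\<phi> g(1) S]) auto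
      show "\<phi> ` ?S \<subseteq> snd c ` (fst c \<inter> fst d)"
      proof (rule image_subsetI)
        fix u assume u: "u \<in> ?S"
        then have "\<phi> u \<in> snd c ` fst c" "chart_inv c (\<phi> u) \<in> fst d" using N V'sub by auto
        then show "\<phi> u \<in> snd c ` (fst c \<inter> fst d)"
          using apply_chart_inv[OF c(1)] chart_inv_mem[OF c(1)] by (metis IntI image_eqI)
      qed
    qed
    then show "smooth_on ?S (snd d \<circ> Psi A nabla H V q)"
      by (rule smooth_on_cong[OF S]) (simp add: N)
  qed
  have smooth_inv: "smooth_from A W (inv_into N (Psi A nabla H V q))"
  proof (rule smooth_from_localI[OF W])
    fix p assume p: "p \<in> W"
    have "smooth_on (snd c ` W) (inv_into N (Psi A nabla H V q) \<circ> chart_inv c)"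
      unfolding imW
    proof (rule smooth_on_cong[OF g(4,6)])
      fix y assume y: "y \<in> V'"
      have gy: "g y \<in> N" using homeomorphism_image2[OF g(5)] y by blast
      have "Psi A nabla H V q (g y) = chart_inv c y" using N(1)[OF gy] homeomorphism_apply2[OF g(5) y] by simp
      then show "g y = (inv_into N (Psi A nabla H V q) \<circ> chart_inv c) y"
        using inv_into_f_eq[OF bij_betw_imp_inj_on[OF bij] gy] by simp
    qed
    then show "\<exists>c\<in>A. \<exists>M. open M \<and> p \<in> M \<and> M \<subseteq> fst c \<and> smooth_on (snd c ` M) (inv_into N (Psi A nabla H V q) \<circ> chart_inv c)"
      using c(1) W p by (intro bexI[of _ c] exI[of _ W]) (auto simp: W_def)
  qed
  have Psi0: "Psi A nabla H V q 0 = q" using N(1)[OF g(3)] by (simp add: \<phi>0 chart_inv_apply c)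
  have "q \<in> W" using bij g(3) Psi0 by (metis bij_betwE)
  moreover have "N \<subseteq> Psi_domain A nabla H V q" using Psi g(2) by blast
  moreover have "diffeomorphism_into A N W (Psi A nabla H V q)"
    using bij into smooth_inv by (simp add: diffeomorphism_into_def)
  ultimately show thesis using that[of N W] g(1,3) W Psi0 by blast
qed

text \<open>For \<open>t \<noteq> 0\<close> this is the correspondence of solutions.  For \<open>t = 0\<close> it says that \<open>\<Psi>(0) = q\<close> and that
the problem with data \<open>(X, Y)\<close> has a solution at all; the latter follows by scaling from the
existence of solutions for small data.\<close>

lemma Psi_parabolic_scaling:
  assumes sp: "splitting (H q) (V q)" and X: "X \<in> H q" and Y: "Y \<in> V q"
  shows "t *\<^sub>R X + t\<^sup>2 *\<^sub>R Y \<in> Psi_domain A nabla H V q \<longleftrightarrow> t \<in> max_domain A nabla q X Y" (is "?A t")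
    and "Psi A nabla H V q (t *\<^sub>R X + t\<^sup>2 *\<^sub>R Y) = max_curve A nabla q X Y t" (is "?B t")
proof -
  interpret splitting "H q" "V q" by fact
  have comp: "component (H q) (V q) (t *\<^sub>R X + t\<^sup>2 *\<^sub>R Y) = t *\<^sub>R X"
    "component (V q) (H q) (t *\<^sub>R X + t\<^sup>2 *\<^sub>R Y) = t\<^sup>2 *\<^sub>R Y" for t
    by (rule component_sum; rule subspace_scale; fact subspace X Y)+
  have nz: "?A t \<and> ?B t" if "t \<noteq> 0" for t
    using max_curve_scale[OF that, of q X Y] by (simp add: Psi_domain_def Psi_def comp)
  have z: "?A 0 \<and> ?B 0"
  proof -
    obtain N where N: "open N" "0 \<in> N" "N \<subseteq> Psi_domain A nabla H V q" "Psi A nabla H V q 0 = q"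
      by (rule Psi_local_diffeomorphism[where H = H and V = V and q = q, OF sp]) (rule that)
    have "((\<lambda>t. t *\<^sub>R X + t\<^sup>2 *\<^sub>R Y) \<longlongrightarrow> 0) (at 0)"
      by (auto intro!: tendsto_eq_intros)
    then have "\<forall>\<^sub>F t in at 0. t *\<^sub>R X + t\<^sup>2 *\<^sub>R Y \<in> N"
      using N(1,2) by (rule topological_tendstoD)
    \<comment> \<open>Small data admit solutions up to time 1, so \<open>(X, Y)\<close> admits one up to the time \<open>d / 2\<close>.\<close>
    then obtain d :: real where "d > 0" "\<And>t. t \<noteq> 0 \<Longrightarrow> dist t 0 < d \<Longrightarrow> t *\<^sub>R X + t\<^sup>2 *\<^sub>R Y \<in> N"
      unfolding eventually_at by auto
    then have "(d / 2) *\<^sub>R X + (d / 2)\<^sup>2 *\<^sub>R Y \<in> N" "d / 2 \<noteq> 0" by auto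
    then have "d / 2 \<in> max_domain A nabla q X Y" using nz N(3) by blast
    then obtain I \<gamma> where s: "solves_ivp A nabla q X Y I \<gamma>" by (auto simp: max_domain_def)
    from max_curve_eq[OF s solves_ivpD(3)[OF s]] show ?thesis
      using N(2-4) solves_ivpD(5)[OF s] by auto
  qed
  show "?A t" "?B t" using nz z by (cases "t = 0"; simp)+
qed

end

theorem theorem3p1:
  fixes A :: "('m::{t2_space,second_countable_topology}, 'e::euclidean_space) chart set"
    and nabla :: "('m \<Rightarrow> 'e) \<Rightarrow> ('m \<Rightarrow> 'e) \<Rightarrow> 'm \<Rightarrow> 'e"
    and H V :: "'m \<Rightarrow> 'e set"
    and q :: 'm
  assumes "smooth_manifold A"
    and "linear_connection A nabla"
    and "distribution A H"
    and "distribution A V"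
    and "direct_sum_decomposition H V"
  shows "(\<exists>N W. open N \<and> 0 \<in> N \<and> open W \<and> q \<in> W \<and>
            N \<subseteq> Psi_domain A nabla H V q \<and>
            diffeomorphism_into A N W (Psi A nabla H V q)) \<and>
         (\<forall>X\<in>H q. \<forall>Y\<in>V q. \<forall>t::real.
            (t *\<^sub>R X + t\<^sup>2 *\<^sub>R Y \<in> Psi_domain A nabla H V q \<longleftrightarrow> t \<in> max_domain A nabla q X Y) \<and>
            (t \<in> max_domain A nabla q X Y \<longrightarrow>
               Psi A nabla H V q (t *\<^sub>R X + t\<^sup>2 *\<^sub>R Y) = max_curve A nabla q X Y t))"
proof -
  interpret connection_mfd A nabla
    by unfold_locales (use assms in auto)
  have sp: "splitting (H q) (V q)" by (rule distribution_splitting[OF assms(3-5)])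
  obtain N W where "open N" "0 \<in> N" "open W" "q \<in> W" "N \<subseteq> Psi_domain A nabla H V q"
    "diffeomorphism_into A N W (Psi A nabla H V q)"
    by (rule Psi_local_diffeomorphism[where H = H and V = V and q = q, OF sp]) (rule that)
  then show ?thesis
    by (intro conjI exI[of _ N] exI[of _ W] ballI allI impI Psi_parabolic_scaling[where H = H and V = V and q = q, OF sp])
qed

end
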